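(* A unitary representation $\pi$ of a group $G$ in a Hilbert space $\mathcal H$ is amenable if and only if at least one of the following holds: (a) $\pi$ contains a non-zero finite-dimensional subrepresentation; or (b) the $G$-space $(\mathbb S_{\mathcal H},G,\pi)$ has the concentration property.
   Context: As usual for unitary representations, Hilbert spaces are complex. $G$ is an abstract group; no topology on $G$ and no continuity of $\pi$ is assumed. $\mathbb S_{\mathcal H}$ is the unit sphere of $\mathcal H$, with the uniform structure given by the norm distance, on which $G$ acts by the operators $\pi(g)$. Amenable representation (Bekka): a unitary representation $\pi$ of $G$ in $\mathcal H$ is amenable if there is a $G$-invariant state on the algebra $\mathcal L(\mathcal H)$ of all bounded operators, i.e. a linear functional $\phi\in\mathcal L(\mathcal H)^*$ with $\phi\ge 0$, $\phi(\mathbb I)=1$ and $\phi(\pi(g)T\pi(g)^{-1})=\phi(T)$ for all $T\in\mathcal L(\mathcal H)$, $g\in G$. Subrepresentations are restrictions of $\pi$ to closed $G$-invariant subspaces. Concentration property: a set $A\subseteq\mathbb S_{\mathcal H}$ is essential if for every $\epsilon>0$ and every finite collection $g_1,\dots,g_n\in G$ one has $\bigcap_{i=1}^n\pi(g_i)\mathcal O_\epsilon(A)\ne\emptyset$, where $\mathcal O_\epsilon(A)$ is the $\epsilon$-neighbourhood of $A$ in $\mathbb S_{\mathcal H}$. The system $(\mathbb S_{\mathcal H},G,\pi)$ has the concentration property if every finite cover of $\mathbb S_{\mathcal H}$ by subsets contains an essential set. *)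

theory Defs
  imports "HOL-Analysis.Analysis" "HOL-Algebra.Group"
begin

text \<open>
  A complex inner product space is a real one with a complex scalar multiplication and a
  sesquilinear form (linear in the first argument) whose real part is the given real inner
  product.  In particular the norm is \<open>sqrt (Re (cinner x x))\<close>, and \<open>cinner x x\<close> is real
  by conjugate symmetry.
\<close>

class complex_inner = real_inner +
  fixes scaleC :: "complex \<Rightarrow> 'a \<Rightarrow> 'a" (infixr "*\<^sub>C" 75)
    and cinner :: "'a \<Rightarrow> 'a \<Rightarrow> complex"
  assumes scaleC_add_right: "c *\<^sub>C (x + y) = c *\<^sub>C x + c *\<^sub>C y"
    and scaleC_add_left: "(c + d) *\<^sub>C x = c *\<^sub>C x + d *\<^sub>C x"
    and scaleC_scaleC: "c *\<^sub>C d *\<^sub>C x = (c * d) *\<^sub>C x"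
    and scaleC_one: "1 *\<^sub>C x = x"
    and scaleR_scaleC: "r *\<^sub>R x = complex_of_real r *\<^sub>C x"
    and cinner_commute: "cinner x y = cnj (cinner y x)"
    and cinner_add_left: "cinner (x + y) z = cinner x z + cinner y z"
    and cinner_scaleC_left: "cinner (c *\<^sub>C x) y = c * cinner x y"
    and inner_eq_Re_cinner: "inner x y = Re (cinner x y)"

class complex_hilbert_space = complex_inner + banach

instantiation complex :: complex_hilbert_space
begin

definition scaleC_complex :: "complex \<Rightarrow> complex \<Rightarrow> complex"
  where "scaleC_complex c x = c * x"

definition cinner_complex :: "complex \<Rightarrow> complex \<Rightarrow> complex"
  where "cinner_complex x y = x * cnj y"

instance
  by standard
    (simp_all add: scaleC_complex_def cinner_complex_def algebra_simps inner_complex_def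
      scaleR_conv_of_real)

end

global_interpretation complex_vector:
  vector_space "scaleC :: complex \<Rightarrow> 'a \<Rightarrow> 'a::complex_inner"
  defines csubspace = complex_vector.subspace
    and cspan = complex_vector.span
  by unfold_locales (simp_all add: scaleC_add_right scaleC_add_left scaleC_scaleC scaleC_one)


definition bounded_clinear :: "('a::complex_inner \<Rightarrow> 'a) \<Rightarrow> bool" where
  "bounded_clinear T \<longleftrightarrow> bounded_linear T \<and> (\<forall>c x. T (c *\<^sub>C x) = c *\<^sub>C T x)"

definition positive_op :: "('a::complex_inner \<Rightarrow> 'a) \<Rightarrow> bool" where
  "positive_op T \<longleftrightarrow> bounded_clinear T \<and> (\<forall>x. cinner (T x) x \<in> \<real>\<^sub>\<ge>\<^sub>0)"

definition unitary_op :: "('a::complex_inner \<Rightarrow> 'a) \<Rightarrow> bool" where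
  "unitary_op U \<longleftrightarrow>
     bounded_clinear U \<and> surj U \<and> (\<forall>x y. cinner (U x) (U y) = cinner x y)"

definition unitary_group :: "('a::complex_inner \<Rightarrow> 'a) monoid" where
  "unitary_group = \<lparr>carrier = {U. unitary_op U}, mult = (\<circ>), one = id\<rparr>"

definition unitary_rep ::
  "('g, 'm) monoid_scheme \<Rightarrow> ('g \<Rightarrow> 'a::complex_inner \<Rightarrow> 'a) \<Rightarrow> bool" where
  "unitary_rep G \<pi> \<longleftrightarrow> \<pi> \<in> hom G unitary_group"


text \<open>
  Functionals on the algebra of bounded operators are total HOL functions of which only the
  values on bounded complex-linear operators matter.
\<close>

definition op_state :: "(('a::complex_inner \<Rightarrow> 'a) \<Rightarrow> complex) \<Rightarrow> bool" where
  "op_state \<phi> \<longleftrightarrow>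
     (\<forall>S T. bounded_clinear S \<longrightarrow> bounded_clinear T \<longrightarrow> \<phi> (\<lambda>x. S x + T x) = \<phi> S + \<phi> T) \<and>
     (\<forall>c T. bounded_clinear T \<longrightarrow> \<phi> (\<lambda>x. c *\<^sub>C T x) = c * \<phi> T) \<and>
     (\<exists>K. \<forall>T. bounded_clinear T \<longrightarrow> cmod (\<phi> T) \<le> K * onorm T) \<and>
     (\<forall>T. positive_op T \<longrightarrow> \<phi> T \<in> \<real>\<^sub>\<ge>\<^sub>0) \<and>
     \<phi> id = 1"

definition amenable_rep ::
  "('g, 'm) monoid_scheme \<Rightarrow> ('g \<Rightarrow> 'a::complex_inner \<Rightarrow> 'a) \<Rightarrow> bool" where
  "amenable_rep G \<pi> \<longleftrightarrow>
     (\<exists>\<phi>. op_state \<phi> \<and>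
        (\<forall>g\<in>carrier G. \<forall>T. bounded_clinear T \<longrightarrow>
           \<phi> (\<pi> g \<circ> T \<circ> inv_into UNIV (\<pi> g)) = \<phi> T))"


definition subrep ::
  "('g, 'm) monoid_scheme \<Rightarrow> ('g \<Rightarrow> 'a::complex_inner \<Rightarrow> 'a) \<Rightarrow> 'a set \<Rightarrow> bool" where
  "subrep G \<pi> V \<longleftrightarrow> csubspace V \<and> closed V \<and> (\<forall>g\<in>carrier G. \<pi> g ` V \<subseteq> V)"

definition cfinite_dim :: "'a::complex_inner set \<Rightarrow> bool" where
  "cfinite_dim V \<longleftrightarrow> (\<exists>B. finite B \<and> cspan B = V)"


text \<open>
  In the following, \<open>X\<close> is a subset of a metric space on which \<open>G\<close> acts by the maps \<open>\<pi> g\<close>,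
  and neighbourhoods are taken within \<open>X\<close>.
\<close>

definition nbhd_in :: "'a::metric_space set \<Rightarrow> real \<Rightarrow> 'a set \<Rightarrow> 'a set" where
  "nbhd_in X \<epsilon> A = {x \<in> X. \<exists>a\<in>A. dist x a < \<epsilon>}"

text \<open>
  The family of group elements is required to be nonempty because in HOL the intersection of
  the empty family is \<open>UNIV\<close> rather than \<open>X\<close>.
\<close>

definition essential ::
  "'a::metric_space set \<Rightarrow> ('g, 'm) monoid_scheme \<Rightarrow> ('g \<Rightarrow> 'a \<Rightarrow> 'a) \<Rightarrow> 'a set \<Rightarrow> bool" where
  "essential X G \<pi> A \<longleftrightarrow>
     (\<forall>\<epsilon>>0. \<forall>F. finite F \<longrightarrow> F \<noteq> {} \<longrightarrow> F \<subseteq> carrier G \<longrightarrow>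
        (\<Inter>g\<in>F. \<pi> g ` nbhd_in X \<epsilon> A) \<noteq> {})"

definition concentration_property ::
  "'a::metric_space set \<Rightarrow> ('g, 'm) monoid_scheme \<Rightarrow> ('g \<Rightarrow> 'a \<Rightarrow> 'a) \<Rightarrow> bool" where
  "concentration_property X G \<pi> \<longleftrightarrow>
     (\<forall>\<C>. finite \<C> \<longrightarrow> (\<forall>A\<in>\<C>. A \<subseteq> X) \<longrightarrow> \<Union>\<C> = X \<longrightarrow> (\<exists>A\<in>\<C>. essential X G \<pi> A))"

end

theory Submission
  imports Defs
begin

text \<open>
  A finite-dimensional subrepresentation gives the normalised trace as an invariant state. Under the
  concentration property a compactness argument in the space of functionals produces a limit \<open>\<phi>\<close> of the vector
  states \<open>T \<mapsto> cinner (T \<xi>) \<xi>\<close> such that every neighbourhood of \<open>\<phi>\<close> is hit by an essential set of \<open>\<xi>\<close>; this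
  forces \<open>\<phi>\<close> to be an invariant state.

  Conversely, let \<open>\<phi>\<close> be an invariant state and suppose that there is no finite-dimensional subrepresentation.
  Then \<open>\<phi>\<close> vanishes on rank one operators, since otherwise the top eigenspace of the invariant trace class
  form \<open>v \<mapsto> \<phi> (rank_one v)\<close> would be a finite-dimensional subrepresentation. By a minimax argument there are
  finite tuples of vectors, of total squared norm one and with Gram matrix of small Hilbert-Schmidt norm, whose
  covariance operators are almost invariant in trace norm. A Procrustes argument replaces the action of a group
  element on the tuple by an orthogonal matrix, and averaging over a fine minimal net of the orthogonal group
  replaces the orthogonal matrix by a permutation (Hall's theorem). For such a tuple \<open>v\<close> the random sum
  \<open>\<Sum>x. \<plusminus> v x\<close> with independent signs concentrates: a one-sided Efron-Stein inequality on the cube bounds the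
  variance of the squared distance to a subset of the sphere, which is semiconcave. Since the law of the signs
  is invariant under permutations, the sum and its translates by the group elements are simultaneously close
  to any set of the cover that has non-negligible probability.
\<close>

section \<open>Complex inner product spaces and unitary representations\<close>

text \<open>Random signs keep all probability inside counting on a finite cube. The price is that
  the law of the signs is invariant under permutations of a tuple but not under general orthogonal
  matrices, hence the net of the orthogonal group. Signs are real, so tuples, matrices and
  contractions live over the underlying real space; since a state sees only complex linear
  operators, the complex structure is restored by letting x and i x enter with equal weight. Trace
  norm closeness of covariance operators is stated by duality, as a bound for every real contraction
  Z: minimax produces it in this form, and the Procrustes step uses it for one particular Z, a
  Cayley transform. The Gram matrix must be small because a sum dominated by few vectors does not
  concentrate; vanishing of the state on rank one operators allows a new tuple to be chosen nearly
  orthogonal to all earlier ones, and many such tuples are put side by side. The variance inequality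
  is one-sided since a squared distance has a quadratic bound from above but none from
  below.\<close>

lemma cinner_scaleC_right: "cinner x (c *\<^sub>C y) = cnj c * cinner x y"
  by (metis cinner_commute cinner_scaleC_left complex_cnj_mult)

lemma cinner_add_right: "cinner x (y + z) = cinner x y + cinner x z"
  by (metis cinner_add_left cinner_commute complex_cnj_add)

lemma scaleC_minus1: "(- 1) *\<^sub>C x = - (x :: 'a::complex_inner)"
  using scaleR_scaleC[of "-1" x] by simp

lemma cinner_minus_left: "cinner (- x) y = - cinner x y"
  by (metis cinner_scaleC_left mult_minus1 scaleC_minus1)

lemma cinner_minus_right: "cinner x (- y) = - cinner x y"
  by (metis cinner_commute cinner_minus_left complex_cnj_minus)

lemma cinner_diff_left: "cinner (x - y) z = cinner x z - cinner y z"
  using cinner_add_left[of x "- y" z] by (simp add: cinner_minus_left)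

lemma cinner_diff_right: "cinner x (y - z) = cinner x y - cinner x z"
  using cinner_add_right[of x y "- z"] by (simp add: cinner_minus_right)

lemma cinner_zero_left [simp]: "cinner 0 y = 0"
  using cinner_diff_left[of y y y] by simp

lemma cinner_zero_right [simp]: "cinner x 0 = 0"
  using cinner_diff_right[of x x x] by simp

lemma cinner_sum_left: "cinner (sum f A) y = (\<Sum>i\<in>A. cinner (f i) y)"
  by (induction A rule: infinite_finite_induct) (auto simp: cinner_add_left)

lemma cinner_sum_right: "cinner x (sum f A) = (\<Sum>i\<in>A. cinner x (f i))"
  by (induction A rule: infinite_finite_induct) (auto simp: cinner_add_right)

lemma cinner_self: "cinner x x = complex_of_real ((norm x)\<^sup>2)"
proof (rule complex_eqI)
  show "Im (cinner x x) = Im (complex_of_real ((norm x)\<^sup>2))"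
    using cinner_commute[of x x] by (simp add: complex_eq_iff)
qed (simp add: power2_norm_eq_inner inner_eq_Re_cinner)

lemma Im_cinner: "Im (cinner x y) = x \<bullet> (\<i> *\<^sub>C y)"
  by (simp add: inner_eq_Re_cinner cinner_scaleC_right)

lemma norm_scaleC: "norm (c *\<^sub>C x) = cmod c * norm (x :: 'a::complex_inner)"
proof -
  have "complex_of_real ((norm (c *\<^sub>C x))\<^sup>2) = complex_of_real ((cmod c * norm x)\<^sup>2)"
  proof -
    have "cinner (c *\<^sub>C x) (c *\<^sub>C x) = (c * cnj c) * cinner x x"
      by (simp only: cinner_scaleC_left cinner_scaleC_right mult_ac)
    also have "\<dots> = complex_of_real ((cmod c)\<^sup>2) * complex_of_real ((norm x)\<^sup>2)"
      by (simp only: complex_norm_square cinner_self)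
    finally show ?thesis by (simp add: cinner_self power_mult_distrib)
  qed
  then show ?thesis by (simp only: of_real_eq_iff power2_eq_iff_nonneg norm_ge_zero mult_nonneg_nonneg)
qed

lemma scaleC_zero_right [simp]: "c *\<^sub>C (0 :: 'a::complex_inner) = 0"
  using complex_vector.scale_zero_right .

lemma scaleC_zero_left [simp]: "0 *\<^sub>C (x :: 'a::complex_inner) = 0"
  using complex_vector.scale_zero_left .

lemma scaleC_one' [simp]: "1 *\<^sub>C (x :: 'a::complex_inner) = x"
  by (rule scaleC_one)

lemma norm_cinner_le: "cmod (cinner x y) \<le> norm x * norm y"
proof (cases "cinner x y = 0")
  case False
  \<comment> \<open>The phase \<open>c\<close> makes the inner product real and nonnegative, so that
    the real Cauchy-Schwarz inequality applies.\<close>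
  define c where "c = cnj (sgn (cinner x y))"
  have "complex_of_real (cmod (cinner x y)) = cinner (c *\<^sub>C x) y"
    using False by (simp add: c_def cinner_scaleC_left sgn_div_norm complex_norm_square[symmetric]
      scaleR_conv_of_real power2_eq_square field_simps)
  then have "cmod (cinner x y) = (c *\<^sub>C x) \<bullet> y" by (metis Re_complex_of_real inner_eq_Re_cinner)
  also have "\<dots> \<le> norm (c *\<^sub>C x) * norm y" by (rule norm_cauchy_schwarz)
  also have "norm (c *\<^sub>C x) = norm x" using False by (simp add: norm_scaleC c_def norm_sgn)
  finally show ?thesis .
qed simp

lemma scaleC_scaleR_commute: "c *\<^sub>C (r *\<^sub>R x) = r *\<^sub>R (c *\<^sub>C (x :: 'a::complex_inner))"
  by (simp add: scaleR_scaleC scaleC_scaleC mult.commute)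

lemma scaleC_Re_Im: "c *\<^sub>C x = Re c *\<^sub>R x + Im c *\<^sub>R (\<i> *\<^sub>C (x :: 'a::complex_inner))"
proof -
  have "c = complex_of_real (Re c) + complex_of_real (Im c) * \<i>"
    by (simp add: complex_eq_iff)
  then have "c *\<^sub>C x = (complex_of_real (Re c) + complex_of_real (Im c) * \<i>) *\<^sub>C x"
    by (rule arg_cong)
  then show ?thesis by (simp only: scaleC_add_left scaleR_scaleC scaleC_scaleC)
qed

lemma bounded_linear_scaleC: "bounded_linear (\<lambda>x :: 'a::complex_inner. c *\<^sub>C x)"
  by (rule bounded_linear_intro[of _ "cmod c"])
    (simp_all add: scaleC_add_right scaleC_scaleR_commute norm_scaleC mult.commute)

lemma bounded_clinearI:
  assumes "\<And>x y. T (x + y) = T x + T y" "\<And>c x. T (c *\<^sub>C x) = c *\<^sub>C T x" "\<And>x. norm (T x) \<le> norm x * K"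
  shows "bounded_clinear (T :: 'a::complex_inner \<Rightarrow> 'a)"
  unfolding bounded_clinear_def
  using assms by (intro conjI allI bounded_linear_intro[of T K]) (simp_all add: scaleR_scaleC)

lemma bounded_clinear_id: "bounded_clinear id"
  by (simp add: bounded_clinear_def bounded_linear_ident[unfolded id_def[symmetric]])

lemma bounded_clinear_zero: "bounded_clinear (\<lambda>x. 0)"
  by (simp add: bounded_clinear_def)

lemma bounded_clinear_add: "bounded_clinear S \<Longrightarrow> bounded_clinear T \<Longrightarrow> bounded_clinear (\<lambda>x. S x + T x)"
  by (simp add: bounded_clinear_def bounded_linear_add scaleC_add_right)

lemma bounded_clinear_scaleC: "bounded_clinear T \<Longrightarrow> bounded_clinear (\<lambda>x. c *\<^sub>C T x)"
  by (simp add: bounded_clinear_def bounded_linear_compose[OF bounded_linear_scaleC] scaleC_scaleC mult.commute)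

lemma bounded_clinear_diff:
  assumes "bounded_clinear S" "bounded_clinear T"
  shows "bounded_clinear (\<lambda>x. S x - T x)"
  using bounded_clinear_add[OF assms(1) bounded_clinear_scaleC[OF assms(2), of "-1"]]
  by (simp add: scaleC_minus1)

lemma bounded_clinear_sum:
  "(\<And>i. i \<in> I \<Longrightarrow> bounded_clinear (T i)) \<Longrightarrow> bounded_clinear (\<lambda>x. \<Sum>i\<in>I. T i x)"
  by (induction I rule: infinite_finite_induct) (auto intro: bounded_clinear_add bounded_clinear_zero)

lemma bounded_clinear_compose: "bounded_clinear S \<Longrightarrow> bounded_clinear T \<Longrightarrow> bounded_clinear (S \<circ> T)"
  by (simp add: bounded_clinear_def bounded_linear_compose o_def)

definition rank_one :: "'a::complex_inner \<Rightarrow> 'a \<Rightarrow> 'a" where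
  "rank_one v x = cinner x v *\<^sub>C v"

lemma bounded_clinear_rank_one: "bounded_clinear (rank_one v)"
proof (rule bounded_clinearI)
  show "norm (rank_one v x) \<le> norm x * (norm v * norm v)" for x
    using mult_right_mono[OF norm_cinner_le[of x v], of "norm v"] by (simp add: rank_one_def norm_scaleC mult.assoc)
qed (simp_all add: rank_one_def cinner_add_left cinner_scaleC_left scaleC_add_left scaleC_scaleC)

lemma cinner_rank_one: "cinner (rank_one v x) x = complex_of_real ((cmod (cinner x v))\<^sup>2)"
  unfolding rank_one_def cinner_scaleC_left complex_norm_square
  by (simp add: cinner_commute[of v x])

lemma positive_op_rank_one: "positive_op (rank_one v)"
  by (simp add: positive_op_def bounded_clinear_rank_one cinner_rank_one complex_nonneg_Reals_iff)

locale unitary_representation =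
  fixes G :: "('g, 'm) monoid_scheme" and \<pi> :: "'g \<Rightarrow> 'a::complex_hilbert_space \<Rightarrow> 'a"
  assumes group_G: "group G" and rep: "unitary_rep G \<pi>"
begin

lemma unitary: "g \<in> carrier G \<Longrightarrow> unitary_op (\<pi> g)"
  using rep by (auto simp: unitary_rep_def unitary_group_def hom_def)

lemma mult: "g \<in> carrier G \<Longrightarrow> h \<in> carrier G \<Longrightarrow> \<pi> (g \<otimes>\<^bsub>G\<^esub> h) = \<pi> g \<circ> \<pi> h"
  using rep by (auto simp: unitary_rep_def unitary_group_def hom_def)

lemma one: "\<pi> \<one>\<^bsub>G\<^esub> = id"
proof
  fix x
  interpret group G by (rule group_G)
  \<comment> \<open>Membership in \<open>hom\<close> only gives multiplicativity. The image of the
    unit is idempotent, and a surjective idempotent map is the identity.\<close>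
  have "surj (\<pi> \<one>\<^bsub>G\<^esub>)" using unitary[of "\<one>\<^bsub>G\<^esub>"] by (simp add: unitary_op_def)
  then obtain y where "x = \<pi> \<one>\<^bsub>G\<^esub> y" by blast
  then show "\<pi> \<one>\<^bsub>G\<^esub> x = id x" using mult[of "\<one>\<^bsub>G\<^esub>" "\<one>\<^bsub>G\<^esub>"] by (simp add: fun_eq_iff)
qed

lemma inv_closed: "g \<in> carrier G \<Longrightarrow> inv\<^bsub>G\<^esub> g \<in> carrier G"
  using group_G by (rule group.inv_closed)

lemma inv_cancel:
  assumes "g \<in> carrier G"
  shows "\<pi> (inv\<^bsub>G\<^esub> g) (\<pi> g x) = x" "\<pi> g (\<pi> (inv\<^bsub>G\<^esub> g) x) = x"
  using mult[of "inv\<^bsub>G\<^esub> g" g] mult[of g "inv\<^bsub>G\<^esub> g"] one assms group_G inv_closed[OF assms]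
  by (auto simp: fun_eq_iff group.l_inv group.r_inv)

lemma inv_into_eq: "g \<in> carrier G \<Longrightarrow> inv_into UNIV (\<pi> g) = \<pi> (inv\<^bsub>G\<^esub> g)"
  by (rule inv_equality) (simp_all add: inv_cancel)

lemma bounded_clinear: "g \<in> carrier G \<Longrightarrow> bounded_clinear (\<pi> g)"
  using unitary by (simp add: unitary_op_def)

lemma linear: "g \<in> carrier G \<Longrightarrow> linear (\<pi> g)"
  using bounded_clinear by (simp add: bounded_clinear_def bounded_linear.linear)

lemma scaleC: "g \<in> carrier G \<Longrightarrow> \<pi> g (c *\<^sub>C x) = c *\<^sub>C \<pi> g x"
  using bounded_clinear by (simp add: bounded_clinear_def)

lemma cinner: "g \<in> carrier G \<Longrightarrow> cinner (\<pi> g x) (\<pi> g y) = cinner x y"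
  using unitary by (simp add: unitary_op_def)

lemma norm: "g \<in> carrier G \<Longrightarrow> norm (\<pi> g x) = norm x"
  using cinner[of g x x] unfolding cinner_self by (simp only: of_real_eq_iff power2_eq_iff_nonneg norm_ge_zero)

lemma cinner_inv: "g \<in> carrier G \<Longrightarrow> cinner (\<pi> (inv\<^bsub>G\<^esub> g) x) y = cinner x (\<pi> g y)"
  using cinner[of g "\<pi> (inv\<^bsub>G\<^esub> g) x" y] by (simp add: inv_cancel)

text \<open>Turns invariance of a state under conjugation into invariance of the quadratic form
  \<open>\<phi> (rank_one v)\<close> under v \<mapsto> \<open>\<pi> g v\<close>.\<close>

lemma rank_one_conj:
  assumes "g \<in> carrier G"
  shows "rank_one (\<pi> g v) = \<pi> g \<circ> rank_one v \<circ> inv_into UNIV (\<pi> g)"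
  using assms by (simp add: fun_eq_iff rank_one_def inv_into_eq scaleC cinner_inv)

end

section \<open>Finite orthonormal sets and orthogonal projections\<close>

definition corthonormal :: "'a::complex_inner set \<Rightarrow> bool" where
  "corthonormal B \<longleftrightarrow> (\<forall>x\<in>B. \<forall>y\<in>B. cinner x y = of_bool (x = y))"

definition cproj :: "'a::complex_inner set \<Rightarrow> 'a \<Rightarrow> 'a" where
  "cproj B x = (\<Sum>b\<in>B. rank_one b x)"

lemma cinner_cproj:
  assumes "finite B" "corthonormal B" "b \<in> B"
  shows "cinner (cproj B x) b = cinner x b"
proof -
  have "cinner (cproj B x) b = (\<Sum>e\<in>B. if e = b then cinner x b else 0)"
    unfolding cproj_def cinner_sum_left
    using assms by (intro sum.cong) (auto simp: rank_one_def cinner_scaleC_left corthonormal_def)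
  then show ?thesis using assms by simp
qed

lemma cproj_perp:
  assumes "finite B" "corthonormal B" "b \<in> B"
  shows "cinner (x - cproj B x) b = 0"
  using cinner_cproj[OF assms] by (simp add: cinner_diff_left)

lemma cproj_pythagoras:
  assumes "finite B" "corthonormal B"
  shows "(norm x)\<^sup>2 = (\<Sum>b\<in>B. (cmod (cinner x b))\<^sup>2) + (norm (x - cproj B x))\<^sup>2"
proof -
  have "cinner (x - cproj B x) (\<Sum>b\<in>B. rank_one b x) = 0"
    unfolding cinner_sum_right
    by (intro sum.neutral) (simp add: rank_one_def cinner_scaleC_right cproj_perp[OF assms])
  then have 1: "cinner (x - cproj B x) (cproj B x) = 0" by (simp only: cproj_def[symmetric])
  have "cinner (cproj B x) x = complex_of_real (\<Sum>b\<in>B. (cmod (cinner x b))\<^sup>2)"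
    unfolding cproj_def cinner_sum_left by (simp add: cinner_rank_one)
  then have 2: "cinner x (cproj B x) = complex_of_real (\<Sum>b\<in>B. (cmod (cinner x b))\<^sup>2)"
    by (metis cinner_commute complex_cnj_complex_of_real)
  have "cinner (x - cproj B x) (x - cproj B x) = cinner (x - cproj B x) x"
    using 1 by (simp add: cinner_diff_right)
  also have "\<dots> = cinner x x - complex_of_real (\<Sum>b\<in>B. (cmod (cinner x b))\<^sup>2)"
    using 2 cinner_commute[of "cproj B x" x] by (simp add: cinner_diff_left)
  finally have "complex_of_real ((norm (x - cproj B x))\<^sup>2)
      = complex_of_real ((norm x)\<^sup>2 - (\<Sum>b\<in>B. (cmod (cinner x b))\<^sup>2))"
    unfolding cinner_self by simp
  then show ?thesis by (simp only: of_real_eq_iff)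
qed

lemma corthonormal_norm:
  assumes "corthonormal B" "b \<in> B"
  shows "norm b = 1"
proof -
  have "complex_of_real ((norm b)\<^sup>2) = 1"
    using assms unfolding cinner_self[symmetric] by (simp add: corthonormal_def)
  then have "(norm b)\<^sup>2 = 1\<^sup>2" by (simp only: of_real_eq_1_iff power_one)
  then show ?thesis by (rule power2_eq_imp_eq) auto
qed

lemma corthonormal_insert:
  assumes "corthonormal B" "norm x = 1" "\<And>b. b \<in> B \<Longrightarrow> cinner x b = 0"
  shows "corthonormal (insert x B)" "x \<notin> B"
proof -
  have "cinner b x = 0" if "b \<in> B" for b using assms(3)[OF that] by (metis cinner_commute complex_cnj_zero)
  moreover have "cinner x x = 1" using assms(2) by (simp add: cinner_self)
  ultimately show "corthonormal (insert x B)" "x \<notin> B" using assms by (auto simp: corthonormal_def)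
qed

text \<open>The set \<open>S\<close> need not be a subspace: besides subspaces, the lemma serves for
  a set on which a quadratic form exceeds a threshold. A uniform bound on cardinalities replaces
  Zorn's lemma.\<close>

lemma maximal_corthonormal:
  fixes S :: "'a::complex_inner set"
  assumes "\<And>B. finite B \<Longrightarrow> corthonormal B \<Longrightarrow> B \<subseteq> S \<Longrightarrow> card B \<le> n"
  obtains B where "finite B" "corthonormal B" "B \<subseteq> S"
    "\<And>x. x \<in> S \<Longrightarrow> norm x = 1 \<Longrightarrow> \<exists>b\<in>B. cinner x b \<noteq> 0"
proof -
  define P where "P = (\<lambda>B. finite B \<and> corthonormal B \<and> B \<subseteq> S)"
  have "P {}" by (simp add: P_def corthonormal_def)
  then obtain B where B: "P B" "\<And>B'. P B' \<Longrightarrow> card B' \<le> card B"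
    using ex_has_greatest_nat[of P "{}" card "Suc n"] assms unfolding P_def less_Suc_eq_le by blast
  show thesis
  proof (rule that)
    fix x assume x: "x \<in> S" "norm x = 1"
    show "\<exists>b\<in>B. cinner x b \<noteq> 0"
    proof (rule ccontr)
      assume "\<not> (\<exists>b\<in>B. cinner x b \<noteq> 0)"
      then have "P (insert x B)" "x \<notin> B" using corthonormal_insert[of B x] B(1) x by (auto simp: P_def)
      then show False using B(2)[of "insert x B"] B(1) by (simp add: P_def)
    qed
  qed (use B in \<open>auto simp: P_def\<close>)
qed

lemma cproj_in_csubspace:
  assumes "csubspace V" "B \<subseteq> V"
  shows "cproj B x \<in> V"
  unfolding cproj_def rank_one_def
  using assms by (intro complex_vector.subspace_sum complex_vector.subspace_scale) auto

lemma csubspace_corthonormal_basis: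
  fixes V :: "'a::complex_inner set"
  assumes V: "csubspace V" and "\<And>B. finite B \<Longrightarrow> corthonormal B \<Longrightarrow> B \<subseteq> V \<Longrightarrow> card B \<le> n"
  obtains B where "finite B" "corthonormal B" "B \<subseteq> V" "\<And>v. v \<in> V \<Longrightarrow> cproj B v = v"
proof -
  obtain B where B: "finite B" "corthonormal B" "B \<subseteq> V"
    "\<And>x. x \<in> V \<Longrightarrow> norm x = 1 \<Longrightarrow> \<exists>b\<in>B. cinner x b \<noteq> 0"
    using maximal_corthonormal[of V n] assms(2) by blast
  show thesis
  proof (rule that[OF B(1-3)], rule ccontr)
    fix v assume v: "v \<in> V" "cproj B v \<noteq> v"
    define u where "u = v - cproj B v"
    have "u \<noteq> 0" using v by (simp add: u_def)
    have "u \<in> V" using v cproj_in_csubspace[OF V B(3)] V by (simp add: u_def complex_vector.subspace_diff)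
    then have "complex_of_real (1 / norm u) *\<^sub>C u \<in> V" using V by (simp add: complex_vector.subspace_scale)
    moreover have "norm (complex_of_real (1 / norm u) *\<^sub>C u) = 1"
      using \<open>u \<noteq> 0\<close> by (simp add: norm_scaleC norm_divide)
    ultimately obtain b where "b \<in> B" "cinner (complex_of_real (1 / norm u) *\<^sub>C u) b \<noteq> 0" using B(4) by blast
    then show False using cproj_perp[OF B(1,2), of b v] by (simp add: cinner_scaleC_left u_def)
  qed
qed

lemma corthonormal_independent:
  assumes "finite B" "corthonormal B"
  shows "complex_vector.independent B"
  unfolding complex_vector.dependent_finite[OF assms(1)]
proof clarify
  fix u v assume uv: "(\<Sum>w\<in>B. u w *\<^sub>C w) = 0" "v \<in> B" "u v \<noteq> 0"
  have "cinner (\<Sum>w\<in>B. u w *\<^sub>C w) v = (\<Sum>w\<in>B. if w = v then u v else 0)"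
    unfolding cinner_sum_left
    using assms uv by (intro sum.cong) (auto simp: cinner_scaleC_left corthonormal_def)
  then show False using uv assms by simp
qed

section \<open>Orthogonal matrices and tuples of vectors\<close>

text \<open>Matrices are functions on pairs that vanish outside the k by k block, which puts them in
  a compact box of a product space. Row and column relations are both demanded, so that closure
  under transposition is immediate.\<close>

definition orth :: "nat \<Rightarrow> (nat \<times> nat \<Rightarrow> real) set" where
  "orth k = {U. (\<forall>i<k. \<forall>j<k. (\<Sum>l<k. U (l, i) * U (l, j)) = of_bool (i = j)) \<and>
                (\<forall>i<k. \<forall>j<k. (\<Sum>l<k. U (i, l) * U (j, l)) = of_bool (i = j)) \<and>
                (\<forall>i j. \<not> (i < k \<and> j < k) \<longrightarrow> U (i, j) = 0)}"

definition mat_mult :: "nat \<Rightarrow> (nat \<times> nat \<Rightarrow> real) \<Rightarrow> (nat \<times> nat \<Rightarrow> real) \<Rightarrow> nat \<times> nat \<Rightarrow> real" where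
  "mat_mult k U V = (\<lambda>(i, j). if i < k \<and> j < k then \<Sum>l<k. U (i, l) * V (l, j) else 0)"

definition mat_tr :: "(nat \<times> nat \<Rightarrow> real) \<Rightarrow> nat \<times> nat \<Rightarrow> real" where
  "mat_tr U = (\<lambda>(i, j). U (j, i))"

lemma mat_tr_apply [simp]: "mat_tr U (i, j) = U (j, i)"
  by (simp add: mat_tr_def)

lemma mat_tr_orth: "U \<in> orth k \<Longrightarrow> mat_tr U \<in> orth k"
  by (simp add: orth_def) blast

lemma sum_of_bool_scaleR:
  fixes x :: "nat \<Rightarrow> 'a::real_vector"
  assumes "i < k"
  shows "(\<Sum>l<k. of_bool (i = l) *\<^sub>R x l) = x i" "(\<Sum>l<k. of_bool (l = i) *\<^sub>R x l) = x i"
proof -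
  have "(\<Sum>l<k. of_bool (i = l) *\<^sub>R x l) = (\<Sum>l<k. if l = i then x l else 0)"
    by (intro sum.cong) auto
  then show "(\<Sum>l<k. of_bool (i = l) *\<^sub>R x l) = x i" using assms by simp
  have "(\<Sum>l<k. of_bool (l = i) *\<^sub>R x l) = (\<Sum>l<k. if l = i then x l else 0)"
    by (intro sum.cong) auto
  then show "(\<Sum>l<k. of_bool (l = i) *\<^sub>R x l) = x i" using assms by simp
qed

lemma orth_inner:
  fixes x y :: "nat \<Rightarrow> 'a::real_inner"
  assumes "U \<in> orth k"
  shows "(\<Sum>l<k. (\<Sum>i<k. U (l, i) *\<^sub>R x i) \<bullet> (\<Sum>j<k. U (l, j) *\<^sub>R y j)) = (\<Sum>i<k. x i \<bullet> y i)"
proof -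
  have "(\<Sum>l<k. (\<Sum>i<k. U (l, i) *\<^sub>R x i) \<bullet> (\<Sum>j<k. U (l, j) *\<^sub>R y j))
      = (\<Sum>l<k. \<Sum>i<k. \<Sum>j<k. (U (l, i) * U (l, j)) * (x i \<bullet> y j))"
    unfolding inner_sum_left unfolding inner_sum_right by (simp add: mult_ac)
  also have "\<dots> = (\<Sum>i<k. \<Sum>l<k. \<Sum>j<k. (U (l, i) * U (l, j)) * (x i \<bullet> y j))"
    by (rule sum.swap)
  also have "\<dots> = (\<Sum>i<k. \<Sum>j<k. \<Sum>l<k. (U (l, i) * U (l, j)) * (x i \<bullet> y j))"
    by (intro sum.cong refl sum.swap)
  also have "\<dots> = (\<Sum>i<k. \<Sum>j<k. of_bool (i = j) *\<^sub>R (x i \<bullet> y j))"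
    using assms by (intro sum.cong refl) (simp add: orth_def flip: sum_distrib_right)
  also have "\<dots> = (\<Sum>i<k. x i \<bullet> y i)"
    by (intro sum.cong refl) (simp only: sum_of_bool_scaleR lessThan_iff)
  finally show ?thesis .
qed

lemma orth_inner_tr:
  fixes x y :: "nat \<Rightarrow> 'a::real_inner"
  assumes "U \<in> orth k"
  shows "(\<Sum>l<k. (\<Sum>i<k. U (i, l) *\<^sub>R x i) \<bullet> (\<Sum>j<k. U (j, l) *\<^sub>R y j)) = (\<Sum>i<k. x i \<bullet> y i)"
  using orth_inner[OF mat_tr_orth[OF assms], of x y] by simp

lemma mat_mult_orth:
  assumes "U \<in> orth k" "V \<in> orth k"
  shows "mat_mult k U V \<in> orth k"
proof -
  have 1: "(\<Sum>l<k. mat_mult k U V (l, i) * mat_mult k U V (l, j)) = of_bool (i = j)"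
    if "i < k" "j < k" for i j
  proof -
    have "(\<Sum>l<k. mat_mult k U V (l, i) * mat_mult k U V (l, j)) = (\<Sum>l<k. V (l, i) * V (l, j))"
      using orth_inner[OF assms(1), of "\<lambda>l. V (l, i)" "\<lambda>l. V (l, j)"] that
      by (simp add: mat_mult_def)
    then show ?thesis using assms(2) that by (simp add: orth_def)
  qed
  have 2: "(\<Sum>l<k. mat_mult k U V (i, l) * mat_mult k U V (j, l)) = of_bool (i = j)"
    if "i < k" "j < k" for i j
  proof -
    have "(\<Sum>l<k. mat_mult k U V (i, l) * mat_mult k U V (j, l)) = (\<Sum>l<k. U (i, l) * U (j, l))"
      using orth_inner_tr[OF assms(2), of "\<lambda>l. U (i, l)" "\<lambda>l. U (j, l)"] that
      by (simp add: mat_mult_def mult.commute)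
    then show ?thesis using assms(1) that by (simp add: orth_def)
  qed
  show ?thesis using 1 2 by (auto simp: orth_def mat_mult_def)
qed

lemma mat_mult_tr_cancel:
  assumes "G \<in> orth k" "Z \<in> orth k"
  shows "mat_mult k G (mat_mult k (mat_tr G) Z) = Z"
proof
  fix p :: "nat \<times> nat"
  obtain i j where p: "p = (i, j)" by fastforce
  show "mat_mult k G (mat_mult k (mat_tr G) Z) p = Z p"
  proof (cases "i < k \<and> j < k")
    case True
    then have "mat_mult k G (mat_mult k (mat_tr G) Z) p = (\<Sum>l<k. \<Sum>m<k. (G (i, l) * G (m, l)) * Z (m, j))"
      by (simp add: p mat_mult_def sum_distrib_left mult.assoc)
    also have "\<dots> = (\<Sum>m<k. \<Sum>l<k. (G (i, l) * G (m, l)) * Z (m, j))" by (rule sum.swap)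
    also have "\<dots> = (\<Sum>m<k. of_bool (i = m) *\<^sub>R Z (m, j))"
      using assms(1) True by (intro sum.cong refl) (simp add: orth_def flip: sum_distrib_right)
    also have "\<dots> = Z (i, j)" using True by (simp only: sum_of_bool_scaleR)
    finally show ?thesis by (simp add: p)
  next
    case False
    then show ?thesis using assms(2) by (auto simp: p mat_mult_def orth_def)
  qed
qed

lemma orth_one: "(\<lambda>(i, j). of_bool (i = j \<and> i < k)) \<in> orth k"
proof -
  have "(\<Sum>l<k. of_bool (l = i) * of_bool (l = j)) = (of_bool (i = j) :: real)" if "i < k" for i j
    using sum_of_bool_scaleR(2)[OF that, of "\<lambda>l. of_bool (l = j) :: real"] by simp
  note 1 = this
  have 2: "(\<Sum>l<k. of_bool (i = l) * of_bool (j = l)) = (of_bool (i = j) :: real)" if "i < k" for i j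
    using sum_of_bool_scaleR(1)[OF that, of "\<lambda>l. of_bool (j = l) :: real"] by (simp add: eq_commute[of j i])
  show ?thesis
    unfolding orth_def
  proof (intro CollectI conjI allI impI)
    fix i j assume ij: "i < k" "j < k"
    show "(\<Sum>l<k. (case (l, i) of (i, j) \<Rightarrow> of_bool (i = j \<and> i < k)) * (case (l, j) of (i, j) \<Rightarrow> of_bool (i = j \<and> i < k)))
      = (of_bool (i = j) :: real)"
      using 1[OF ij(1), of j] by (simp cong: sum.cong_simp)
    show "(\<Sum>l<k. (case (i, l) of (i, j) \<Rightarrow> of_bool (i = j \<and> i < k)) * (case (j, l) of (i, j) \<Rightarrow> of_bool (i = j \<and> i < k)))
      = (of_bool (i = j) :: real)"
      using 2[OF ij(1), of j] ij by simp
  qed auto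
qed

text \<open>Tychonoff's theorem for pointwise convergence. It is the source of compactness for
  orthogonal matrices, bounded functionals, coefficient vectors and spaces of forms.\<close>

lemma compact_box: "compact {f :: 'i \<Rightarrow> 'b::topological_space. \<forall>i. f i \<in> S i}"
  if "\<And>i. compact (S i)"
proof -
  have "compactin (product_topology (\<lambda>i. euclidean) UNIV) (PiE UNIV S)"
    using that by (simp add: compactin_PiE)
  moreover have "PiE UNIV S = {f. \<forall>i. f i \<in> S i}" by (auto simp: PiE_def)
  ultimately show ?thesis by (simp add: euclidean_product_topology)
qed

lemma orth_abs_le: "U \<in> orth k \<Longrightarrow> \<bar>U p\<bar> \<le> 1"
proof -
  assume U: "U \<in> orth k"
  obtain i j where p: "p = (i, j)" by fastforce
  show "\<bar>U p\<bar> \<le> 1"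
  proof (cases "i < k \<and> j < k")
    case True
    have "(U (i, j))\<^sup>2 \<le> (\<Sum>l<k. (U (i, l))\<^sup>2)"
      using True by (intro member_le_sum) auto
    also have "\<dots> = 1" using U True by (simp add: orth_def power2_eq_square)
    finally show ?thesis by (simp add: p abs_square_le_1)
  qed (use U p in \<open>auto simp: orth_def\<close>)
qed

lemma continuous_on_apply [continuous_intros]:
  "continuous_on S (\<lambda>x. x i :: 'b::topological_space)"
  by (rule continuous_on_subset[OF continuous_on_product_coordinates]) simp

lemma compact_orth: "compact (orth k)"
proof -
  have "closed (orth k)"
    unfolding orth_def
    by (intro closed_Collect_conj closed_Collect_all closed_Collect_imp open_Collect_const
        closed_Collect_eq continuous_intros)
  moreover have "compact {f :: nat \<times> nat \<Rightarrow> real. \<forall>p. f p \<in> {-1..1}}"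
    by (rule compact_box) simp
  moreover have "orth k = {f :: nat \<times> nat \<Rightarrow> real. \<forall>p. f p \<in> {-1..1}} \<inter> orth k"
    using orth_abs_le[of _ k] by (auto simp: abs_le_iff minus_le_iff)
  ultimately show ?thesis by (metis compact_Int_closed)
qed

section \<open>Householder reflections, polar decomposition and the Procrustes problem\<close>

definition reflection :: "nat \<Rightarrow> (nat \<Rightarrow> real) \<Rightarrow> nat \<times> nat \<Rightarrow> real" where
  "reflection k z = (\<lambda>(i, j). if i < k \<and> j < k then of_bool (i = j) - 2 * z i * z j else 0)"

lemma reflection_orth:
  assumes "(\<Sum>i<k. (z i)\<^sup>2) = 1"
  shows "reflection k z \<in> orth k"
proof -
  have "(\<Sum>l<k. reflection k z (l, i) * reflection k z (l, j)) = of_bool (i = j)"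
    if "i < k" "j < k" for i j
  proof -
    have "(\<Sum>l<k. reflection k z (l, i) * reflection k z (l, j))
      = (\<Sum>l<k. of_bool (l = i) *\<^sub>R of_bool (l = j)) - 2 * z i * (\<Sum>l<k. of_bool (l = j) *\<^sub>R z l)
        - 2 * z j * (\<Sum>l<k. of_bool (l = i) *\<^sub>R z l) + 4 * z i * z j * (\<Sum>l<k. (z l)\<^sup>2)"
      using that unfolding sum_distrib_left sum_subtractf[symmetric] sum.distrib[symmetric]
      by (intro sum.cong) (auto simp: reflection_def algebra_simps power2_eq_square)
    then show ?thesis using that assms by (simp add: sum_of_bool_scaleR algebra_simps del: of_bool_eq)
  qed
  moreover have "reflection k z (i, l) = reflection k z (l, i)" for i l
    by (simp add: reflection_def mult_ac eq_commute[of i l])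
  ultimately show ?thesis
    unfolding orth_def by (intro CollectI conjI allI impI) (simp_all, auto simp: reflection_def)
qed

text \<open>By \<open>contr\<close> the assignment of \<open>d i\<close> to \<open>s i\<close>
  extends to a linear contraction W on the span of the \<open>s i\<close>, and by \<open>sym\<close>
  W is symmetric there. Z is W after the orthogonal projection P onto that span, and
  \<open>Z (d i) \<bullet> s i\<close> is the squared norm of \<open>P (d i)\<close>.\<close>

lemma contraction_extension:
  fixes s d :: "'i \<Rightarrow> 'a::real_inner"
  assumes fin: "finite I"
    and contr: "\<And>c. norm (\<Sum>i\<in>I. c i *\<^sub>R d i) \<le> norm (\<Sum>i\<in>I. c i *\<^sub>R s i)"
    and sym: "\<And>i j. i \<in> I \<Longrightarrow> j \<in> I \<Longrightarrow> d i \<bullet> s j = s i \<bullet> d j"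
  shows "\<exists>Z. linear Z \<and> (\<forall>x. norm (Z x) \<le> norm x) \<and> (\<forall>i\<in>I. Z (s i) = d i \<and> 0 \<le> Z (d i) \<bullet> s i)"
proof -
  \<comment> \<open>R is the graph of W. Working with the graph avoids selecting a basis from the
    possibly dependent \<open>s i\<close>; single-valuedness is \<open>contrR\<close>.\<close>
  define R where "R = range (\<lambda>c. (\<Sum>i\<in>I. c i *\<^sub>R s i, \<Sum>i\<in>I. c i *\<^sub>R d i))"
  have subR: "subspace R"
  proof (rule subspaceI)
    show "0 \<in> R" unfolding R_def by (rule range_eqI[of _ _ "\<lambda>_. 0"]) (simp add: zero_prod_def)
    show "x + y \<in> R" if xy: "x \<in> R" "y \<in> R" for x y
    proof -
      from xy obtain c c' where "x = (\<Sum>i\<in>I. c i *\<^sub>R s i, \<Sum>i\<in>I. c i *\<^sub>R d i)"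
        "y = (\<Sum>i\<in>I. c' i *\<^sub>R s i, \<Sum>i\<in>I. c' i *\<^sub>R d i)" by (auto simp: R_def)
      then show ?thesis unfolding R_def
        by (intro range_eqI[of _ _ "\<lambda>i. c i + c' i"]) (simp add: scaleR_add_left sum.distrib)
    qed
    show "a *\<^sub>R x \<in> R" if x: "x \<in> R" for a x
    proof -
      from x obtain c where "x = (\<Sum>i\<in>I. c i *\<^sub>R s i, \<Sum>i\<in>I. c i *\<^sub>R d i)" by (auto simp: R_def)
      then show ?thesis unfolding R_def
        by (intro range_eqI[of _ _ "\<lambda>i. a * c i"]) (simp add: scaleR_sum_right)
    qed
  qed
  have genR: "(s i, d i) \<in> R" if "i \<in> I" for i
    unfolding R_def
  proof (rule range_eqI[of _ _ "\<lambda>j. of_bool (j = i)"])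
    have "(\<Sum>j\<in>I. of_bool (j = i) *\<^sub>R f j) = f i" for f :: "'i \<Rightarrow> 'a"
    proof -
      have "(\<Sum>j\<in>I. of_bool (j = i) *\<^sub>R f j) = (\<Sum>j\<in>I. if j = i then f j else 0)"
        by (intro sum.cong) auto
      then show ?thesis using that fin by simp
    qed
    then show "(s i, d i) = (\<Sum>j\<in>I. of_bool (j = i) *\<^sub>R s j, \<Sum>j\<in>I. of_bool (j = i) *\<^sub>R d j)" by simp
  qed
  have contrR: "norm v \<le> norm u" if "(u, v) \<in> R" for u v
    using that contr by (auto simp: R_def)
  have symR: "v \<bullet> u' = u \<bullet> v'" if "(u, v) \<in> R" "(u', v') \<in> R" for u v u' v'
    using that by (auto simp: R_def inner_sum_left inner_sum_right sym intro!: sum.cong)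
  obtain C where C: "finite C" "span C = span (s ` I)" "pairwise orthogonal C"
    using basis_orthogonal[of "s ` I"] fin by auto
  have "subspace (fst ` R)"
    using linear_subspace_image[OF linear_fst subR] .
  then have "span (s ` I) \<subseteq> fst ` R"
    using genR by (intro span_minimal) force+
  then have "\<forall>f\<in>C. \<exists>h. (f, h) \<in> R"
    using C(2) span_superset[of C] by force
  then obtain h where h: "\<And>f. f \<in> C \<Longrightarrow> (f, h f) \<in> R" by metis
  define P where "P = (\<lambda>x. \<Sum>f\<in>C. (x \<bullet> f / (f \<bullet> f)) *\<^sub>R f)"
  define Z where "Z = (\<lambda>x. \<Sum>f\<in>C. (x \<bullet> f / (f \<bullet> f)) *\<^sub>R h f)"
  have linZ: "linear Z"
    by (rule linearI) (simp_all add: Z_def inner_add_left add_divide_distrib scaleR_add_left sum.distrib scaleR_sum_right)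
  have linP: "linear P"
    by (rule linearI) (simp_all add: P_def inner_add_left add_divide_distrib scaleR_add_left sum.distrib scaleR_sum_right)
  have PZ: "(P x, Z x) \<in> R" for x
  proof -
    have "(\<Sum>f\<in>C. (x \<bullet> f / (f \<bullet> f)) *\<^sub>R (f, h f)) \<in> R"
      using h by (intro subspace_sum[OF subR] subspace_scale[OF subR])
    also have "(\<Sum>f\<in>C. (x \<bullet> f / (f \<bullet> f)) *\<^sub>R (f, h f)) = (P x, Z x)"
      by (simp add: P_def Z_def sum_prod)
    finally show ?thesis .
  qed
  have Pf: "P x \<bullet> f = x \<bullet> f" if "f \<in> C" for x f
  proof -
    have "P x \<bullet> f = (\<Sum>g\<in>C. if g = f then x \<bullet> f else 0)"
      unfolding P_def inner_sum_left
    proof (intro sum.cong refl)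
      fix g assume "g \<in> C"
      then show "(x \<bullet> g / (g \<bullet> g)) *\<^sub>R g \<bullet> f = (if g = f then x \<bullet> f else 0)"
        using C(3) that by (auto simp: pairwise_def orthogonal_def)
    qed
    then show ?thesis using C(1) that by simp
  qed
  have Pperp: "(x - P x) \<bullet> P y = 0" for x y
  proof -
    have "P y = (\<Sum>f\<in>C. (y \<bullet> f / (f \<bullet> f)) *\<^sub>R f)" by (simp add: P_def)
    then show ?thesis by (simp add: inner_sum_right inner_diff_left Pf)
  qed
  have Pnorm: "norm (P x) \<le> norm x" for x
  proof -
    have "(norm x)\<^sup>2 = (norm (P x))\<^sup>2 + (norm (x - P x))\<^sup>2"
      using Pperp[of x x] unfolding power2_norm_eq_inner by (simp add: inner_diff inner_commute)
    then have "(norm (P x))\<^sup>2 \<le> (norm x)\<^sup>2" by simp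
    then show ?thesis by (simp add: norm_le_square power2_norm_eq_inner)
  qed
  have Ps: "P u = u" if "u \<in> span C" for u
  proof -
    have "P f = f" if "f \<in> C" for f
    proof -
      have "P f = (\<Sum>g\<in>C. if g = f then f else 0)"
        unfolding P_def
      proof (intro sum.cong refl)
        fix g assume "g \<in> C"
        then show "(f \<bullet> g / (g \<bullet> g)) *\<^sub>R g = (if g = f then f else 0)"
          using C(3) that by (cases "f = g") (auto simp: pairwise_def orthogonal_def)
      qed
      then show ?thesis using C(1) that by simp
    qed
    then have "P u = id u"
      using linear_eq_on_span[OF linP linear_id _ that] by simp
    then show ?thesis by simp
  qed
  have "Z (s i) = d i \<and> 0 \<le> Z (d i) \<bullet> s i" if "i \<in> I" for i
  proof
    have "P (s i) = s i" using that C(2) by (intro Ps) (auto intro: span_base)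
    then have "(s i, Z (s i)) \<in> R" using PZ[of "s i"] by simp
    from subspace_diff[OF subR this genR[OF that]]
    have "(0, Z (s i) - d i) \<in> R" by simp
    then show "Z (s i) = d i" using contrR by fastforce
    have "Z (d i) \<bullet> s i = P (d i) \<bullet> d i" by (rule symR[OF PZ genR[OF that]])
    also have "\<dots> = P (d i) \<bullet> P (d i)"
      using Pperp[of "d i" "d i"] by (simp add: inner_diff_left inner_diff_right inner_commute)
    finally show "0 \<le> Z (d i) \<bullet> s i" by simp
  qed
  moreover have "norm (Z x) \<le> norm x" for x
    using contrR[OF PZ] Pnorm order.trans by blast
  ultimately show ?thesis using linZ by blast
qed

text \<open>A substitute for differentiation at an extremum: \<epsilon> has either sign and may be
  arbitrarily small, so the linear coefficient cannot survive.\<close>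

lemma homogeneous_le_square_imp_zero:
  fixes D M :: real
  assumes "\<And>\<epsilon>. \<epsilon> * D \<le> \<epsilon>\<^sup>2 * M"
  shows "D = 0"
proof (rule ccontr)
  assume "D \<noteq> 0"
  define \<epsilon> where "\<epsilon> = D / (\<bar>M\<bar> + 1)"
  have 1: "\<epsilon> * (\<bar>M\<bar> + 1) = D" by (simp add: \<epsilon>_def)
  then have "\<epsilon> \<noteq> 0" using \<open>D \<noteq> 0\<close> by auto
  have "\<epsilon>\<^sup>2 * (\<bar>M\<bar> + 1) \<le> \<epsilon>\<^sup>2 * M"
    using assms[of \<epsilon>] by (simp add: power2_eq_square mult.assoc flip: 1)
  moreover have "\<epsilon>\<^sup>2 * M < \<epsilon>\<^sup>2 * (\<bar>M\<bar> + 1)"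
    using \<open>\<epsilon> \<noteq> 0\<close> by (intro mult_strict_left_mono) auto
  ultimately show False by simp
qed

text \<open>
  At an orthogonal matrix maximising \<open>\<Sum>j. (\<Sum>i. U (i, j) *\<^sub>R a i) \<bullet> b j\<close> the cross Gram matrix is symmetric
  and positive semidefinite, as in the polar decomposition.
\<close>

lemma orth_polar:
  fixes a b :: "nat \<Rightarrow> 'a::real_inner"
  obtains U where "U \<in> orth k"
    "\<And>i j. i < k \<Longrightarrow> j < k \<Longrightarrow> (\<Sum>l<k. U (l, i) *\<^sub>R a l) \<bullet> b j = (\<Sum>l<k. U (l, j) *\<^sub>R a l) \<bullet> b i"
    "\<And>c. 0 \<le> (\<Sum>i<k. c i *\<^sub>R (\<Sum>l<k. U (l, i) *\<^sub>R a l)) \<bullet> (\<Sum>j<k. c j *\<^sub>R b j)"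
proof -
  define val where "val = (\<lambda>U. \<Sum>j<k. (\<Sum>l<k. U (l, j) *\<^sub>R a l) \<bullet> b j)"
  have "val = (\<lambda>U. \<Sum>j<k. \<Sum>l<k. U (l, j) * (a l \<bullet> b j))"
    by (simp add: val_def inner_sum_left)
  then have "continuous_on (orth k) val"
    by (auto intro!: continuous_intros)
  then obtain U where U: "U \<in> orth k" "\<And>V. V \<in> orth k \<Longrightarrow> val V \<le> val U"
    using continuous_attains_sup[OF compact_orth, of k val] orth_one by blast
  define a' where "a' = (\<lambda>j. \<Sum>l<k. U (l, j) *\<^sub>R a l)"
  have val_mult: "val (mat_mult k U V) = (\<Sum>j<k. (\<Sum>i<k. V (i, j) *\<^sub>R a' i) \<bullet> b j)" for V
    unfolding val_def
  proof (rule sum.cong[OF refl])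
    fix j assume j: "j \<in> {..<k}"
    have "(\<Sum>l<k. mat_mult k U V (l, j) *\<^sub>R a l) = (\<Sum>l<k. \<Sum>i<k. V (i, j) *\<^sub>R U (l, i) *\<^sub>R a l)"
      using j by (intro sum.cong refl) (simp add: mat_mult_def scaleR_sum_left mult.commute)
    also have "\<dots> = (\<Sum>i<k. \<Sum>l<k. V (i, j) *\<^sub>R U (l, i) *\<^sub>R a l)" by (rule sum.swap)
    also have "\<dots> = (\<Sum>i<k. V (i, j) *\<^sub>R a' i)" by (simp add: a'_def scaleR_sum_right)
    finally show "(\<Sum>l<k. mat_mult k U V (l, j) *\<^sub>R a l) \<bullet> b j = (\<Sum>i<k. V (i, j) *\<^sub>R a' i) \<bullet> b j"
      by simp
  qed
  \<comment> \<open>Optimality of U says that the identity is optimal for the rotated tuple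
    \<open>a'\<close>. It is tested only against reflections and products of two reflections, so no
    calculus on the orthogonal group is needed.\<close>
  have max: "(\<Sum>j<k. (\<Sum>i<k. V (i, j) *\<^sub>R a' i) \<bullet> b j) \<le> (\<Sum>j<k. a' j \<bullet> b j)" if "V \<in> orth k" for V
    using U(2)[OF mat_mult_orth[OF U(1) that]] by (simp add: val_mult) (simp add: val_def a'_def)
  define A B where "A = (\<lambda>z. \<Sum>i<k. z i *\<^sub>R a' i)" and "B = (\<lambda>z. \<Sum>i<k. z i *\<^sub>R b i)"
  have refl_apply: "(\<Sum>i<k. reflection k z (i, j) *\<^sub>R x i) = x j - (2 * z j) *\<^sub>R (\<Sum>i<k. z i *\<^sub>R x i)"
    if "j < k" for z j and x :: "nat \<Rightarrow> 'a"
  proof -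
    have "(\<Sum>i<k. reflection k z (i, j) *\<^sub>R x i)
      = (\<Sum>i<k. of_bool (i = j) *\<^sub>R x i - (2 * z j) *\<^sub>R z i *\<^sub>R x i)"
      using that by (intro sum.cong refl) (simp add: reflection_def scaleR_diff_left mult_ac)
    also have "\<dots> = x j - (2 * z j) *\<^sub>R (\<Sum>i<k. z i *\<^sub>R x i)"
      using that by (simp only: sum_subtractf sum_of_bool_scaleR scaleR_sum_right)
    finally show ?thesis .
  qed
  \<comment> \<open>Reflecting along the unit vector z changes the value by
    \<open>- 2 * (A z \<bullet> B z)\<close>, which optimality forces to be at most 0.\<close>
  have Q1: "0 \<le> A z \<bullet> B z" if "(\<Sum>i<k. (z i)\<^sup>2) = 1" for z
  proof -
    have "(\<Sum>j<k. (\<Sum>i<k. reflection k z (i, j) *\<^sub>R a' i) \<bullet> b j)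
       = (\<Sum>j<k. (a' j - (2 * z j) *\<^sub>R A z) \<bullet> b j)"
      by (intro sum.cong refl) (simp add: refl_apply A_def)
    also have "\<dots> = (\<Sum>j<k. a' j \<bullet> b j) - 2 * (A z \<bullet> B z)"
      by (simp add: inner_diff_left sum_subtractf B_def inner_sum_right sum_distrib_left mult.assoc)
    finally show ?thesis using max[OF reflection_orth[OF that]] by simp
  qed
  have Q: "0 \<le> A z \<bullet> B z" for z
  proof (cases "(\<Sum>i<k. (z i)\<^sup>2) = 0")
    case True
    then have "\<forall>i<k. z i = 0" by (simp add: sum_nonneg_eq_0_iff)
    then have "A z = 0" by (simp add: A_def)
    then show ?thesis by simp
  next
    case False
    define r where "r = sqrt (\<Sum>i<k. (z i)\<^sup>2)"
    have "(\<Sum>i<k. (z i)\<^sup>2) \<ge> 0" by (simp add: sum_nonneg)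
    then have r: "r > 0" "r\<^sup>2 = (\<Sum>i<k. (z i)\<^sup>2)" using False by (auto simp: r_def)
    have "(\<Sum>i<k. (z i / r)\<^sup>2) = 1"
      using r False by (simp add: power_divide flip: sum_divide_distrib)
    then have "0 \<le> A (\<lambda>i. z i / r) \<bullet> B (\<lambda>i. z i / r)" by (rule Q1)
    also have "A (\<lambda>i. z i / r) = (1 / r) *\<^sub>R A z" by (simp add: A_def scaleR_sum_right)
    also have "B (\<lambda>i. z i / r) = (1 / r) *\<^sub>R B z" by (simp add: B_def scaleR_sum_right)
    finally have "0 \<le> (A z \<bullet> B z) / (r * r)" by simp
    moreover have "0 < r * r" using r by simp
    ultimately show ?thesis by (simp only: zero_le_divide_iff) auto
  qed
  \<comment> \<open>The product of the reflections along z and y is a rotation in their plane; this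
    is the optimality inequality for it.\<close>
  have two: "2 * (\<Sum>i<k. z i * y i) * (A z \<bullet> B y) \<le> A z \<bullet> B z + A y \<bullet> B y"
    if z: "(\<Sum>i<k. (z i)\<^sup>2) = 1" and y: "(\<Sum>i<k. (y i)\<^sup>2) = 1" for z y
  proof -
    define c where "c = (\<Sum>i<k. z i * y i)"
    have eq: "(\<Sum>i<k. mat_mult k (reflection k z) (reflection k y) (i, j) *\<^sub>R a' i)
      = a' j - (2 * z j) *\<^sub>R A z - (2 * y j) *\<^sub>R A y + (4 * c * y j) *\<^sub>R A z" if j: "j < k" for j
    proof -
      have "(\<Sum>i<k. mat_mult k (reflection k z) (reflection k y) (i, j) *\<^sub>R a' i)
        = (\<Sum>i<k. \<Sum>l<k. reflection k y (l, j) *\<^sub>R reflection k z (i, l) *\<^sub>R a' i)"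
        using j by (intro sum.cong refl) (simp add: mat_mult_def scaleR_sum_left mult.commute)
      also have "\<dots> = (\<Sum>l<k. \<Sum>i<k. reflection k y (l, j) *\<^sub>R reflection k z (i, l) *\<^sub>R a' i)"
        by (rule sum.swap)
      also have "\<dots> = (\<Sum>l<k. reflection k y (l, j) *\<^sub>R (a' l - (2 * z l) *\<^sub>R A z))"
        by (intro sum.cong refl) (simp only: scaleR_sum_right[symmetric] refl_apply A_def lessThan_iff)
      also have "\<dots> = a' j - (2 * z j) *\<^sub>R A z - (2 * y j) *\<^sub>R (\<Sum>i<k. y i *\<^sub>R (a' i - (2 * z i) *\<^sub>R A z))"
        using j by (rule refl_apply)
      also have "(\<Sum>i<k. y i *\<^sub>R (a' i - (2 * z i) *\<^sub>R A z)) = A y - (2 * c) *\<^sub>R A z"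
        by (simp add: A_def c_def scaleR_diff_right sum_subtractf scaleR_sum_left sum_distrib_left mult_ac)
      finally show ?thesis by (simp add: algebra_simps)
    qed
    have "(\<Sum>j<k. (\<Sum>i<k. mat_mult k (reflection k z) (reflection k y) (i, j) *\<^sub>R a' i) \<bullet> b j)
       = (\<Sum>j<k. a' j \<bullet> b j - 2 * (A z \<bullet> z j *\<^sub>R b j) - 2 * (A y \<bullet> y j *\<^sub>R b j) + 4 * c * (A z \<bullet> y j *\<^sub>R b j))"
      by (intro sum.cong refl) (simp add: eq inner_diff_left inner_add_left)
    also have "\<dots> = (\<Sum>j<k. a' j \<bullet> b j) - 2 * (A z \<bullet> B z) - 2 * (A y \<bullet> B y) + 4 * c * (A z \<bullet> B y)"
      by (simp only: sum.distrib sum_subtractf B_def inner_sum_right sum_distrib_left)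
    finally show ?thesis
      using max[OF mat_mult_orth[OF reflection_orth[OF z] reflection_orth[OF y]]] by (simp add: c_def)
  qed
  \<comment> \<open>Take y as the p-th unit vector and tilt z from it by \<epsilon> towards the q-th
    one. The terms of order 0 in \<epsilon> cancel, and the coefficient of \<epsilon> is the
    antisymmetric part of the cross Gram matrix.\<close>
  have sym: "a' q \<bullet> b p = a' p \<bullet> b q" if pq: "p < k" "q < k" "p \<noteq> q" for p q
  proof -
    have "\<epsilon> * (a' q \<bullet> b p - a' p \<bullet> b q) \<le> \<epsilon>\<^sup>2 * (a' p \<bullet> b p + a' q \<bullet> b q)" for \<epsilon>
    proof -
      define r where "r = sqrt (1 + \<epsilon>\<^sup>2)"
      have "1 + \<epsilon>\<^sup>2 > 0" by (simp add: add_pos_nonneg)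
      then have r: "r > 0" "r\<^sup>2 = 1 + \<epsilon>\<^sup>2" by (auto simp: r_def)
      define z y :: "nat \<Rightarrow> real" where "z = (\<lambda>i. (of_bool (i = p) + \<epsilon> * of_bool (i = q)) / r)"
        and "y = (\<lambda>i. of_bool (i = p))"
      have sc: "(\<Sum>i<k. z i *\<^sub>R x i) = (1 / r) *\<^sub>R (x p + \<epsilon> *\<^sub>R x q)" for x :: "nat \<Rightarrow> 'b::real_vector"
      proof -
        have "(\<Sum>i<k. z i *\<^sub>R x i) = (1 / r) *\<^sub>R ((\<Sum>i<k. of_bool (i = p) *\<^sub>R x i) + \<epsilon> *\<^sub>R (\<Sum>i<k. of_bool (i = q) *\<^sub>R x i))"
          unfolding scaleR_sum_right sum.distrib[symmetric]
          by (intro sum.cong refl) (simp add: z_def scaleR_add_left scaleR_add_right add_divide_distrib)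
        then show ?thesis using pq by (simp only: sum_of_bool_scaleR)
      qed
      have sy: "(\<Sum>i<k. y i *\<^sub>R x i) = x p" for x :: "nat \<Rightarrow> 'b::real_vector"
        unfolding y_def using pq by (simp only: sum_of_bool_scaleR)
      have zz: "(\<Sum>i<k. (z i)\<^sup>2) = 1"
      proof -
        have "(\<Sum>i<k. (z i)\<^sup>2) = (z p + \<epsilon> * z q) / r"
          using sc[of z] by (simp add: power2_eq_square)
        also have "\<dots> = (1 + \<epsilon>\<^sup>2) / r\<^sup>2"
          using pq by (simp add: z_def power2_eq_square add_divide_distrib)
        finally show ?thesis unfolding r(2) using \<open>1 + \<epsilon>\<^sup>2 > 0\<close> by simp
      qed
      have yy: "(\<Sum>i<k. (y i)\<^sup>2) = 1" using sy[of y] by (simp add: power2_eq_square y_def)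
      have zy: "(\<Sum>i<k. z i * y i) = 1 / r" using sc[of y] pq by (simp add: y_def)
      have Az: "A z = (1 / r) *\<^sub>R (a' p + \<epsilon> *\<^sub>R a' q)" "B z = (1 / r) *\<^sub>R (b p + \<epsilon> *\<^sub>R b q)"
        "A y = a' p" "B y = b p"
        by (simp_all only: A_def B_def sc sy)
      define X where "X = (a' p + \<epsilon> *\<^sub>R a' q)"
      define Y where "Y = (b p + \<epsilon> *\<^sub>R b q)"
      have "2 * (1 / r) * ((1 / r) * (X \<bullet> b p)) \<le> (1 / r) * ((1 / r) * (X \<bullet> Y)) + a' p \<bullet> b p"
        using two[OF zz yy] unfolding zy Az X_def[symmetric] Y_def[symmetric] by simp
      then have "r\<^sup>2 * (2 * (1 / r) * ((1 / r) * (X \<bullet> b p))) \<le> r\<^sup>2 * ((1 / r) * ((1 / r) * (X \<bullet> Y)) + a' p \<bullet> b p)"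
        by (intro mult_left_mono) auto
      then have "2 * (X \<bullet> b p) \<le> X \<bullet> Y + r\<^sup>2 * (a' p \<bullet> b p)"
        using r(1) by (simp add: power2_eq_square distrib_left)
      then show ?thesis
        unfolding r(2) X_def Y_def by (simp add: inner_add_left inner_add_right power2_eq_square algebra_simps)
    qed
    from homogeneous_le_square_imp_zero[OF this] show ?thesis by simp
  qed
  show thesis
    by (rule that[OF U(1)]) (use sym Q in \<open>force simp: a'_def A_def B_def\<close>)+
qed

text \<open>An inequality of Powers-Stormer type: the right-hand side is a pairing of a contraction
  with the difference of the covariance operators. For \<open>s = a' + b\<close> and
  \<open>d = a' - b\<close> the polar decomposition supplies a contraction with
  \<open>Z s = d\<close>, and then \<open>2 * (Z a' \<bullet> a' - Z b \<bullet> b)\<close> equals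
  \<open>d \<bullet> d + Z d \<bullet> s\<close>, whose second term is nonnegative.\<close>

lemma procrustes_le_trace_distance:
  fixes a b :: "nat \<Rightarrow> 'a::real_inner"
  shows "\<exists>U\<in>orth k. \<exists>Z. linear Z \<and> (\<forall>x. norm (Z x) \<le> norm x) \<and>
    (\<Sum>j<k. (norm ((\<Sum>l<k. U (l, j) *\<^sub>R a l) - b j))\<^sup>2) \<le> 2 * (\<Sum>j<k. Z (a j) \<bullet> a j - Z (b j) \<bullet> b j)"
proof -
  obtain U where U: "U \<in> orth k"
    and sym: "\<And>i j. i < k \<Longrightarrow> j < k \<Longrightarrow> (\<Sum>l<k. U (l, i) *\<^sub>R a l) \<bullet> b j = (\<Sum>l<k. U (l, j) *\<^sub>R a l) \<bullet> b i"
    and psd: "\<And>c. 0 \<le> (\<Sum>i<k. c i *\<^sub>R (\<Sum>l<k. U (l, i) *\<^sub>R a l)) \<bullet> (\<Sum>j<k. c j *\<^sub>R b j)"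
    using orth_polar[of k a b] by blast
  define a' where "a' = (\<lambda>j. \<Sum>l<k. U (l, j) *\<^sub>R a l)"
  define s d where "s = (\<lambda>j. a' j + b j)" and "d = (\<lambda>j. a' j - b j)"
  have contr: "norm (\<Sum>i<k. c i *\<^sub>R d i) \<le> norm (\<Sum>i<k. c i *\<^sub>R s i)" for c
  proof -
    define A B where "A = (\<Sum>i<k. c i *\<^sub>R a' i)" and "B = (\<Sum>i<k. c i *\<^sub>R b i)"
    have "(norm (A - B))\<^sup>2 + 4 * (A \<bullet> B) = (norm (A + B))\<^sup>2"
      unfolding power2_norm_eq_inner by (simp add: inner_diff inner_add inner_commute)
    moreover have "0 \<le> A \<bullet> B" using psd[of c] by (simp add: A_def B_def a'_def)
    ultimately have "(norm (A - B))\<^sup>2 \<le> (norm (A + B))\<^sup>2" by linarith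
    then have "norm (A - B) \<le> norm (A + B)" by (rule power2_le_imp_le) simp
    then show ?thesis
      by (simp add: A_def B_def s_def d_def scaleR_diff_right scaleR_add_right sum.distrib sum_subtractf)
  qed
  have symsd: "d i \<bullet> s j = s i \<bullet> d j" if "i \<in> {..<k}" "j \<in> {..<k}" for i j
    using sym[of i j] that unfolding s_def d_def a'_def[symmetric]
    by (simp add: inner_diff_left inner_diff_right inner_add_left inner_add_right inner_commute a'_def)
  obtain Z where Z: "linear Z" "\<And>x. norm (Z x) \<le> norm x" "\<And>i. i < k \<Longrightarrow> Z (s i) = d i"
      "\<And>i. i < k \<Longrightarrow> 0 \<le> Z (d i) \<bullet> s i"
    using contraction_extension[of "{..<k}" d s] contr symsd by auto
  interpret linear Z by fact
  \<comment> \<open>An orthogonal recombination of a tuple leaves its covariance operator unchanged,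
    so \<open>a\<close> may be replaced by \<open>a'\<close> in the pairing with Z.\<close>
  have "(\<Sum>j<k. Z (a j) \<bullet> a j) = (\<Sum>j<k. Z (a' j) \<bullet> a' j)"
    using orth_inner_tr[OF U, of "\<lambda>j. Z (a j)" a] by (simp add: a'_def sum scale)
  moreover have "(norm (d j))\<^sup>2 \<le> 2 * (Z (a' j) \<bullet> a' j - Z (b j) \<bullet> b j)" if "j < k" for j
  proof -
    have "Z (d j) = Z (a' j) - Z (b j)" "Z (a' j) + Z (b j) = d j"
      using Z(3)[OF that] by (simp_all add: s_def d_def diff add)
    then have "2 * (Z (a' j) \<bullet> a' j - Z (b j) \<bullet> b j) = d j \<bullet> d j + Z (d j) \<bullet> s j"
      unfolding s_def by (simp add: d_def inner_diff_left inner_diff_right inner_add_left inner_add_right)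
        (smt (verit, best) inner_add_left inner_diff_right inner_diff_left)
    then show ?thesis using Z(4)[OF that] by (simp add: power2_norm_eq_inner)
  qed
  then have "(\<Sum>j<k. (norm (d j))\<^sup>2) \<le> (\<Sum>j<k. 2 * (Z (a' j) \<bullet> a' j - Z (b j) \<bullet> b j))"
    by (intro sum_mono) auto
  ultimately show ?thesis
    using U Z(1,2) by (intro bexI[OF _ U] exI[of _ Z])
      (simp add: d_def a'_def sum_subtractf flip: sum_distrib_left)
qed

section \<open>The marriage theorem and almost permuted nets\<close>

lemma hall_marriage:
  fixes A :: "'i \<Rightarrow> 'b set"
  assumes "finite I" "\<And>i. i \<in> I \<Longrightarrow> finite (A i)"
    and "\<And>J. J \<subseteq> I \<Longrightarrow> card J \<le> card (\<Union>i\<in>J. A i)"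
  shows "\<exists>f. inj_on f I \<and> (\<forall>i\<in>I. f i \<in> A i)"
  using assms
proof (induction I arbitrary: A rule: finite_psubset_induct)
  case (psubset I)
  note fin = \<open>finite I\<close> psubset.prems(1) and hall = psubset.prems(2)
  have finU: "finite (\<Union>i\<in>J. A i)" if "J \<subseteq> I" for J
    using that fin finite_subset by blast
  show ?case
  proof (cases "I = {}")
    case False
    then obtain i where i: "i \<in> I" by blast
    show ?thesis
    \<comment> \<open>If a proper nonempty J is tight, match J and the rest separately: removing the
      neighbours of J costs the rest no more than J itself contributed. If none is tight, every
      proper nonempty subset has a surplus of at least one, so i can take any neighbour.\<close>
    proof (cases "\<exists>J. J \<subset> I \<and> J \<noteq> {} \<and> card (\<Union>i\<in>J. A i) \<le> card J")
      case True
      then obtain J where J: "J \<subset> I" "J \<noteq> {}" "card (\<Union>i\<in>J. A i) \<le> card J" by blast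
      have "\<exists>f. inj_on f J \<and> (\<forall>i\<in>J. f i \<in> A i)"
        using J fin hall by (intro psubset.IH[OF J(1)]) auto
      then obtain f1 where f1: "inj_on f1 J" "\<And>i. i \<in> J \<Longrightarrow> f1 i \<in> A i" by blast
      define A' where "A' = (\<lambda>i. A i - (\<Union>j\<in>J. A j))"
      have "\<exists>f. inj_on f (I - J) \<and> (\<forall>i\<in>I - J. f i \<in> A' i)"
      proof (rule psubset.IH)
        show "I - J \<subset> I" using J by blast
        show "finite (A' i)" if "i \<in> I - J" for i using that fin by (auto simp: A'_def)
        show "card K \<le> card (\<Union>i\<in>K. A' i)" if K: "K \<subseteq> I - J" for K
        proof -
          have finKJ: "finite K" "finite J" using K J fin(1) by (auto intro: finite_subset)
          have eq: "(\<Union>i\<in>K \<union> J. A i) = (\<Union>i\<in>K. A' i) \<union> (\<Union>i\<in>J. A i)" by (auto simp: A'_def)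
          have "card K + card J = card (K \<union> J)"
            using K finKJ by (intro card_Un_disjoint[symmetric]) auto
          also have "\<dots> \<le> card (\<Union>i\<in>K \<union> J. A i)" using K J by (intro hall) auto
          also have "\<dots> \<le> card (\<Union>i\<in>K. A' i) + card (\<Union>i\<in>J. A i)" unfolding eq by (rule card_Un_le)
          finally show ?thesis using J(3) by linarith
        qed
      qed
      then obtain f2 where f2: "inj_on f2 (I - J)" "\<And>i. i \<in> I - J \<Longrightarrow> f2 i \<in> A' i" by blast
      define f where "f = (\<lambda>i. if i \<in> J then f1 i else f2 i)"
      have "f x \<noteq> f y" if "x \<in> J" "y \<in> I - J" for x y
        using f1(2)[OF that(1)] f2(2)[OF that(2)] that by (auto simp: f_def A'_def)
      then have "inj_on f I"
        using f1(1) f2(1) J(1) unfolding inj_on_def f_def by (metis DiffI)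
      moreover have "\<forall>i\<in>I. f i \<in> A i" using f1(2) f2(2) by (auto simp: f_def A'_def)
      ultimately show ?thesis by blast
    next
      case False
      have "card {i} \<le> card (\<Union>j\<in>{i}. A j)" using i by (intro hall) auto
      then have "A i \<noteq> {}" by auto
      then obtain x where x: "x \<in> A i" by blast
      define A' where "A' = (\<lambda>j. A j - {x})"
      have "\<exists>f. inj_on f (I - {i}) \<and> (\<forall>j\<in>I - {i}. f j \<in> A' j)"
      proof (rule psubset.IH)
        show "I - {i} \<subset> I" using i by blast
        show "finite (A' j)" if "j \<in> I - {i}" for j using that fin by (auto simp: A'_def)
        show "card K \<le> card (\<Union>j\<in>K. A' j)" if K: "K \<subseteq> I - {i}" for K
        proof (cases "K = {}")
          case nonempty: False
          have "K \<subset> I" using K i by blast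
          then have "card K < card (\<Union>j\<in>K. A j)" using False nonempty by (meson not_le)
          moreover have "(\<Union>j\<in>K. A' j) = (\<Union>j\<in>K. A j) - {x}" by (auto simp: A'_def)
          moreover have "card (\<Union>j\<in>K. A j) - card {x} \<le> card ((\<Union>j\<in>K. A j) - {x})"
            by (rule diff_card_le_card_Diff) simp
          ultimately show ?thesis by simp
        qed simp
      qed
      then obtain f where f: "inj_on f (I - {i})" "\<And>j. j \<in> I - {i} \<Longrightarrow> f j \<in> A' j" by blast
      have "inj_on (f(i := x)) I"
        using f unfolding inj_on_def A'_def by (auto simp: fun_upd_def)
      moreover have "\<forall>j\<in>I. (f(i := x)) j \<in> A j" using f(2) x by (auto simp: A'_def)
      ultimately show ?thesis by blast
    qed
  qed auto
qed

text \<open>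
  A minimal net is almost permuted by every symmetry of the space: failure of Hall's condition would
  produce a smaller net.
\<close>

lemma minimal_net_almost_permuted:
  fixes R R2 :: "'b \<Rightarrow> 'b \<Rightarrow> bool"
  assumes net: "finite N0" "N0 \<subseteq> K" "\<And>z. z \<in> K \<Longrightarrow> \<exists>x\<in>N0. R z x"
    and R2: "\<And>z a b. R z a \<Longrightarrow> R z b \<Longrightarrow> R2 a b"
  shows "\<exists>N. finite N \<and> N \<subseteq> K \<and> (K \<noteq> {} \<longrightarrow> N \<noteq> {}) \<and>
    (\<forall>u. u ` K = K \<longrightarrow> (\<forall>x\<in>K. \<forall>y\<in>K. R x y \<longrightarrow> R (u x) (u y)) \<longrightarrow>
      (\<exists>\<sigma>. bij_betw \<sigma> N N \<and> (\<forall>x\<in>N. R2 (u x) (\<sigma> x))))"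
proof -
  define is_net where "is_net = (\<lambda>N. finite N \<and> N \<subseteq> K \<and> (\<forall>z\<in>K. \<exists>x\<in>N. R z x))"
  have "is_net N0" using net by (simp add: is_net_def)
  then obtain N where N: "is_net N" and min: "\<And>N'. is_net N' \<Longrightarrow> card N \<le> card N'"
    using ex_has_least_nat[of is_net N0 card] by blast
  have fin: "finite N" and sub: "N \<subseteq> K" and cov: "\<And>z. z \<in> K \<Longrightarrow> \<exists>x\<in>N. R z x"
    using N by (auto simp: is_net_def)
  have perm: "\<exists>\<sigma>. bij_betw \<sigma> N N \<and> (\<forall>x\<in>N. R2 (u x) (\<sigma> x))"
    if u: "u ` K = K" "\<And>x y. x \<in> K \<Longrightarrow> y \<in> K \<Longrightarrow> R x y \<Longrightarrow> R (u x) (u y)" for u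
  proof -
    define A where "A = (\<lambda>x. {y\<in>N. R2 (u x) y})"
    have "\<exists>f. inj_on f N \<and> (\<forall>x\<in>N. f x \<in> A x)"
    proof (rule hall_marriage[OF fin])
      show "finite (A x)" for x using fin by (simp add: A_def)
      show "card J \<le> card (\<Union>x\<in>J. A x)" if J: "J \<subseteq> N" for J
      proof -
        \<comment> \<open>Replace the net by its image under \<open>u\<close>, but trade the points
          \<open>u x\<close> with x in J for their R2-neighbours in N. A point z covered by such a
          \<open>u x\<close> is also covered by some y in N, and y is then an R2-neighbour of
          \<open>u x\<close>. So N' is still a net, and minimality of N is Hall's inequality for
          J.\<close>
        define N' where "N' = u ` (N - J) \<union> (\<Union>x\<in>J. A x)"
        have "finite J" using J fin finite_subset by blast
        have "is_net N'"
          unfolding is_net_def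
        proof (intro conjI ballI)
          show "finite N'" using fin \<open>finite J\<close> by (auto simp: N'_def A_def)
          show "N' \<subseteq> K" using sub u(1) by (auto simp: N'_def A_def)
          fix z assume z: "z \<in> K"
          then obtain w where w: "w \<in> K" "z = u w" using u(1) by blast
          obtain x where x: "x \<in> N" "R w x" using cov[OF w(1)] by blast
          then have zx: "R z (u x)" using u(2) w sub by blast
          show "\<exists>x\<in>N'. R z x"
          proof (cases "x \<in> J")
            case True
            obtain y where "y \<in> N" "R z y" using cov[OF z] by blast
            then have "y \<in> A x" using R2[OF zx] by (simp add: A_def)
            then show ?thesis using True \<open>R z y\<close> by (auto simp: N'_def)
          qed (use x zx in \<open>auto simp: N'_def\<close>)
        qed
        then have "card N \<le> card N'" by (rule min)
        also have "\<dots> \<le> card (u ` (N - J)) + card (\<Union>x\<in>J. A x)" unfolding N'_def by (rule card_Un_le)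
        also have "card (u ` (N - J)) \<le> card (N - J)" using fin by (intro card_image_le) auto
        also have "card (N - J) = card N - card J" using J \<open>finite J\<close> by (rule card_Diff_subset[rotated])
        finally show ?thesis using card_mono[OF fin J] by linarith
      qed
    qed
    then obtain f where f: "inj_on f N" "\<And>x. x \<in> N \<Longrightarrow> f x \<in> A x" by blast
    then have "f ` N = N" using fin by (intro endo_inj_surj) (auto simp: A_def)
    then have "bij_betw f N N" using f(1) by (simp add: bij_betw_def)
    then show ?thesis using f(2) by (auto simp: A_def)
  qed
  have "K \<noteq> {} \<longrightarrow> N \<noteq> {}" using cov by blast
  with fin sub show ?thesis
    by (intro exI[of _ N] conjI allI impI perm) auto
qed

definition frob :: "nat \<Rightarrow> (nat \<times> nat \<Rightarrow> real) \<Rightarrow> (nat \<times> nat \<Rightarrow> real) \<Rightarrow> real" where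
  "frob k U V = (\<Sum>j<k. \<Sum>i<k. (U (i, j) - V (i, j))\<^sup>2)"

text \<open>Left multiplication by an orthogonal matrix maps \<open>orth k\<close> onto itself and
  preserves \<open>frob\<close>, so it qualifies as a symmetry of the net. Since \<open>frob\<close>
  is a squared distance, the triangle inequality costs a factor 2 for each of the two summands,
  whence \<open>4 * \<delta>\<close>.\<close>

lemma orth_almost_permuted_net:
  assumes \<delta>: "\<delta> > 0"
  shows "\<exists>N. finite N \<and> N \<subseteq> orth k \<and> N \<noteq> {} \<and>
    (\<forall>G\<in>orth k. \<exists>\<sigma>. bij_betw \<sigma> N N \<and> (\<forall>U\<in>N. frob k (mat_mult k G U) (\<sigma> U) \<le> 4 * \<delta>))"
proof -
  have "open {V. frob k U V < \<delta>}" for U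
    unfolding frob_def by (intro open_Collect_less continuous_intros)
  moreover have "orth k \<subseteq> (\<Union>U\<in>orth k. {V. frob k U V < \<delta>})"
    using \<delta> by (auto simp: frob_def)
  ultimately obtain N0 where N0: "N0 \<subseteq> orth k" "finite N0" "orth k \<subseteq> (\<Union>U\<in>N0. {V. frob k U V < \<delta>})"
    using compactE_image[OF compact_orth, of "orth k" "\<lambda>U. {V. frob k U V < \<delta>}" k] by metis
  have "\<exists>N. finite N \<and> N \<subseteq> orth k \<and> (orth k \<noteq> {} \<longrightarrow> N \<noteq> {}) \<and>
    (\<forall>u. u ` orth k = orth k \<longrightarrow> (\<forall>x\<in>orth k. \<forall>y\<in>orth k. frob k y x < \<delta> \<longrightarrow> frob k (u y) (u x) < \<delta>) \<longrightarrow>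
      (\<exists>\<sigma>. bij_betw \<sigma> N N \<and> (\<forall>x\<in>N. frob k (u x) (\<sigma> x) \<le> 4 * \<delta>)))"
  proof (rule minimal_net_almost_permuted[OF N0(2,1)])
    show "\<exists>x\<in>N0. frob k x z < \<delta>" if "z \<in> orth k" for z using that N0(3) by auto
    fix z a b assume ab: "frob k a z < \<delta>" "frob k b z < \<delta>"
    have "frob k a b \<le> 2 * frob k a z + 2 * frob k b z"
      unfolding frob_def sum_distrib_left sum.distrib[symmetric]
    proof (intro sum_mono)
      fix i j
      show "(a (i, j) - b (i, j))\<^sup>2 \<le> 2 * (a (i, j) - z (i, j))\<^sup>2 + 2 * (b (i, j) - z (i, j))\<^sup>2"
        using zero_le_power2[of "(a (i, j) - z (i, j)) + (b (i, j) - z (i, j))"]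
        by (simp add: power2_eq_square algebra_simps)
    qed
    then show "frob k a b \<le> 4 * \<delta>" using ab by linarith
  qed
  then obtain N where N: "finite N" "N \<subseteq> orth k" "orth k \<noteq> {} \<longrightarrow> N \<noteq> {}"
    "\<forall>u. u ` orth k = orth k \<longrightarrow> (\<forall>x\<in>orth k. \<forall>y\<in>orth k. frob k y x < \<delta> \<longrightarrow> frob k (u y) (u x) < \<delta>) \<longrightarrow>
      (\<exists>\<sigma>. bij_betw \<sigma> N N \<and> (\<forall>x\<in>N. frob k (u x) (\<sigma> x) \<le> 4 * \<delta>))"
    by (elim exE conjE) (rule that)
  have "\<exists>\<sigma>. bij_betw \<sigma> N N \<and> (\<forall>U\<in>N. frob k (mat_mult k G U) (\<sigma> U) \<le> 4 * \<delta>)" if G: "G \<in> orth k" for G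
  proof (rule N(4)[rule_format])
    show "mat_mult k G ` orth k = orth k"
    proof
      show "mat_mult k G ` orth k \<subseteq> orth k" using mat_mult_orth[OF G] by blast
      show "orth k \<subseteq> mat_mult k G ` orth k"
        using mat_mult_tr_cancel[OF G] mat_mult_orth[OF mat_tr_orth[OF G]] by (metis image_eqI subsetI)
    qed
    fix x y assume "x \<in> orth k" "y \<in> orth k" "frob k y x < \<delta>"
    have "frob k (mat_mult k G y) (mat_mult k G x) = frob k y x"
      unfolding frob_def
    proof (rule sum.cong[OF refl])
      fix j assume j: "j \<in> {..<k}"
      have "(\<Sum>i<k. (mat_mult k G y (i, j) - mat_mult k G x (i, j))\<^sup>2)
        = (\<Sum>i<k. (\<Sum>l<k. G (i, l) *\<^sub>R (y (l, j) - x (l, j))) \<bullet> (\<Sum>l<k. G (i, l) *\<^sub>R (y (l, j) - x (l, j))))"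
        using j by (intro sum.cong refl)
          (simp add: mat_mult_def right_diff_distrib sum_subtractf power2_eq_square)
      also have "\<dots> = (\<Sum>l<k. (y (l, j) - x (l, j)) \<bullet> (y (l, j) - x (l, j)))" by (rule orth_inner[OF G])
      finally show "(\<Sum>i<k. (mat_mult k G y (i, j) - mat_mult k G x (i, j))\<^sup>2) = (\<Sum>i<k. (y (i, j) - x (i, j))\<^sup>2)"
        by (simp add: power2_eq_square)
    qed
    then show "frob k (mat_mult k G y) (mat_mult k G x) < \<delta>" using \<open>frob k y x < \<delta>\<close> by simp
  qed
  moreover have "N \<noteq> {}" using N(3) orth_one[of k] by auto
  ultimately show ?thesis using N(1,2) by auto
qed

section \<open>Spreading a tuple over a net of the orthogonal group\<close>

lemma norm_sum_scaleR_square_le: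
  fixes w :: "nat \<Rightarrow> 'a::real_normed_vector"
  shows "(norm (\<Sum>i<k. c i *\<^sub>R w i))\<^sup>2 \<le> (\<Sum>i<k. (c i)\<^sup>2) * (\<Sum>i<k. (norm (w i))\<^sup>2)"
proof -
  have "norm (\<Sum>i<k. c i *\<^sub>R w i) \<le> (\<Sum>i<k. \<bar>c i\<bar> * norm (w i))"
    by (intro order.trans[OF norm_sum] sum_mono) simp
  then have "(norm (\<Sum>i<k. c i *\<^sub>R w i))\<^sup>2 \<le> (\<Sum>i<k. \<bar>c i\<bar> * norm (w i))\<^sup>2" by (intro power_mono) auto
  also have "\<dots> \<le> (\<Sum>i<k. \<bar>c i\<bar>\<^sup>2) * (\<Sum>i<k. (norm (w i))\<^sup>2)" by (rule Cauchy_Schwarz_ineq_sum)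
  finally show ?thesis by simp
qed

text \<open>The operator norm of the covariance is at most the Hilbert-Schmidt norm of the Gram
  matrix. With y the covariance operator applied to u, the sum S is \<open>u \<bullet> y\<close>;
  Cauchy-Schwarz against the Gram matrix bounds the squared norm of y by \<open>S * \<eta>\<close>,
  and one factor S cancels.\<close>

lemma sum_inner_square_le_gram:
  fixes w :: "nat \<Rightarrow> 'a::real_inner"
  assumes "(\<Sum>i<k. \<Sum>j<k. (w i \<bullet> w j)\<^sup>2) \<le> \<eta>\<^sup>2" "\<eta> \<ge> 0"
  shows "(\<Sum>i<k. (u \<bullet> w i)\<^sup>2) \<le> \<eta> * (norm u)\<^sup>2"
proof -
  define S where "S = (\<Sum>i<k. (u \<bullet> w i)\<^sup>2)"
  define y where "y = (\<Sum>i<k. (u \<bullet> w i) *\<^sub>R w i)"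
  have S0: "S \<ge> 0" by (simp add: S_def sum_nonneg)
  have "S = u \<bullet> y" by (simp add: S_def y_def inner_sum_right power2_eq_square)
  then have 1: "S\<^sup>2 \<le> (norm u)\<^sup>2 * (norm y)\<^sup>2"
    using Cauchy_Schwarz_ineq2[of u y] S0 by (metis abs_of_nonneg power_mono power_mult_distrib)
  have "(norm y)\<^sup>2 \<le> S * \<eta>"
  proof -
    have 3: "(\<Sum>i<k. (w i \<bullet> y)\<^sup>2) \<le> S * \<eta>\<^sup>2"
    proof -
      have "(\<Sum>i<k. (w i \<bullet> y)\<^sup>2) \<le> (\<Sum>i<k. S * (\<Sum>j<k. (w i \<bullet> w j)\<^sup>2))"
      proof (intro sum_mono)
        fix i
        have "w i \<bullet> y = (\<Sum>j<k. (u \<bullet> w j) * (w i \<bullet> w j))" by (simp add: y_def inner_sum_right)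
        then show "(w i \<bullet> y)\<^sup>2 \<le> S * (\<Sum>j<k. (w i \<bullet> w j)\<^sup>2)"
          unfolding S_def by (simp add: Cauchy_Schwarz_ineq_sum)
      qed
      also have "\<dots> = S * (\<Sum>i<k. \<Sum>j<k. (w i \<bullet> w j)\<^sup>2)" by (simp add: sum_distrib_left)
      also have "\<dots> \<le> S * \<eta>\<^sup>2" using assms(1) S0 by (intro mult_left_mono)
      finally show ?thesis .
    qed
    have "(norm y)\<^sup>2 = (\<Sum>i<k. (u \<bullet> w i) * (w i \<bullet> y))"
      unfolding power2_norm_eq_inner by (subst (1) y_def) (simp add: inner_sum_left)
    also have "\<dots> \<le> sqrt ((\<Sum>i<k. (u \<bullet> w i) * (w i \<bullet> y))\<^sup>2)" by simp
    also have "\<dots> \<le> sqrt (S * (\<Sum>i<k. (w i \<bullet> y)\<^sup>2))"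
      unfolding S_def by (intro real_sqrt_le_mono Cauchy_Schwarz_ineq_sum)
    also have "\<dots> \<le> sqrt (S * (S * \<eta>\<^sup>2))"
      by (intro real_sqrt_le_mono mult_left_mono 3 S0)
    also have "S * (S * \<eta>\<^sup>2) = (S * \<eta>)\<^sup>2" by (simp add: power2_eq_square)
    finally show ?thesis using S0 assms(2) by simp
  qed
  then have "S * S \<le> S * (\<eta> * (norm u)\<^sup>2)"
    using order.trans[OF 1 mult_left_mono[of "(norm y)\<^sup>2" "S * \<eta>" "(norm u)\<^sup>2"]] by (simp add: power2_eq_square mult_ac)
  then have "S \<le> \<eta> * (norm u)\<^sup>2"
    using S0 assms(2) by (cases "S = 0") (auto simp: mult_le_cancel_left)
  then show ?thesis by (simp add: S_def)
qed

text \<open>The new tuple collects all recombinations of w by matrices U of the net. By the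
  Procrustes step \<open>T g\<close> acts on w nearly like an orthogonal matrix G, hence sends the
  U-block near the block of the product GU, and the net replaces that product by another of its
  elements.\<close>

lemma almost_permuted_tuple:
  fixes w :: "nat \<Rightarrow> 'a::real_inner" and T :: "'g \<Rightarrow> 'a \<Rightarrow> 'a"
  assumes one: "(\<Sum>i<k. (norm (w i))\<^sup>2) = 1"
    and gram: "(\<Sum>i<k. \<Sum>j<k. (w i \<bullet> w j)\<^sup>2) \<le> \<eta>\<^sup>2" and \<eta>: "\<eta> > 0"
    and lin: "\<And>g. g \<in> F \<Longrightarrow> linear (T g)"
    and inv: "\<And>g Z. g \<in> F \<Longrightarrow> linear Z \<Longrightarrow> (\<And>x. norm (Z x) \<le> norm x) \<Longrightarrow>
      (\<Sum>i<k. Z (w i) \<bullet> w i - Z (T g (w i)) \<bullet> T g (w i)) \<le> \<eta>"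
  shows "\<exists>(X :: ((nat \<times> nat \<Rightarrow> real) \<times> nat) set) v \<sigma>. finite X \<and> (\<Sum>x\<in>X. (norm (v x))\<^sup>2) = 1 \<and>
    (\<forall>u. (\<Sum>x\<in>X. (u \<bullet> v x)\<^sup>2) \<le> \<eta> * (norm u)\<^sup>2) \<and>
    (\<forall>g\<in>F. bij_betw (\<sigma> g) X X \<and> (\<Sum>x\<in>X. (norm (T g (v x) - v (\<sigma> g x)))\<^sup>2) \<le> 6 * \<eta>)"
proof -
  \<comment> \<open>The mesh \<eta> / 4 makes the squared error of the net at most \<eta>.\<close>
  obtain N where N: "finite N" "N \<subseteq> orth k" "N \<noteq> {}"
    and perm: "\<And>G. G \<in> orth k \<Longrightarrow> \<exists>\<sigma>. bij_betw \<sigma> N N \<and> (\<forall>U\<in>N. frob k (mat_mult k G U) (\<sigma> U) \<le> 4 * (\<eta> / 4))"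
    using orth_almost_permuted_net[of "\<eta> / 4" k] \<eta> by auto
  define n where "n = real (card N)"
  have n: "n > 0" using N by (simp add: n_def card_gt_0_iff)
  \<comment> \<open>Each block has squared norm 1 before scaling and there are \<open>n\<close>
    blocks, so this scaling restores total squared norm 1.\<close>
  define c where "c = 1 / sqrt n"
  have c2: "c\<^sup>2 * n = 1" using n by (simp add: c_def power_divide)
  define X where "X = N \<times> {..<k}"
  define v :: "(nat \<times> nat \<Rightarrow> real) \<times> nat \<Rightarrow> 'a" where "v = (\<lambda>(U, j). c *\<^sub>R (\<Sum>i<k. U (i, j) *\<^sub>R w i))"
  have avg: "(\<Sum>x\<in>X. f x) = s" if "\<And>U. U \<in> N \<Longrightarrow> (\<Sum>j<k. f (U, j)) = c\<^sup>2 * s" for f :: "_ \<Rightarrow> real" and s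
  proof -
    have "(\<Sum>x\<in>X. f x) = (\<Sum>U\<in>N. c\<^sup>2 * s)"
      unfolding X_def sum.cartesian_product[symmetric, of "\<lambda>U j. f (U, j)", simplified]
      by (intro sum.cong refl that)
    also have "\<dots> = (c\<^sup>2 * n) * s" by (simp add: n_def)
    finally show ?thesis using c2 by simp
  qed
  have avg_le: "(\<Sum>x\<in>X. f x) \<le> s" if "\<And>U. U \<in> N \<Longrightarrow> (\<Sum>j<k. f (U, j)) \<le> c\<^sup>2 * s" for f :: "_ \<Rightarrow> real" and s
  proof -
    have "(\<Sum>x\<in>X. f x) \<le> (\<Sum>U\<in>N. c\<^sup>2 * s)"
      unfolding X_def sum.cartesian_product[symmetric, of "\<lambda>U j. f (U, j)", simplified]
      by (intro sum_mono that)
    also have "\<dots> = (c\<^sup>2 * n) * s" by (simp add: n_def)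
    finally show ?thesis using c2 by simp
  qed
  have v1: "(\<Sum>x\<in>X. (norm (v x))\<^sup>2) = 1"
  proof (rule avg)
    fix U assume "U \<in> N"
    then have U: "U \<in> orth k" using N by blast
    have "(\<Sum>j<k. (norm (v (U, j)))\<^sup>2) = c\<^sup>2 * (\<Sum>j<k. (\<Sum>i<k. U (i, j) *\<^sub>R w i) \<bullet> (\<Sum>i<k. U (i, j) *\<^sub>R w i))"
      by (simp add: v_def power_mult_distrib sum_distrib_left power2_norm_eq_inner)
    then show "(\<Sum>j<k. (norm (v (U, j)))\<^sup>2) = c\<^sup>2 * 1"
      unfolding orth_inner_tr[OF U] using one by (simp add: power2_norm_eq_inner)
  qed
  have v2: "(\<Sum>x\<in>X. (u \<bullet> v x)\<^sup>2) \<le> \<eta> * (norm u)\<^sup>2" for u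
  proof (rule avg_le)
    fix U assume "U \<in> N"
    then have U: "U \<in> orth k" using N by blast
    have "(\<Sum>j<k. (u \<bullet> v (U, j))\<^sup>2) = c\<^sup>2 * (\<Sum>j<k. (\<Sum>i<k. U (i, j) *\<^sub>R (u \<bullet> w i)) \<bullet> (\<Sum>i<k. U (i, j) *\<^sub>R (u \<bullet> w i)))"
      by (simp add: v_def power_mult_distrib sum_distrib_left inner_sum_right power2_eq_square mult_ac)
    also have "\<dots> = c\<^sup>2 * (\<Sum>i<k. (u \<bullet> w i)\<^sup>2)"
      unfolding orth_inner_tr[OF U] by (simp add: power2_eq_square)
    also have "\<dots> \<le> c\<^sup>2 * (\<eta> * (norm u)\<^sup>2)"
      using gram \<eta> by (intro mult_left_mono sum_inner_square_le_gram) auto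
    finally show "(\<Sum>j<k. (u \<bullet> v (U, j))\<^sup>2) \<le> c\<^sup>2 * (\<eta> * (norm u)\<^sup>2)" .
  qed
  have "\<exists>\<sigma>. bij_betw \<sigma> X X \<and> (\<Sum>x\<in>X. (norm (T g (v x) - v (\<sigma> x)))\<^sup>2) \<le> 6 * \<eta>" if g: "g \<in> F" for g
  proof -
    interpret linear "T g" by (rule lin[OF g])
    define b where "b = (\<lambda>i. T g (w i))"
    obtain G Z where G: "G \<in> orth k" and Z: "linear Z" "\<And>x. norm (Z x) \<le> norm x"
      and le: "(\<Sum>j<k. (norm ((\<Sum>l<k. G (l, j) *\<^sub>R w l) - b j))\<^sup>2) \<le> 2 * (\<Sum>j<k. Z (w j) \<bullet> w j - Z (b j) \<bullet> b j)"
      using procrustes_le_trace_distance[of k w b] by blast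
    define y where "y = (\<lambda>j. b j - (\<Sum>l<k. G (l, j) *\<^sub>R w l))"
    have y: "(\<Sum>j<k. (norm (y j))\<^sup>2) \<le> 2 * \<eta>"
      using le inv[OF g Z] by (simp add: y_def b_def norm_minus_commute)
    obtain \<tau> where \<tau>: "bij_betw \<tau> N N" "\<And>U. U \<in> N \<Longrightarrow> frob k (mat_mult k G U) (\<tau> U) \<le> \<eta>"
      using perm[OF G] by auto
    define \<sigma> where "\<sigma> = map_prod \<tau> (id :: nat \<Rightarrow> nat)"
    have "bij_betw \<sigma> X X"
      unfolding \<sigma>_def X_def using \<tau>(1) by (intro bij_betw_map_prod) auto
    moreover have "(\<Sum>x\<in>X. (norm (T g (v x) - v (\<sigma> x)))\<^sup>2) \<le> 6 * \<eta>"
    proof (rule avg_le)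
      fix U assume UN: "U \<in> N"
      then have U: "U \<in> orth k" using N by blast
      define D where "D = (\<lambda>l j. mat_mult k G U (l, j) - \<tau> U (l, j))"
      have eq: "T g (v (U, j)) - v (\<sigma> (U, j)) = c *\<^sub>R ((\<Sum>i<k. U (i, j) *\<^sub>R y i) + (\<Sum>l<k. D l j *\<^sub>R w l))"
        if j: "j < k" for j
      proof -
        have "(\<Sum>i<k. U (i, j) *\<^sub>R (\<Sum>l<k. G (l, i) *\<^sub>R w l)) = (\<Sum>i<k. \<Sum>l<k. (G (l, i) * U (i, j)) *\<^sub>R w l)"
          by (simp add: scaleR_sum_right mult.commute)
        also have "\<dots> = (\<Sum>l<k. \<Sum>i<k. (G (l, i) * U (i, j)) *\<^sub>R w l)" by (rule sum.swap)
        also have "\<dots> = (\<Sum>l<k. mat_mult k G U (l, j) *\<^sub>R w l)"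
          using j by (intro sum.cong refl) (simp add: mat_mult_def scaleR_sum_left)
        finally have 1: "(\<Sum>i<k. U (i, j) *\<^sub>R (\<Sum>l<k. G (l, i) *\<^sub>R w l)) = (\<Sum>l<k. mat_mult k G U (l, j) *\<^sub>R w l)" .
        have "T g (v (U, j)) = c *\<^sub>R (\<Sum>i<k. U (i, j) *\<^sub>R b i)"
          by (simp add: v_def b_def scale sum)
        then show ?thesis
          by (simp add: v_def \<sigma>_def y_def D_def scaleR_diff_right scaleR_diff_left sum_subtractf 1)
      qed
      have "(\<Sum>j<k. (norm (T g (v (U, j)) - v (\<sigma> (U, j))))\<^sup>2)
        = (\<Sum>j<k. c\<^sup>2 * (norm ((\<Sum>i<k. U (i, j) *\<^sub>R y i) + (\<Sum>l<k. D l j *\<^sub>R w l)))\<^sup>2)"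
        by (intro sum.cong refl) (simp add: eq power_mult_distrib)
      also have "\<dots> \<le> (\<Sum>j<k. c\<^sup>2 * (2 * ((\<Sum>i<k. U (i, j) *\<^sub>R y i) \<bullet> (\<Sum>i<k. U (i, j) *\<^sub>R y i)) + 2 * (\<Sum>l<k. (D l j)\<^sup>2)))"
      proof (intro sum_mono mult_left_mono)
        fix j
        define p q where "p = (\<Sum>i<k. U (i, j) *\<^sub>R y i)" and "q = (\<Sum>l<k. D l j *\<^sub>R w l)"
        have "(norm (p + q))\<^sup>2 + (norm (p - q))\<^sup>2 = 2 * (norm p)\<^sup>2 + 2 * (norm q)\<^sup>2"
          by (simp add: power2_norm_eq_inner inner_diff inner_add inner_commute)
        then have "(norm (p + q))\<^sup>2 \<le> 2 * (norm p)\<^sup>2 + 2 * (norm q)\<^sup>2"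
          using zero_le_power2[of "norm (p - q)"] by linarith
        moreover have "(norm q)\<^sup>2 \<le> (\<Sum>l<k. (D l j)\<^sup>2)"
          using norm_sum_scaleR_square_le[of "\<lambda>l. D l j" w k] one by (simp add: q_def)
        ultimately show "(norm (p + q))\<^sup>2 \<le> 2 * (p \<bullet> p) + 2 * (\<Sum>l<k. (D l j)\<^sup>2)"
          by (simp add: power2_norm_eq_inner)
      qed auto
      also have "\<dots> = c\<^sup>2 * (2 * (\<Sum>j<k. (norm (y j))\<^sup>2) + 2 * frob k (mat_mult k G U) (\<tau> U))"
        unfolding sum_distrib_left[symmetric] sum.distrib orth_inner_tr[OF U] frob_def D_def
        by (simp add: power2_norm_eq_inner)
      \<comment> \<open>Here 6 is 2 times the Procrustes error \<open>2 * \<eta>\<close> plus 2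
        times the net error \<eta>.\<close>
      also have "\<dots> \<le> c\<^sup>2 * (6 * \<eta>)"
        using y \<tau>(2)[OF UN] by (intro mult_left_mono) auto
      finally show "(\<Sum>j<k. (norm (T g (v (U, j)) - v (\<sigma> (U, j))))\<^sup>2) \<le> c\<^sup>2 * (6 * \<eta>)" .
    qed
    ultimately show ?thesis by blast
  qed
  then have "\<forall>g\<in>F. \<exists>\<sigma>. bij_betw \<sigma> X X \<and> (\<Sum>x\<in>X. (norm (T g (v x) - v (\<sigma> x)))\<^sup>2) \<le> 6 * \<eta>"
    by blast
  from bchoice[OF this] obtain \<sigma> where
    \<sigma>: "\<forall>g\<in>F. bij_betw (\<sigma> g) X X \<and> (\<Sum>x\<in>X. (norm (T g (v x) - v (\<sigma> g x)))\<^sup>2) \<le> 6 * \<eta>" ..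
  have "finite X" using N by (simp add: X_def)
  then show ?thesis
    by (intro exI[of _ X] exI[of _ v] exI[of _ \<sigma>] conjI allI v1 v2 \<sigma>)
qed

section \<open>Concentration of signed sums\<close>

definition flip :: "'i \<Rightarrow> 'i set \<Rightarrow> 'i set" where
  "flip x A = (if x \<in> A then A - {x} else insert x A)"

lemma sum_Pow_insert:
  fixes g :: "'i set \<Rightarrow> 'b::comm_monoid_add"
  assumes "finite X" "x \<notin> X"
  shows "(\<Sum>A\<in>Pow (insert x X). g A) = (\<Sum>A\<in>Pow X. g A + g (insert x A))"
proof -
  have inj: "inj_on (insert x) (Pow X)"
    using assms(2) by (auto simp: inj_on_def)
  have "(\<Sum>A\<in>Pow (insert x X). g A) = (\<Sum>A\<in>Pow X. g A) + (\<Sum>A\<in>insert x ` Pow X. g A)"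
    unfolding Pow_insert using assms by (intro sum.union_disjoint) auto
  also have "(\<Sum>A\<in>insert x ` Pow X. g A) = (\<Sum>A\<in>Pow X. g (insert x A))"
    using inj by (simp add: sum.reindex)
  finally show ?thesis by (simp add: sum.distrib)
qed

text \<open>Efron-Stein for the uniform measure on the cube, multiplied by the squared number of
  vertices. An edge has at most one endpoint from which f increases, so each edge contributes its
  squared difference once. In the induction the cube is cut along x, and the difference of the two
  half sums is absorbed by the edges in direction x through Cauchy-Schwarz.\<close>

lemma cube_poincare:
  fixes f :: "'i set \<Rightarrow> real"
  assumes "finite X"
  shows "2 ^ card X * (\<Sum>A\<in>Pow X. (f A)\<^sup>2) - (\<Sum>A\<in>Pow X. f A)\<^sup>2
    \<le> 2 ^ card X / 2 * (\<Sum>A\<in>Pow X. \<Sum>x\<in>X. (max 0 (f (flip x A) - f A))\<^sup>2)"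
  using assms
proof (induction X arbitrary: f)
  case empty
  then show ?case by simp
next
  case (insert x X)
  define f1 where "f1 = (\<lambda>A. f (insert x A))"
  define n :: real where "n = 2 ^ card X"
  define R where "R = (\<lambda>h::'i set \<Rightarrow> real. \<Sum>A\<in>Pow X. \<Sum>y\<in>X. (max 0 (h (flip y A) - h A))\<^sup>2)"
  define a b where "a = (\<Sum>A\<in>Pow X. f A)" and "b = (\<Sum>A\<in>Pow X. f1 A)"
  define a2 b2 where "a2 = (\<Sum>A\<in>Pow X. (f A)\<^sup>2)" and "b2 = (\<Sum>A\<in>Pow X. (f1 A)\<^sup>2)"
  define d where "d = (\<Sum>A\<in>Pow X. (f A - f1 A)\<^sup>2)"
  have IH0: "n * a2 - a\<^sup>2 \<le> n / 2 * R f"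
    using insert.IH[of f] by (simp add: n_def a2_def a_def R_def)
  have IH1: "n * b2 - b\<^sup>2 \<le> n / 2 * R f1"
    using insert.IH[of f1] by (simp add: n_def b2_def b_def R_def)
  have cs: "(a - b)\<^sup>2 \<le> n * d"
  proof -
    have "(\<Sum>A\<in>Pow X. f A - f1 A)\<^sup>2 \<le> (\<Sum>A\<in>Pow X. (f A - f1 A)\<^sup>2) * card (Pow X)"
      by (rule sum_squared_le_sum_of_squares)
    then show ?thesis
      using insert.hyps by (simp add: a_def b_def d_def n_def sum_subtractf card_Pow mult.commute)
  qed
  have n': "2 ^ card (insert x X) = 2 * n"
    using insert.hyps by (simp add: n_def)
  have s1: "(\<Sum>A\<in>Pow (insert x X). f A) = a + b"
    using insert.hyps by (simp add: sum_Pow_insert a_def b_def f1_def sum.distrib)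
  have s2: "(\<Sum>A\<in>Pow (insert x X). (f A)\<^sup>2) = a2 + b2"
    using insert.hyps by (simp add: sum_Pow_insert a2_def b2_def f1_def sum.distrib)
  have s3: "(\<Sum>A\<in>Pow (insert x X). \<Sum>y\<in>insert x X. (max 0 (f (flip y A) - f A))\<^sup>2) = d + R f + R f1"
  proof -
    have "(\<Sum>y\<in>insert x X. (max 0 (f (flip y A) - f A))\<^sup>2)
        + (\<Sum>y\<in>insert x X. (max 0 (f (flip y (insert x A)) - f (insert x A)))\<^sup>2)
      = (f A - f1 A)\<^sup>2 + (\<Sum>y\<in>X. (max 0 (f (flip y A) - f A))\<^sup>2)
        + (\<Sum>y\<in>X. (max 0 (f1 (flip y A) - f1 A))\<^sup>2)" if "A \<in> Pow X" for A
    proof -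
      have "x \<notin> A" using that insert.hyps by auto
      then have 1: "flip x A = insert x A" "flip x (insert x A) = A" by (auto simp: flip_def)
      have 2: "flip y (insert x A) = insert x (flip y A)" if "y \<in> X" for y
        using that insert.hyps by (auto simp: flip_def)
      have 3: "(max 0 (f (insert x A) - f A))\<^sup>2 + (max 0 (f A - f (insert x A)))\<^sup>2 = (f A - f1 A)\<^sup>2"
        by (cases "f A \<le> f (insert x A)") (auto simp: f1_def max_def power2_commute)
      have 4: "(\<Sum>y\<in>X. (max 0 (f (flip y (insert x A)) - f (insert x A)))\<^sup>2)
        = (\<Sum>y\<in>X. (max 0 (f1 (flip y A) - f1 A))\<^sup>2)"
        by (intro sum.cong refl) (simp add: 2 f1_def)
      show ?thesis using insert.hyps 3 4 by (simp add: 1)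
    qed
    then have "(\<Sum>A\<in>Pow (insert x X). \<Sum>y\<in>insert x X. (max 0 (f (flip y A) - f A))\<^sup>2)
      = (\<Sum>A\<in>Pow X. (f A - f1 A)\<^sup>2 + (\<Sum>y\<in>X. (max 0 (f (flip y A) - f A))\<^sup>2)
        + (\<Sum>y\<in>X. (max 0 (f1 (flip y A) - f1 A))\<^sup>2))"
      unfolding sum_Pow_insert[OF insert.hyps] by (rule sum.cong[OF refl])
    then show ?thesis by (simp only: d_def R_def sum.distrib)
  qed
  have "(2 * n) * (a2 + b2) - (a + b)\<^sup>2 = 2 * (n * a2 - a\<^sup>2) + 2 * (n * b2 - b\<^sup>2) + (a - b)\<^sup>2"
    by (simp add: power2_eq_square algebra_simps)
  also have "\<dots> \<le> 2 * (n / 2 * R f) + 2 * (n / 2 * R f1) + n * d"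
    by (intro add_mono mult_left_mono IH0 IH1 cs) auto
  also have "\<dots> = 2 * n / 2 * (d + R f + R f1)"
    by (simp add: algebra_simps)
  finally show ?case
    unfolding n' s1 s2 s3 .
qed

text \<open>A subset A of X encodes a choice of signs, plus on A and minus elsewhere, so that
  averages over \<open>Pow X\<close> are expectations over independent fair signs.\<close>

definition signed_sum :: "('i \<Rightarrow> 'a::real_inner) \<Rightarrow> 'i set \<Rightarrow> 'i set \<Rightarrow> 'a" where
  "signed_sum v X A = (\<Sum>x\<in>X. if x \<in> A then v x else - v x)"

lemma sum_norm_signed_sum:
  fixes v :: "'i \<Rightarrow> 'a::real_inner"
  assumes "finite X"
  shows "(\<Sum>A\<in>Pow X. (norm (signed_sum v X A))\<^sup>2) = 2 ^ card X * (\<Sum>x\<in>X. (norm (v x))\<^sup>2)"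
  using assms
proof (induction X)
  case empty
  then show ?case by (simp add: signed_sum_def)
next
  case (insert x X)
  have eq: "signed_sum v (insert x X) A = signed_sum v X A - v x"
    "signed_sum v (insert x X) (insert x A) = signed_sum v X A + v x" if "A \<in> Pow X" for A
  proof -
    have "x \<notin> A" using that insert.hyps by auto
    then show "signed_sum v (insert x X) A = signed_sum v X A - v x"
      using insert.hyps by (simp add: signed_sum_def)
    have "(\<Sum>y\<in>X. if y = x \<or> y \<in> A then v y else - v y) = (\<Sum>y\<in>X. if y \<in> A then v y else - v y)"
      using insert.hyps by (intro sum.cong) auto
    then show "signed_sum v (insert x X) (insert x A) = signed_sum v X A + v x"
      using insert.hyps by (simp add: signed_sum_def)
  qed
  have "(norm (u - w))\<^sup>2 + (norm (u + w))\<^sup>2 = 2 * (norm u)\<^sup>2 + 2 * (norm w)\<^sup>2" for u w :: 'a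
    by (simp add: power2_norm_eq_inner inner_diff inner_add inner_commute)
  then have "(\<Sum>A\<in>Pow (insert x X). (norm (signed_sum v (insert x X) A))\<^sup>2)
    = (\<Sum>A\<in>Pow X. 2 * (norm (signed_sum v X A))\<^sup>2 + 2 * (norm (v x))\<^sup>2)"
    using insert.hyps by (simp add: sum_Pow_insert eq)
  also have "\<dots> = 2 * (\<Sum>A\<in>Pow X. (norm (signed_sum v X A))\<^sup>2) + 2 ^ card X * (2 * (norm (v x))\<^sup>2)"
    using insert.hyps by (simp add: sum.distrib sum_distrib_left card_Pow)
  finally show ?case
    using insert by (simp add: algebra_simps)
qed

lemma signed_sum_flip:
  assumes "finite X" "x \<in> X"
  shows "signed_sum v X (flip x A) = signed_sum v X A + (if x \<in> A then - 2 else 2) *\<^sub>R v x"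
proof -
  have "signed_sum v X (flip x A) = (if x \<in> A then - v x else v x)
      + (\<Sum>y\<in>X - {x}. if y \<in> A then v y else - v y)"
    unfolding signed_sum_def using assms
    by (subst sum.remove[OF assms]) (auto simp: flip_def intro!: sum.cong)
  moreover have "signed_sum v X A = (if x \<in> A then v x else - v x)
      + (\<Sum>y\<in>X - {x}. if y \<in> A then v y else - v y)"
    unfolding signed_sum_def using assms by (subst sum.remove[OF assms]) auto
  ultimately show ?thesis by (simp add: scaleR_2)
qed

text \<open>A permutation of X acts on the cube by taking images and so preserves counting: this is
  the permutation invariance of the law of the signs.\<close>

lemma signed_sum_image:
  assumes "bij_betw \<sigma> X X" "A \<subseteq> X"
  shows "signed_sum v X (\<sigma> ` A) = signed_sum (\<lambda>x. v (\<sigma> x)) X A"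
proof -
  have "signed_sum v X (\<sigma> ` A) = (\<Sum>x\<in>X. if \<sigma> x \<in> \<sigma> ` A then v (\<sigma> x) else - v (\<sigma> x))"
    unfolding signed_sum_def by (rule sum.reindex_bij_betw[OF assms(1), symmetric])
  also have "\<dots> = signed_sum (\<lambda>x. v (\<sigma> x)) X A"
    unfolding signed_sum_def
    using assms by (intro sum.cong refl if_cong)
      (use assms in \<open>auto simp: bij_betw_def dest: inj_onD\<close>)
  finally show ?thesis .
qed

text \<open>The hypothesis on f is the semiconcavity of a squared distance, with \<open>p u\<close>
  a nearest point. It bounds increments from above only, which is all that
  \<open>cube_poincare\<close> asks for; \<open>small\<close> then controls the sum over x of the
  squared linear terms.\<close>

lemma signed_sum_variance:
  fixes v :: "'i \<Rightarrow> 'a::real_inner" and f :: "'a \<Rightarrow> real"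
  assumes fin: "finite X" and one: "(\<Sum>x\<in>X. (norm (v x))\<^sup>2) = 1"
    and small: "\<And>u. (\<Sum>x\<in>X. (u \<bullet> v x)\<^sup>2) \<le> \<eta> * (norm u)\<^sup>2"
    and f: "\<And>u h. f (u + h) \<le> f u + 2 * ((u - p u) \<bullet> h) + (norm h)\<^sup>2"
    and p: "\<And>u. norm (p u) \<le> 1"
  shows "2 ^ card X * (\<Sum>A\<in>Pow X. (f (signed_sum v X A))\<^sup>2) - (\<Sum>A\<in>Pow X. f (signed_sum v X A))\<^sup>2
    \<le> (2 ^ card X)\<^sup>2 * (80 * \<eta>)"
proof -
  define \<xi> where "\<xi> = signed_sum v X"
  \<comment> \<open>Applying \<open>small\<close> to \<open>v x\<close> itself shows that no single
    vector is large, which tames the quadratic terms of the increments.\<close>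
  have v4: "(norm (v x))^4 \<le> \<eta> * (norm (v x))\<^sup>2" if "x \<in> X" for x
  proof -
    have "(v x \<bullet> v x)\<^sup>2 \<le> (\<Sum>y\<in>X. (v x \<bullet> v y)\<^sup>2)"
      using fin that by (intro member_le_sum) auto
    also have "\<dots> \<le> \<eta> * (norm (v x))\<^sup>2" by (rule small)
    finally show ?thesis by (simp add: dot_square_norm)
  qed
  have \<eta>: "\<eta> \<ge> 0"
  proof -
    obtain x where "x \<in> X" "v x \<noteq> 0"
    proof (rule ccontr)
      assume "\<not> thesis"
      then have "(\<Sum>x\<in>X. (norm (v x))\<^sup>2) = 0" using that by (intro sum.neutral) auto
      then show False using one by simp
    qed
    have "0 \<le> (\<Sum>y\<in>X. (v x \<bullet> v y)\<^sup>2)" by (simp add: sum_nonneg)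
    also have "\<dots> \<le> \<eta> * (norm (v x))\<^sup>2" by (rule small)
    finally show ?thesis using \<open>v x \<noteq> 0\<close> by (simp add: zero_le_mult_iff)
  qed
  have step: "(max 0 (f (\<xi> (flip x A)) - f (\<xi> A)))\<^sup>2
      \<le> 32 * ((\<xi> A - p (\<xi> A)) \<bullet> v x)\<^sup>2 + 32 * (\<eta> * (norm (v x))\<^sup>2)" if "x \<in> X" for x A
  proof -
    \<comment> \<open>Flipping the sign of x moves the sum by twice \<open>v x\<close>; this is the
      origin of the factors 4 and 16 below.\<close>
    define h where "h = (if x \<in> A then - 2 else 2) *\<^sub>R v x"
    define s where "s = (\<xi> A - p (\<xi> A)) \<bullet> h"
    have "f (\<xi> (flip x A)) - f (\<xi> A) \<le> 2 * s + (norm h)\<^sup>2"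
      using f[of "\<xi> A" h] signed_sum_flip[OF fin that, of v A] by (simp add: h_def \<xi>_def s_def)
    then have "(max 0 (f (\<xi> (flip x A)) - f (\<xi> A)))\<^sup>2 \<le> (max 0 (2 * s + (norm h)\<^sup>2))\<^sup>2"
      by (intro power_mono) auto
    also have "\<dots> \<le> (2 * s + (norm h)\<^sup>2)\<^sup>2"
      by (simp add: max_def)
    also have "\<dots> \<le> 8 * s\<^sup>2 + 2 * (norm h)^4"
      using sum_squares_bound[of "2 * s" "(norm h)\<^sup>2"] by (simp add: power2_eq_square algebra_simps power4_eq_xxxx)
    also have "s\<^sup>2 = 4 * ((\<xi> A - p (\<xi> A)) \<bullet> v x)\<^sup>2"
      by (simp add: s_def h_def power2_eq_square)
    also have "(norm h)^4 = 16 * (norm (v x))^4"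
      by (simp add: h_def power_mult_distrib)
    finally show ?thesis using v4[OF that] by simp
  qed
  have "(\<Sum>A\<in>Pow X. \<Sum>x\<in>X. (max 0 (f (\<xi> (flip x A)) - f (\<xi> A)))\<^sup>2)
      \<le> (\<Sum>A\<in>Pow X. 64 * \<eta> * (norm (\<xi> A))\<^sup>2 + 96 * \<eta>)"
  proof (intro sum_mono)
    fix A
    have "(\<Sum>x\<in>X. (max 0 (f (\<xi> (flip x A)) - f (\<xi> A)))\<^sup>2)
       \<le> (\<Sum>x\<in>X. 32 * ((\<xi> A - p (\<xi> A)) \<bullet> v x)\<^sup>2 + 32 * (\<eta> * (norm (v x))\<^sup>2))"
      by (intro sum_mono step)
    also have "\<dots> = 32 * (\<Sum>x\<in>X. ((\<xi> A - p (\<xi> A)) \<bullet> v x)\<^sup>2) + 32 * \<eta> * (\<Sum>x\<in>X. (norm (v x))\<^sup>2)"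
      by (simp add: sum.distrib sum_distrib_left mult.assoc)
    also have "\<dots> \<le> 32 * (\<eta> * (norm (\<xi> A - p (\<xi> A)))\<^sup>2) + 32 * \<eta>"
      using small[of "\<xi> A - p (\<xi> A)"] by (simp add: one)
    also have "(norm (\<xi> A - p (\<xi> A)))\<^sup>2 \<le> 2 * (norm (\<xi> A))\<^sup>2 + 2"
    proof -
      have "(norm (\<xi> A - p (\<xi> A)))\<^sup>2 \<le> (norm (\<xi> A) + 1)\<^sup>2"
        using norm_triangle_ineq4[of "\<xi> A" "p (\<xi> A)"] p[of "\<xi> A"] by (intro power_mono) auto
      also have "\<dots> \<le> 2 * (norm (\<xi> A))\<^sup>2 + 2"
        using sum_squares_bound[of "norm (\<xi> A)" 1] by (simp add: power2_eq_square algebra_simps)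
      finally show ?thesis .
    qed
    finally have "(\<Sum>x\<in>X. (max 0 (f (\<xi> (flip x A)) - f (\<xi> A)))\<^sup>2)
        \<le> 32 * (\<eta> * (2 * (norm (\<xi> A))\<^sup>2 + 2)) + 32 * \<eta>"
      using \<eta> by (simp add: mult_left_mono)
    then show "(\<Sum>x\<in>X. (max 0 (f (\<xi> (flip x A)) - f (\<xi> A)))\<^sup>2)
        \<le> 64 * \<eta> * (norm (\<xi> A))\<^sup>2 + 96 * \<eta>"
      by (simp add: algebra_simps)
  qed
  \<comment> \<open>The squared norm of the signed sum has mean 1, so 64 + 96 = 160; the factor 1/2
    of the Efron-Stein inequality leaves 80.\<close>
  also have "\<dots> = 160 * \<eta> * 2 ^ card X"
    using sum_norm_signed_sum[OF fin, of v] fin one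
    by (simp add: sum.distrib card_Pow \<xi>_def flip: sum_distrib_left)
  finally have "2 ^ card X / 2 * (\<Sum>A\<in>Pow X. \<Sum>x\<in>X. (max 0 (f (\<xi> (flip x A)) - f (\<xi> A)))\<^sup>2)
     \<le> 2 ^ card X / 2 * (160 * \<eta> * 2 ^ card X)"
    by (intro mult_left_mono) auto
  also have "\<dots> = (2 ^ card X)\<^sup>2 * (80 * \<eta>)"
    by (simp add: power2_eq_square)
  finally show ?thesis
    using cube_poincare[OF fin, of "\<lambda>A. f (\<xi> A)"] unfolding \<xi>_def by (rule order.trans[rotated])
qed

section \<open>From small variance to simultaneous closeness\<close>

lemma card_chebyshev:
  fixes F :: "'b \<Rightarrow> real" and s c :: real
  assumes fin: "finite S" and s: "s > 0"
    and var: "card S * (\<Sum>A\<in>S. (F A)\<^sup>2) - (\<Sum>A\<in>S. F A)\<^sup>2 \<le> (real (card S))\<^sup>2 * c"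
  shows "card {A\<in>S. \<bar>F A - (\<Sum>A\<in>S. F A) / card S\<bar> \<ge> s} * s\<^sup>2 \<le> card S * c"
proof (cases "S = {}")
  case False
  then have N: "real (card S) > 0" using fin by (simp add: card_gt_0_iff)
  define m where "m = (\<Sum>A\<in>S. F A) / card S"
  define B where "B = {A\<in>S. \<bar>F A - m\<bar> \<ge> s}"
  have "card B * s\<^sup>2 = (\<Sum>A\<in>B. s\<^sup>2)" by simp
  also have "\<dots> \<le> (\<Sum>A\<in>B. (F A - m)\<^sup>2)"
  proof (intro sum_mono)
    fix A assume "A \<in> B"
    then have "\<bar>s\<bar> \<le> \<bar>F A - m\<bar>" using s by (auto simp: B_def)
    then show "s\<^sup>2 \<le> (F A - m)\<^sup>2" by (simp only: abs_le_square_iff)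
  qed
  also have "\<dots> \<le> (\<Sum>A\<in>S. (F A - m)\<^sup>2)"
    using fin by (intro sum_mono2) (auto simp: B_def)
  also have "\<dots> = (\<Sum>A\<in>S. (F A)\<^sup>2) - 2 * m * (\<Sum>A\<in>S. F A) + card S * m\<^sup>2"
  proof -
    have "(F A - m)\<^sup>2 = (F A)\<^sup>2 - 2 * m * F A + m\<^sup>2" for A
      by (simp add: power2_diff)
    then show ?thesis by (simp add: sum.distrib sum_subtractf sum_distrib_left)
  qed
  also have "\<dots> = (card S * (\<Sum>A\<in>S. (F A)\<^sup>2) - (\<Sum>A\<in>S. F A)\<^sup>2) / card S"
    using N by (simp add: m_def field_simps power2_eq_square)
  also have "\<dots> \<le> (real (card S))\<^sup>2 * c / card S"
    using var N by (intro divide_right_mono) auto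
  also have "\<dots> = card S * c" using N by (simp add: power2_eq_square)
  finally show ?thesis by (simp add: B_def m_def)
qed simp

text \<open>Each use of Chebyshev's inequality at threshold \<open>\<tau>\<^sup>2\<close> loses at
  most a proportion 80 \<beta> of the cube, where \<beta> = \<eta> / \<tau>^4. The hypothesis on
  \<eta> keeps two union bounds, one over the cover and one over F, below the whole cube.\<close>

lemma almost_permuted_concentration:
  fixes v :: "'i \<Rightarrow> 'a::real_inner" and T :: "'g \<Rightarrow> 'a \<Rightarrow> 'a"
  assumes fin: "finite X" and one: "(\<Sum>x\<in>X. (norm (v x))\<^sup>2) = 1"
    and small: "\<And>u. (\<Sum>x\<in>X. (u \<bullet> v x)\<^sup>2) \<le> \<eta> * (norm u)\<^sup>2"
    and finF: "finite F" and fin\<C>: "finite \<C>" and cover: "sphere 0 1 \<subseteq> \<Union>\<C>"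
    and lin: "\<And>g. g \<in> F \<Longrightarrow> linear (T g)" and iso: "\<And>g x. g \<in> F \<Longrightarrow> norm (T g x) = norm x"
    and bij: "\<And>g. g \<in> F \<Longrightarrow> bij_betw (\<sigma> g) X X"
    and perm: "\<And>g. g \<in> F \<Longrightarrow> (\<Sum>x\<in>X. (norm (T g (v x) - v (\<sigma> g x)))\<^sup>2) \<le> \<eta>"
    and \<tau>: "0 < \<tau>" "\<tau> \<le> 1 / 2"
    and \<eta>: "\<eta> * (200 * (real (card \<C>) + 1) * (real (card F) + 1)) = \<tau>^4"
  shows "\<exists>C\<in>\<C>. \<exists>z. norm z = 1 \<and> (\<forall>g\<in>F. \<exists>a\<in>C. dist (T g z) a < 4 * \<tau>)"
proof -
  define N :: real where "N = 2 ^ card X"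
  have N: "N > 0" and cardP: "real (card (Pow X)) = N"
    using fin by (auto simp: N_def card_Pow)
  define k c where "k = real (card F)" and "c = real (card \<C>) + 1"
  have kc: "k \<ge> 0" "c \<ge> 1" by (auto simp: k_def c_def)
  have \<eta>_eq: "\<eta> * (200 * c * (k + 1)) = \<tau>^4"
    unfolding k_def c_def by (rule \<eta>)
  moreover have "200 * c * (k + 1) > 0" using kc by simp
  moreover have "0 < \<tau>^4" using \<tau> by simp
  ultimately have \<eta>_pos: "\<eta> > 0" using zero_less_mult_pos2 by metis
  define \<xi> where "\<xi> = signed_sum v X"
  have norm_sgn_scale: "norm u *\<^sub>R sgn u = u" for u :: 'a
    by (cases "u = 0") (auto simp: sgn_div_norm)
  define \<beta> where "\<beta> = \<eta> / \<tau>^4"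
  have \<beta>: "\<beta> * (200 * c * (k + 1)) = 1" "\<beta> > 0"
    using \<eta>_eq \<eta>_pos \<tau> by (auto simp: \<beta>_def field_simps)
  have \<eta>\<beta>: "\<eta> = \<beta> * \<tau>^4" using \<tau> by (simp add: \<beta>_def)
  have cheb: "card {A\<in>Pow X. \<bar>f (\<xi> A) - (\<Sum>A\<in>Pow X. f (\<xi> A)) / N\<bar> \<ge> \<tau>\<^sup>2} \<le> N * (80 * \<beta>)"
    if "\<And>u h. f (u + h) \<le> f u + 2 * ((u - p u) \<bullet> h) + (norm h)\<^sup>2" "\<And>u. norm (p u) \<le> 1" for f p
  proof -
    have "card {A\<in>Pow X. \<bar>f (\<xi> A) - (\<Sum>A\<in>Pow X. f (\<xi> A)) / N\<bar> \<ge> \<tau>\<^sup>2} * (\<tau>\<^sup>2)\<^sup>2 \<le> N * (80 * \<eta>)"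
      using card_chebyshev[of "Pow X" "\<tau>\<^sup>2" "\<lambda>A. f (\<xi> A)" "80 * \<eta>"]
        signed_sum_variance[OF fin one small that] fin \<tau>
      unfolding cardP by (simp add: \<xi>_def N_def)
    then show ?thesis using \<tau> by (simp add: \<eta>\<beta> flip: power_mult)
  qed
  \<comment> \<open>The squared norm is the squared distance to 0, so \<open>cheb\<close> applies
    with \<open>p\<close> constantly 0; its mean is 1.\<close>
  define B0 where "B0 = {A\<in>Pow X. \<bar>(norm (\<xi> A))\<^sup>2 - 1\<bar> \<ge> \<tau>\<^sup>2}"
  have B0: "card B0 \<le> N * (80 * \<beta>)"
    using cheb[of "\<lambda>u. (norm u)\<^sup>2" "\<lambda>u. 0"] sum_norm_signed_sum[OF fin, of v] N
    by (simp add: one B0_def \<xi>_def flip: N_def) (simp add: power2_norm_eq_inner inner_add inner_commute)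
  have fB0: "finite B0" "B0 \<subseteq> Pow X" using fin by (auto simp: B0_def)
  have norm\<xi>: "\<xi> A \<noteq> 0" "\<bar>norm (\<xi> A) - 1\<bar> \<le> \<tau>" if "A \<in> Pow X - B0" for A
  proof -
    have 1: "\<bar>(norm (\<xi> A))\<^sup>2 - 1\<bar> < \<tau>\<^sup>2" using that by (auto simp: B0_def)
    have 2: "\<tau>\<^sup>2 \<le> \<tau>" using \<tau> by (simp add: power2_eq_square mult_left_le)
    show "\<xi> A \<noteq> 0" using 1 2 \<tau> by auto
    have "\<bar>norm (\<xi> A) - 1\<bar> \<le> \<bar>norm (\<xi> A) - 1\<bar> * (norm (\<xi> A) + 1)"
      by (simp add: mult_le_cancel_left1)
    also have "\<dots> = \<bar>(norm (\<xi> A) - 1) * (norm (\<xi> A) + 1)\<bar>" by (simp add: abs_mult)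
    also have "(norm (\<xi> A) - 1) * (norm (\<xi> A) + 1) = (norm (\<xi> A))\<^sup>2 - 1"
      by (simp add: power2_eq_square algebra_simps)
    finally show "\<bar>norm (\<xi> A) - 1\<bar> \<le> \<tau>" using 1 2 by linarith
  qed
  define D where "D = (\<lambda>C. {A\<in>Pow X - B0. sgn (\<xi> A) \<in> C})"
  have finD: "finite (D C)" for C using fin by (auto simp: D_def)
  \<comment> \<open>Pigeonhole with a purposeful threshold: a set \<open>D C\<close> larger than 80
    \<beta> of the cube cannot lie inside the exceptional set of the next application of
    \<open>cheb\<close>.\<close>
  have "\<exists>C\<in>\<C>. N * (80 * \<beta>) < real (card (D C))"
  proof (rule ccontr)
    assume "\<not> (\<exists>C\<in>\<C>. N * (80 * \<beta>) < real (card (D C)))"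
    then have le: "real (card (D C)) \<le> N * (80 * \<beta>)" if "C \<in> \<C>" for C
      using that by (simp add: not_less)
    have "Pow X \<subseteq> B0 \<union> (\<Union>C\<in>\<C>. D C)"
    proof
      fix A assume A: "A \<in> Pow X"
      show "A \<in> B0 \<union> (\<Union>C\<in>\<C>. D C)"
      proof (cases "A \<in> B0")
        case False
        then have "sgn (\<xi> A) \<in> sphere 0 1" using norm\<xi>[of A] A by (simp add: norm_sgn)
        then show ?thesis using cover A False by (auto simp: D_def)
      qed simp
    qed
    then have "card (Pow X) \<le> card (B0 \<union> (\<Union>C\<in>\<C>. D C))"
      using fB0 fin\<C> finD by (intro card_mono) auto
    also have "\<dots> \<le> card B0 + (\<Sum>C\<in>\<C>. card (D C))"
      using fin\<C> by (intro order.trans[OF card_Un_le] add_left_mono card_UN_le)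
    finally have "N \<le> real (card B0) + (\<Sum>C\<in>\<C>. real (card (D C)))"
      unfolding cardP[symmetric] by (metis of_nat_add of_nat_le_iff of_nat_sum)
    also have "\<dots> \<le> N * (80 * \<beta>) + (\<Sum>C\<in>\<C>. N * (80 * \<beta>))"
      by (intro add_mono sum_mono B0 le)
    also have "\<dots> = N * (80 * (\<beta> * c))" by (simp add: c_def algebra_simps)
    also have "\<dots> < N * 1"
    proof (intro mult_strict_left_mono N)
      have "\<beta> * c * 1 \<le> \<beta> * c * (k + 1)" using \<beta> kc by (intro mult_left_mono) auto
      then show "80 * (\<beta> * c) < 1" using \<beta> by (simp add: algebra_simps)
    qed
    finally show False by simp
  qed
  then obtain C where C: "C \<in> \<C>" "N * (80 * \<beta>) < real (card (D C))" by blast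
  \<comment> \<open>Only the finitely many points of C that are attained as normalised sums are
    kept. Nearest points then exist, and the distance to K bounds the distance to C.\<close>
  define K where "K = (\<lambda>A. sgn (\<xi> A)) ` D C"
  have K: "finite K" "K \<subseteq> C" "\<And>a. a \<in> K \<Longrightarrow> norm a = 1"
    using finD norm\<xi> by (auto simp: K_def D_def norm_sgn)
  have "K \<noteq> {}"
  proof
    assume "K = {}"
    then have "D C = {}" by (simp add: K_def)
    then show False using C \<beta> N by (simp add: mult_less_0_iff)
  qed
  then have "\<exists>q\<in>K. \<forall>a\<in>K. norm (u - q) \<le> norm (u - a)" for u
    using ex_min_if_finite[of "(\<lambda>a. norm (u - a)) ` K"] K(1) by (force simp: not_less)
  then obtain p where p: "\<And>u. p u \<in> K" "\<And>u a. a \<in> K \<Longrightarrow> norm (u - p u) \<le> norm (u - a)"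
    by metis
  define f where "f = (\<lambda>u. (norm (u - p u))\<^sup>2)"
  have f_le: "f u \<le> (norm (u - a))\<^sup>2" if "a \<in> K" for u a
    using p(2)[OF that] by (simp add: f_def power_mono)
  have f_semi: "f (u + h) \<le> f u + 2 * ((u - p u) \<bullet> h) + (norm h)\<^sup>2" for u h
  proof -
    have "f (u + h) \<le> (norm ((u - p u) + h))\<^sup>2" using f_le[OF p(1), of "u + h" u] by (simp add: algebra_simps)
    also have "\<dots> = f u + 2 * ((u - p u) \<bullet> h) + (norm h)\<^sup>2"
      unfolding f_def power2_norm_eq_inner by (simp add: inner_add inner_commute)
    finally show ?thesis .
  qed
  define m where "m = (\<Sum>A\<in>Pow X. f (\<xi> A)) / N"
  define B1 where "B1 = {A\<in>Pow X. \<bar>f (\<xi> A) - m\<bar> \<ge> \<tau>\<^sup>2}"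
  have B1: "card B1 \<le> N * (80 * \<beta>)"
    unfolding B1_def m_def using cheb[OF f_semi] p(1) K(3) by (metis order.refl)
  have fB1: "finite B1" "B1 \<subseteq> Pow X" using fin by (auto simp: B1_def)
  \<comment> \<open>Some A in \<open>D C\<close> avoids B1. There f is within
    \<open>\<tau>\<^sup>2\<close> of its mean, and also at most \<open>\<tau>\<^sup>2\<close>,
    because normalising the sum moves it by at most \<tau>.\<close>
  have "m < 2 * \<tau>\<^sup>2"
  proof -
    have "\<not> D C \<subseteq> B1"
      using C(2) B1 card_mono[OF fB1(1), of "D C"] by linarith
    then obtain A where A: "A \<in> D C" "A \<notin> B1" by auto
    then have "\<bar>norm (\<xi> A) - 1\<bar> \<le> \<tau>" "\<xi> A \<noteq> 0" using norm\<xi> by (auto simp: D_def)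
    have "f (\<xi> A) \<le> (norm (\<xi> A - sgn (\<xi> A)))\<^sup>2" using A(1) by (intro f_le) (auto simp: K_def)
    also have "\<xi> A - sgn (\<xi> A) = (norm (\<xi> A) - 1) *\<^sub>R sgn (\<xi> A)"
      by (simp only: scaleR_left_diff_distrib norm_sgn_scale scaleR_one)
    also have "(norm \<dots>)\<^sup>2 = (norm (\<xi> A) - 1)\<^sup>2" using \<open>\<xi> A \<noteq> 0\<close> by (simp add: norm_sgn)
    also have "\<dots> \<le> \<tau>\<^sup>2" using \<open>\<bar>norm (\<xi> A) - 1\<bar> \<le> \<tau>\<close> \<tau> by (simp add: abs_le_square_iff[symmetric])
    finally show ?thesis using A by (auto simp: B1_def D_def)
  qed
  then have fB: "norm (\<xi> A - p (\<xi> A)) < 2 * \<tau>" if "A \<in> Pow X - B1" for A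
  proof -
    have "f (\<xi> A) < 3 * \<tau>\<^sup>2" using that \<open>m < 2 * \<tau>\<^sup>2\<close> by (auto simp: B1_def)
    also have "\<dots> \<le> (2 * \<tau>)\<^sup>2" by (simp add: power_mult_distrib)
    finally have "(norm (\<xi> A - p (\<xi> A)))\<^sup>2 < (2 * \<tau>)\<^sup>2" by (simp only: f_def)
    then show ?thesis by (rule power2_less_imp_less) (use \<tau> in auto)
  qed
  \<comment> \<open>B2 is the pullback of B1 along the cube bijection induced by the permutation,
    hence no larger. B3 is small by Markov's inequality: the mean square of the difference is the
    sum bounded in \<open>perm\<close>.\<close>
  define B2 where "B2 = (\<lambda>g. {A\<in>Pow X. \<sigma> g ` A \<in> B1})"
  define B3 where "B3 = (\<lambda>g. {A\<in>Pow X. norm (T g (\<xi> A) - \<xi> (\<sigma> g ` A)) \<ge> \<tau>})"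
  have B2: "card (B2 g) \<le> N * (80 * \<beta>)" if g: "g \<in> F" for g
  proof -
    have "inj_on (image (\<sigma> g)) (Pow X)"
      using bij[OF g] by (simp add: bij_betw_def inj_on_image_Pow)
    then have "card (B2 g) = card (image (\<sigma> g) ` B2 g)"
      by (intro card_image[symmetric]) (auto simp: B2_def elim: inj_on_subset)
    also have "\<dots> \<le> card B1" using fB1 by (intro card_mono) (auto simp: B2_def)
    finally show ?thesis using B1 by linarith
  qed
  have B3: "card (B3 g) \<le> N * \<beta>" if g: "g \<in> F" for g
  proof -
    interpret linear "T g" by (rule lin[OF g])
    have eq: "T g (\<xi> A) - \<xi> (\<sigma> g ` A) = signed_sum (\<lambda>x. T g (v x) - v (\<sigma> g x)) X A" if "A \<in> Pow X" for A
    proof -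
      have "T g (\<xi> A) - \<xi> (\<sigma> g ` A) = T g (signed_sum v X A) - signed_sum (\<lambda>x. v (\<sigma> g x)) X A"
        using that signed_sum_image[OF bij[OF g]] by (simp add: \<xi>_def)
      also have "\<dots> = signed_sum (\<lambda>x. T g (v x) - v (\<sigma> g x)) X A"
        unfolding signed_sum_def sum sum_subtractf[symmetric]
        by (intro sum.cong refl) (auto simp: neg)
      finally show ?thesis .
    qed
    have "card (B3 g) * \<tau>\<^sup>2 = (\<Sum>A\<in>B3 g. \<tau>\<^sup>2)" by simp
    also have "\<dots> \<le> (\<Sum>A\<in>B3 g. (norm (T g (\<xi> A) - \<xi> (\<sigma> g ` A)))\<^sup>2)"
      using \<tau> by (intro sum_mono power_mono) (auto simp: B3_def)
    also have "\<dots> \<le> (\<Sum>A\<in>Pow X. (norm (T g (\<xi> A) - \<xi> (\<sigma> g ` A)))\<^sup>2)"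
      using fin by (intro sum_mono2) (auto simp: B3_def)
    also have "\<dots> = (\<Sum>A\<in>Pow X. (norm (signed_sum (\<lambda>x. T g (v x) - v (\<sigma> g x)) X A))\<^sup>2)"
      by (intro sum.cong refl) (simp add: eq)
    also have "\<dots> = N * (\<Sum>x\<in>X. (norm (T g (v x) - v (\<sigma> g x)))\<^sup>2)"
      unfolding N_def by (rule sum_norm_signed_sum[OF fin])
    also have "\<dots> \<le> N * \<eta>" using perm[OF g] N by simp
    also have "\<dots> \<le> N * \<beta> * \<tau>\<^sup>2"
    proof -
      have "\<tau>^4 \<le> \<tau>\<^sup>2" using \<tau> by (intro power_decreasing) auto
      then show ?thesis using N \<beta> by (simp add: \<eta>\<beta> mult_left_mono)
    qed
    finally show ?thesis using \<tau> by simp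
  qed
  have "\<not> Pow X \<subseteq> B0 \<union> (\<Union>g\<in>F. B2 g \<union> B3 g)"
  proof
    assume "Pow X \<subseteq> B0 \<union> (\<Union>g\<in>F. B2 g \<union> B3 g)"
    then have "card (Pow X) \<le> card (B0 \<union> (\<Union>g\<in>F. B2 g \<union> B3 g))"
      using fB0 finF fin by (intro card_mono) (auto simp: B2_def B3_def)
    also have "\<dots> \<le> card B0 + (\<Sum>g\<in>F. card (B2 g) + card (B3 g))"
      using finF by (intro order.trans[OF card_Un_le] add_left_mono order.trans[OF card_UN_le] sum_mono card_Un_le)
    finally have "N \<le> real (card B0) + (\<Sum>g\<in>F. real (card (B2 g)) + real (card (B3 g)))"
      unfolding cardP[symmetric] by (metis (mono_tags, lifting) of_nat_add of_nat_le_iff of_nat_sum sum.cong)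
    also have "\<dots> \<le> N * (80 * \<beta>) + (\<Sum>g\<in>F. N * (80 * \<beta>) + N * \<beta>)"
      by (intro add_mono sum_mono B0 B2 B3)
    also have "\<dots> \<le> N * (81 * (\<beta> * (k + 1)))" using N \<beta> by (simp add: k_def algebra_simps)
    also have "\<dots> < N * 1"
    proof (intro mult_strict_left_mono N)
      have "\<beta> * (k + 1) * 1 \<le> \<beta> * (k + 1) * c" using \<beta> kc by (intro mult_left_mono) auto
      then show "81 * (\<beta> * (k + 1)) < 1" using \<beta> by (simp add: algebra_simps)
    qed
    finally show False by simp
  qed
  then obtain A where A: "A \<in> Pow X" "A \<notin> B0" "\<And>g. g \<in> F \<Longrightarrow> A \<notin> B2 g" "\<And>g. g \<in> F \<Longrightarrow> A \<notin> B3 g"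
    by auto
  define z where "z = sgn (\<xi> A)"
  have nz: "\<xi> A \<noteq> 0" "\<bar>norm (\<xi> A) - 1\<bar> \<le> \<tau>" using norm\<xi>[of A] A by auto
  \<comment> \<open>The budget: \<tau> for normalising, \<tau> for passing from
    \<open>T g (\<xi> A)\<close> to the permuted sum, and 2 \<tau> from there to K.\<close>
  have "\<exists>a\<in>C. dist (T g z) a < 4 * \<tau>" if g: "g \<in> F" for g
  proof -
    interpret linear "T g" by (rule lin[OF g])
    define A' where "A' = \<sigma> g ` A"
    have A': "A' \<in> Pow X - B1" using A(1,3) g bij[OF g] by (auto simp: A'_def B2_def bij_betw_def)
    have "dist (T g z) (T g (\<xi> A)) = norm (z - \<xi> A)"
      using iso[OF g, of "z - \<xi> A"] by (simp add: dist_norm diff)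
    also have "z - \<xi> A = (1 - norm (\<xi> A)) *\<^sub>R z"
      by (simp only: z_def scaleR_left_diff_distrib norm_sgn_scale scaleR_one)
    also have "norm \<dots> \<le> \<tau>" using nz by (simp add: z_def norm_sgn)
    finally have 1: "dist (T g z) (T g (\<xi> A)) \<le> \<tau>" .
    have 2: "dist (T g (\<xi> A)) (\<xi> A') < \<tau>"
      using A(1) A(4)[OF g] by (auto simp: B3_def A'_def dist_norm)
    have 3: "dist (\<xi> A') (p (\<xi> A')) < 2 * \<tau>" using fB[OF A'] by (simp add: dist_norm)
    have "dist (T g z) (p (\<xi> A')) < 4 * \<tau>"
      using 1 2 3 dist_triangle[of "T g z" "p (\<xi> A')" "T g (\<xi> A)"]
        dist_triangle[of "T g (\<xi> A)" "p (\<xi> A')" "\<xi> A'"] by linarith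
    then show ?thesis using p(1) K(2) by auto
  qed
  moreover have "norm z = 1" using nz by (simp add: z_def norm_sgn)
  ultimately show ?thesis using C(1) by blast
qed

section \<open>Sufficient conditions for amenability\<close>

lemma onorm_bound: "bounded_clinear T \<Longrightarrow> norm (T x) \<le> onorm T * norm x"
  by (simp add: bounded_clinear_def onorm)

context unitary_representation begin

lemma finite_dim_subrep_imp_amenable:
  assumes V: "subrep G \<pi> V" "V \<noteq> {0}" "cfinite_dim V"
  shows "amenable_rep G \<pi>"
proof -
  have sub: "csubspace V" and inv: "\<And>g v. g \<in> carrier G \<Longrightarrow> v \<in> V \<Longrightarrow> \<pi> g v \<in> V"
    using V(1) by (auto simp: subrep_def)
  obtain B0 where B0: "finite B0" "cspan B0 = V" using V(3) by (auto simp: cfinite_dim_def)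
  have "card B \<le> card B0" if "finite B" "corthonormal B" "B \<subseteq> V" for B
    using complex_vector.independent_span_bound[OF B0(1) corthonormal_independent[OF that(1,2)]] that(3) B0(2)
    by simp
  then obtain B where B: "finite B" "corthonormal B" "B \<subseteq> V" and exp: "\<And>v. v \<in> V \<Longrightarrow> cproj B v = v"
    using csubspace_corthonormal_basis[OF sub, of "card B0"] by metis
  have "B \<noteq> {}"
  proof
    assume "B = {}"
    then have "V \<subseteq> {0}" using exp by (force simp: cproj_def)
    then show False using V(2) complex_vector.subspace_0[OF sub] by blast
  qed
  define n where "n = card B"
  have n: "n > 0" using B(1) \<open>B \<noteq> {}\<close> by (simp add: n_def card_gt_0_iff)
  define \<phi> :: "('a \<Rightarrow> 'a) \<Rightarrow> complex" where "\<phi> = (\<lambda>T. (\<Sum>b\<in>B. cinner (T b) b) / of_nat n)"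
  have exp': "v = (\<Sum>c\<in>B. cinner v c *\<^sub>C c)" if "v \<in> V" for v
    using exp[OF that] by (simp add: cproj_def rank_one_def)
  have "op_state \<phi>"
    unfolding op_state_def
  proof (intro conjI allI impI)
    show "\<phi> (\<lambda>x. S x + T x) = \<phi> S + \<phi> T" for S T
      by (simp add: \<phi>_def cinner_add_left sum.distrib add_divide_distrib)
    show "\<phi> (\<lambda>x. c *\<^sub>C T x) = c * \<phi> T" for c T
      by (simp add: \<phi>_def cinner_scaleC_left sum_distrib_left)
    show "\<exists>K. \<forall>T. bounded_clinear T \<longrightarrow> cmod (\<phi> T) \<le> K * onorm T"
    proof (intro exI[of _ 1] allI impI)
      fix T :: "'a \<Rightarrow> 'a" assume T: "bounded_clinear T"
      have "cmod (\<Sum>b\<in>B. cinner (T b) b) \<le> (\<Sum>b\<in>B. onorm T)"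
      proof (intro order.trans[OF norm_sum] sum_mono)
        fix b assume b: "b \<in> B"
        have "cmod (cinner (T b) b) \<le> norm (T b) * norm b" by (rule norm_cinner_le)
        also have "\<dots> \<le> onorm T" using onorm_bound[OF T, of b] corthonormal_norm[OF B(2) b] by simp
        finally show "cmod (cinner (T b) b) \<le> onorm T" .
      qed
      then have "cmod (\<Sum>b\<in>B. cinner (T b) b) \<le> n * onorm T" by (simp add: n_def)
      then show "cmod (\<phi> T) \<le> 1 * onorm T" using n by (simp add: \<phi>_def norm_divide field_simps)
    qed
    show "\<phi> T \<in> \<real>\<^sub>\<ge>\<^sub>0" if "positive_op T" for T
    proof -
      have "(\<Sum>b\<in>B. cinner (T b) b) \<in> \<real>\<^sub>\<ge>\<^sub>0"
        using B(1) that
        by (induction B rule: finite_induct) (auto simp: positive_op_def intro: nonneg_Reals_add_I)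
      then show ?thesis by (simp add: \<phi>_def nonneg_Reals_divide_I)
    qed
    have "(\<Sum>b\<in>B. cinner b b) = (\<Sum>b\<in>B. 1)" using B(2) by (intro sum.cong) (auto simp: corthonormal_def)
    then show "\<phi> id = 1" using n by (simp add: \<phi>_def n_def)
  qed
  moreover have "\<phi> (\<pi> g \<circ> T \<circ> inv_into UNIV (\<pi> g)) = \<phi> T"
    if g: "g \<in> carrier G" and T: "bounded_clinear T" for g T
  proof -
    define f where "f = \<pi> (inv\<^bsub>G\<^esub> g)"
    have fV: "f b \<in> V" if "b \<in> B" for b using inv[OF inv_closed[OF g]] that B(3) by (auto simp: f_def)
    \<comment> \<open>The images \<open>f b\<close> form another orthonormal basis of V, and this is
      the expansion of c in it. Expanding in both bases and exchanging sums shows that the trace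
      does not depend on the basis.\<close>
    have span_f: "c = (\<Sum>b\<in>B. cinner c (f b) *\<^sub>C f b)" if c: "c \<in> B" for c
    proof -
      have "\<pi> g c = (\<Sum>b\<in>B. cinner (\<pi> g c) b *\<^sub>C b)"
        using inv[OF g] c B(3) by (intro exp') auto
      then have "f (\<pi> g c) = f (\<Sum>b\<in>B. cinner (\<pi> g c) b *\<^sub>C b)" by simp
      also have "\<dots> = (\<Sum>b\<in>B. cinner (\<pi> g c) b *\<^sub>C f b)"
        by (simp add: f_def linear_sum[OF linear[OF inv_closed[OF g]]] scaleC[OF inv_closed[OF g]])
      finally have "c = (\<Sum>b\<in>B. cinner (\<pi> g c) b *\<^sub>C f b)" using inv_cancel(1)[OF g] by (simp add: f_def)
      moreover have "cinner (\<pi> g c) b = cinner c (f b)" for b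
        using cinner[OF g, of c "f b"] inv_cancel(2)[OF g] by (simp add: f_def)
      ultimately show ?thesis by simp
    qed
    have linT: "T (\<Sum>b\<in>B. k b *\<^sub>C f b) = (\<Sum>b\<in>B. k b *\<^sub>C T (f b))" for k
      using T linear_sum[of T "\<lambda>b. k b *\<^sub>C f b" B] by (simp add: bounded_clinear_def bounded_linear.linear)
    have "(\<Sum>b\<in>B. cinner (\<pi> g (T (f b))) b) = (\<Sum>b\<in>B. cinner (T (f b)) (f b))"
    proof (intro sum.cong refl)
      fix b
      show "cinner (\<pi> g (T (f b))) b = cinner (T (f b)) (f b)"
        using cinner[OF g, of "T (f b)" "f b"] inv_cancel(2)[OF g] by (simp add: f_def)
    qed
    also have "\<dots> = (\<Sum>b\<in>B. \<Sum>c\<in>B. cinner c (f b) * cinner (T (f b)) c)"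
    proof (intro sum.cong refl)
      fix b assume "b \<in> B"
      then have "cinner (T (f b)) (f b) = cinner (T (f b)) (\<Sum>c\<in>B. cinner (f b) c *\<^sub>C c)"
        using exp'[OF fV] by simp
      then show "cinner (T (f b)) (f b) = (\<Sum>c\<in>B. cinner c (f b) * cinner (T (f b)) c)"
        by (simp add: cinner_sum_right cinner_scaleC_right cinner_commute[of _ "f b"])
    qed
    also have "\<dots> = (\<Sum>c\<in>B. \<Sum>b\<in>B. cinner c (f b) * cinner (T (f b)) c)" by (rule sum.swap)
    also have "\<dots> = (\<Sum>c\<in>B. cinner (T c) c)"
    proof (intro sum.cong refl)
      fix c assume "c \<in> B"
      have "(\<Sum>b\<in>B. cinner c (f b) * cinner (T (f b)) c) = cinner (T (\<Sum>b\<in>B. cinner c (f b) *\<^sub>C f b)) c"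
        by (simp add: linT cinner_sum_left cinner_scaleC_left)
      then show "(\<Sum>b\<in>B. cinner c (f b) * cinner (T (f b)) c) = cinner (T c) c"
        using span_f[OF \<open>c \<in> B\<close>] by simp
    qed
    finally show ?thesis by (simp add: \<phi>_def inv_into_eq[OF g] f_def)
  qed
  ultimately show ?thesis unfolding amenable_rep_def by blast
qed

lemma concentration_imp_amenable:
  assumes "concentration_property (sphere 0 1) G \<pi>"
  shows "amenable_rep G \<pi>"
proof -
  let ?S = "sphere (0::'a) 1"
  \<comment> \<open>Functionals are total functions, so vector states are cut off to 0 at arguments
    that are not bounded operators. This confines every coordinate to a disc and makes K
    compact.\<close>
  define ev :: "'a \<Rightarrow> ('a \<Rightarrow> 'a) \<Rightarrow> complex" where
    "ev = (\<lambda>\<xi> T. if bounded_clinear T then cinner (T \<xi>) \<xi> else 0)"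
  define K where "K = {\<psi> :: ('a \<Rightarrow> 'a) \<Rightarrow> complex. \<forall>T. \<psi> T \<in> cball 0 (if bounded_clinear T then onorm T else 0)}"
  have "compact K" unfolding K_def by (rule compact_box) simp
  have ev_K: "ev \<xi> \<in> K" if "\<xi> \<in> ?S" for \<xi>
  proof -
    have "cmod (cinner (T \<xi>) \<xi>) \<le> onorm T" if "bounded_clinear T" for T
      using norm_cinner_le[of "T \<xi>" \<xi>] onorm_bound[OF that, of \<xi>] \<open>\<xi> \<in> ?S\<close> by simp
    then show ?thesis by (auto simp: K_def ev_def)
  qed
  \<comment> \<open>A point of K in all these closures is not separated from the vector states
    outside any inessential set. Finite intersections are nonempty because finitely many inessential
    sets cannot cover the sphere.\<close>
  define \<F> where "\<F> = {closure (ev ` (?S - A)) | A. A \<subseteq> ?S \<and> \<not> essential ?S G \<pi> A}"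
  have "K \<inter> \<Inter>\<F> \<noteq> {}"
  proof (rule compact_imp_fip[OF \<open>compact K\<close>])
    show "closed C" if "C \<in> \<F>" for C using that by (auto simp: \<F>_def)
    fix \<F>' assume fin: "finite \<F>'" and sub: "\<F>' \<subseteq> \<F>"
    have "\<forall>C\<in>\<F>'. \<exists>A. C = closure (ev ` (?S - A)) \<and> A \<subseteq> ?S \<and> \<not> essential ?S G \<pi> A"
      using sub by (auto simp: \<F>_def)
    from bchoice[OF this] obtain A where
      A: "\<forall>C\<in>\<F>'. C = closure (ev ` (?S - A C)) \<and> A C \<subseteq> ?S \<and> \<not> essential ?S G \<pi> (A C)" ..
    then have A1: "C = closure (ev ` (?S - A C))" and A2: "A C \<subseteq> ?S" and A3: "\<not> essential ?S G \<pi> (A C)"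
      if "C \<in> \<F>'" for C using that by simp_all
    have "\<Union>(A ` \<F>') \<noteq> ?S"
    proof
      assume "\<Union>(A ` \<F>') = ?S"
      then have "\<exists>B\<in>A ` \<F>'. essential ?S G \<pi> B"
        using assms fin A2 unfolding concentration_property_def
        by (elim allE[of _ "A ` \<F>'"]) auto
      then show False using A3 by auto
    qed
    moreover have "\<Union>(A ` \<F>') \<subseteq> ?S" using A2 by (rule UN_least)
    ultimately have "\<exists>\<xi>\<in>?S. \<xi> \<notin> \<Union>(A ` \<F>')" by (simp only: set_eq_iff subset_iff) metis
    then obtain \<xi> where \<xi>: "\<xi> \<in> ?S" "\<And>C. C \<in> \<F>' \<Longrightarrow> \<xi> \<notin> A C" by auto
    have "ev \<xi> \<in> C" if "C \<in> \<F>'" for C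
    proof -
      have "ev \<xi> \<in> ev ` (?S - A C)" using \<xi> that by simp
      then have "ev \<xi> \<in> closure (ev ` (?S - A C))" by (rule subsetD[OF closure_subset])
      then show ?thesis unfolding A1[OF that, symmetric] .
    qed
    then have "ev \<xi> \<in> K \<inter> \<Inter>\<F>'" using ev_K[OF \<xi>(1)] by simp
    then show "K \<inter> \<Inter>\<F>' \<noteq> {}" by (metis empty_iff)
  qed
  then obtain \<phi> where "\<phi> \<in> K" and mem: "\<phi> \<in> \<Inter>\<F>" by (metis IntE ex_in_conv)
  have \<phi>: "\<phi> \<in> closure (ev ` (?S - A))" if "A \<subseteq> ?S" "\<not> essential ?S G \<pi> A" for A
    using mem that unfolding \<F>_def by auto
  \<comment> \<open>If this set were inessential, \<phi> would be a limit of vector states of the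
    remaining vectors, all of which lie outside the neighbourhood U.\<close>
  have ess: "essential ?S G \<pi> {\<xi> \<in> ?S. ev \<xi> \<in> U}" if "open U" "\<phi> \<in> U" for U
  proof (rule ccontr)
    assume "\<not> essential ?S G \<pi> {\<xi> \<in> ?S. ev \<xi> \<in> U}"
    then have "\<phi> \<in> closure (ev ` (?S - {\<xi> \<in> ?S. ev \<xi> \<in> U}))" by (intro \<phi>) auto
    then have "U \<inter> closure (ev ` (?S - {\<xi> \<in> ?S. ev \<xi> \<in> U})) \<noteq> {}" using that(2) by auto
    then have "U \<inter> ev ` (?S - {\<xi> \<in> ?S. ev \<xi> \<in> U}) \<noteq> {}" using open_Int_closure_eq_empty[OF that(1)] by auto
    then show False by auto
  qed
  have one_in: "\<one>\<^bsub>G\<^esub> \<in> carrier G" using group_G by (simp add: group.is_monoid monoid.one_closed)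
  have nbr: "\<exists>\<xi>\<in>?S. ev \<xi> \<in> U" if "open U" "\<phi> \<in> U" for U
  proof -
    have "(\<Inter>g\<in>{\<one>\<^bsub>G\<^esub>}. \<pi> g ` nbhd_in ?S 1 {\<xi> \<in> ?S. ev \<xi> \<in> U}) \<noteq> {}"
      using ess[OF that] one_in unfolding essential_def
      by (elim allE[of _ 1] impE) (auto elim!: allE[of _ "{\<one>\<^bsub>G\<^esub>}"])
    then show ?thesis by (auto simp: nbhd_in_def)
  qed
  \<comment> \<open>Every closed condition shared by all vector states passes to \<phi>. Linearity,
    positivity and normalisation are such conditions; invariance is not, and it needs essential
    sets.\<close>
  have closed_prop: "\<phi> \<in> C" if "closed C" "\<And>\<xi>. \<xi> \<in> ?S \<Longrightarrow> ev \<xi> \<in> C" for C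
    using nbr[of "- C"] that by blast
  have "op_state \<phi>"
    unfolding op_state_def
  proof (intro conjI allI impI)
    fix S T :: "'a \<Rightarrow> 'a" assume "bounded_clinear S" "bounded_clinear T"
    then have "\<phi> \<in> {\<psi>. \<psi> (\<lambda>x. S x + T x) = \<psi> S + \<psi> T}"
      by (intro closed_prop closed_Collect_eq continuous_intros)
        (simp add: ev_def bounded_clinear_add cinner_add_left)
    then show "\<phi> (\<lambda>x. S x + T x) = \<phi> S + \<phi> T" by simp
  next
    fix c and T :: "'a \<Rightarrow> 'a" assume "bounded_clinear T"
    then have "\<phi> \<in> {\<psi>. \<psi> (\<lambda>x. c *\<^sub>C T x) = c * \<psi> T}"
      by (intro closed_prop closed_Collect_eq continuous_intros)
        (simp add: ev_def bounded_clinear_scaleC cinner_scaleC_left)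
    then show "\<phi> (\<lambda>x. c *\<^sub>C T x) = c * \<phi> T" by simp
  next
    show "\<exists>K. \<forall>T. bounded_clinear T \<longrightarrow> cmod (\<phi> T) \<le> K * onorm T"
    proof (intro exI[of _ 1] allI impI)
      fix T :: "'a \<Rightarrow> 'a" assume "bounded_clinear T"
      then show "cmod (\<phi> T) \<le> 1 * onorm T"
        using \<open>\<phi> \<in> K\<close> unfolding K_def by (auto dest: spec[of _ T])
    qed
  next
    fix T :: "'a \<Rightarrow> 'a" assume "positive_op T"
    have "\<phi> \<in> {\<psi>. \<psi> T \<in> \<real>\<^sub>\<ge>\<^sub>0}"
    proof (rule closed_prop)
      have "{\<psi>. \<psi> T \<in> \<real>\<^sub>\<ge>\<^sub>0} = (\<lambda>\<psi>. \<psi> T) -` (\<real>\<^sub>\<ge>\<^sub>0 :: complex set)" by auto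
      then show "closed {\<psi> :: ('a \<Rightarrow> 'a) \<Rightarrow> complex. \<psi> T \<in> \<real>\<^sub>\<ge>\<^sub>0}"
        using closed_vimage[of "\<real>\<^sub>\<ge>\<^sub>0 :: complex set" "\<lambda>\<psi> :: ('a \<Rightarrow> 'a) \<Rightarrow> complex. \<psi> T"] by simp
      show "ev \<xi> \<in> {\<psi>. \<psi> T \<in> \<real>\<^sub>\<ge>\<^sub>0}" for \<xi>
        using \<open>positive_op T\<close> by (simp add: ev_def positive_op_def)
    qed
    then show "\<phi> T \<in> \<real>\<^sub>\<ge>\<^sub>0" by simp
  next
    have "\<phi> \<in> {\<psi>. \<psi> id = 1}"
      by (intro closed_prop closed_Collect_eq continuous_intros)
        (simp add: ev_def bounded_clinear_id cinner_self)
    then show "\<phi> id = 1" by simp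
  qed
  moreover have "\<phi> (\<pi> g \<circ> T \<circ> inv_into UNIV (\<pi> g)) = \<phi> T"
    if g: "g \<in> carrier G" and T: "bounded_clinear T" for g T
  proof (rule ccontr)
    define T' where "T' = \<pi> g \<circ> T \<circ> inv_into UNIV (\<pi> g)"
    assume "\<phi> (\<pi> g \<circ> T \<circ> inv_into UNIV (\<pi> g)) \<noteq> \<phi> T"
    then have neq: "\<phi> T' \<noteq> \<phi> T" by (simp add: T'_def)
    have T': "bounded_clinear T'"
      unfolding T'_def inv_into_eq[OF g]
      by (intro bounded_clinear_compose bounded_clinear T g inv_closed)
    define \<delta> where "\<delta> = dist (\<phi> T') (\<phi> T) / 4"
    have \<delta>: "\<delta> > 0" using neq by (simp add: \<delta>_def)
    define M where "M = onorm T + onorm T'"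
    have M0: "onorm T \<ge> 0" "onorm T' \<ge> 0" using T T' by (auto simp: bounded_clinear_def intro!: onorm_pos_le)
    \<comment> \<open>Chosen so that moving a unit vector by \<epsilon> changes the quadratic form
      of T or of T' by at most \<delta>; adding 1 to M keeps the denominator positive.\<close>
    define \<epsilon> where "\<epsilon> = \<delta> / (2 * (M + 1))"
    have \<epsilon>: "\<epsilon> > 0" using \<delta> M0 by (simp add: \<epsilon>_def M_def)
    define U where "U = {\<psi> :: ('a \<Rightarrow> 'a) \<Rightarrow> complex. dist (\<psi> T) (\<phi> T) < \<delta>} \<inter> {\<psi>. dist (\<psi> T') (\<phi> T') < \<delta>}"
    define A where "A = {\<xi> \<in> ?S. ev \<xi> \<in> U}"
    have "open U" "\<phi> \<in> U"
      using \<delta> unfolding U_def by (auto intro!: open_Collect_less continuous_intros)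
    then have "essential ?S G \<pi> A" unfolding A_def by (rule ess)
    \<comment> \<open>Essentiality for the pair of the unit and g yields \<zeta> and its translate
      \<eta>, both near A. The value of T' at \<eta> equals that of T at \<zeta>, and they
      approximate \<open>\<phi> T'\<close> and \<open>\<phi> T\<close> within 2 \<delta> each,
      contradicting a gap of 4 \<delta>.\<close>
    then have "(\<Inter>h\<in>{\<one>\<^bsub>G\<^esub>, g}. \<pi> h ` nbhd_in ?S \<epsilon> A) \<noteq> {}"
      using \<epsilon> one_in g unfolding essential_def
      by (elim allE[of _ \<epsilon>] impE) (auto elim!: allE[of _ "{\<one>\<^bsub>G\<^esub>, g}"])
    then obtain \<eta> \<zeta> where "\<eta> \<in> nbhd_in ?S \<epsilon> A" "\<zeta> \<in> nbhd_in ?S \<epsilon> A" "\<eta> = \<pi> g \<zeta>"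
      by (auto simp: one)
    then obtain a b where a: "a \<in> A" "dist \<eta> a < \<epsilon>" and b: "b \<in> A" "dist \<zeta> b < \<epsilon>"
      and S: "norm \<eta> = 1" "norm \<zeta> = 1" by (auto simp: nbhd_in_def)
    have lip: "dist (cinner (R x) x) (cinner (R y) y) \<le> onorm R * (2 * \<epsilon>)"
      if R: "bounded_clinear R" and "norm x = 1" "norm y = 1" "dist x y < \<epsilon>" for R :: "'a \<Rightarrow> 'a" and x y
    proof -
      have R0: "onorm R \<ge> 0" using R by (auto simp: bounded_clinear_def intro!: onorm_pos_le)
      have "R (x - y) = R x - R y" using R by (simp add: bounded_clinear_def bounded_linear.linear linear_diff)
      then have "cinner (R x) x - cinner (R y) y = cinner (R x) (x - y) + cinner (R (x - y)) y"
        by (simp add: cinner_diff_left cinner_diff_right)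
      then have "dist (cinner (R x) x) (cinner (R y) y) \<le> cmod (cinner (R x) (x - y)) + cmod (cinner (R (x - y)) y)"
        by (simp add: dist_norm norm_triangle_ineq)
      also have "\<dots> \<le> onorm R * norm (x - y) + onorm R * norm (x - y)"
      proof (intro add_mono)
        have "norm (R x) \<le> onorm R" using onorm_bound[OF R, of x] that by simp
        then have "norm (R x) * norm (x - y) \<le> onorm R * norm (x - y)" by (rule mult_right_mono) simp
        then show "cmod (cinner (R x) (x - y)) \<le> onorm R * norm (x - y)"
          using norm_cinner_le[of "R x" "x - y"] by linarith
        show "cmod (cinner (R (x - y)) y) \<le> onorm R * norm (x - y)"
          using norm_cinner_le[of "R (x - y)" y] onorm_bound[OF R, of "x - y"] that by simp
      qed
      also have "\<dots> = onorm R * (2 * norm (x - y))" by simp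
      also have "\<dots> \<le> onorm R * (2 * \<epsilon>)" using that R0 by (intro mult_left_mono) (auto simp: dist_norm)
      finally show ?thesis .
    qed
    have le\<delta>: "onorm T * (2 * \<epsilon>) \<le> \<delta>" "onorm T' * (2 * \<epsilon>) \<le> \<delta>"
    proof -
      have "M + 1 > 0" using M0 by (simp add: M_def)
      have "D * (2 * (\<delta> / (2 * D))) = \<delta>" if "D > 0" for D using that by simp
      from this[OF \<open>M + 1 > 0\<close>] have "(M + 1) * (2 * \<epsilon>) = \<delta>" unfolding \<epsilon>_def .
      moreover have "onorm T * (2 * \<epsilon>) \<le> (M + 1) * (2 * \<epsilon>)" "onorm T' * (2 * \<epsilon>) \<le> (M + 1) * (2 * \<epsilon>)"
        using M0 \<epsilon> by (auto simp: M_def intro!: mult_right_mono)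
      ultimately show "onorm T * (2 * \<epsilon>) \<le> \<delta>" "onorm T' * (2 * \<epsilon>) \<le> \<delta>" by simp_all
    qed
    have Sab: "norm a = 1" "norm b = 1" using a b by (auto simp: A_def)
    have 1: "dist (cinner (T' \<eta>) \<eta>) (\<phi> T') < 2 * \<delta>"
    proof -
      have "dist (cinner (T' a) a) (\<phi> T') < \<delta>" using a T' by (simp add: A_def U_def ev_def)
      then show ?thesis using lip[OF T' S(1) Sab(1) a(2)] le\<delta>(2) dist_triangle[of "cinner (T' \<eta>) \<eta>" "\<phi> T'" "cinner (T' a) a"]
        by linarith
    qed
    have 2: "dist (cinner (T \<zeta>) \<zeta>) (\<phi> T) < 2 * \<delta>"
    proof -
      have "dist (cinner (T b) b) (\<phi> T) < \<delta>" using b T by (simp add: A_def U_def ev_def)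
      then show ?thesis using lip[OF T S(2) Sab(2) b(2)] le\<delta>(1) dist_triangle[of "cinner (T \<zeta>) \<zeta>" "\<phi> T" "cinner (T b) b"]
        by linarith
    qed
    have "cinner (T' \<eta>) \<eta> = cinner (T \<zeta>) \<zeta>"
      using \<open>\<eta> = \<pi> g \<zeta>\<close> by (simp add: T'_def inv_into_eq[OF g] inv_cancel[OF g] cinner[OF g])
    then have "dist (\<phi> T') (\<phi> T) < 4 * \<delta>"
      using 1 2 dist_triangle3[of "\<phi> T'" "\<phi> T" "cinner (T \<zeta>) \<zeta>"] by simp
    then show False by (simp add: \<delta>_def)
  qed
  ultimately show ?thesis unfolding amenable_rep_def by blast
qed

end

section \<open>Invariant states and invariant subspaces\<close>

lemma op_state_add:
  "op_state \<phi> \<Longrightarrow> bounded_clinear S \<Longrightarrow> bounded_clinear T \<Longrightarrow> \<phi> (\<lambda>x. S x + T x) = \<phi> S + \<phi> T"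
  by (simp add: op_state_def)

lemma op_state_scaleC: "op_state \<phi> \<Longrightarrow> bounded_clinear T \<Longrightarrow> \<phi> (\<lambda>x. c *\<^sub>C T x) = c * \<phi> T"
  by (simp add: op_state_def)

lemma op_state_diff:
  assumes "op_state \<phi>" "bounded_clinear S" "bounded_clinear T"
  shows "\<phi> (\<lambda>x. S x - T x) = \<phi> S - \<phi> T"
  using op_state_add[OF assms(1,2) bounded_clinear_scaleC[OF assms(3), of "-1"]]
    op_state_scaleC[OF assms(1,3), of "-1"]
  by (simp add: scaleC_minus1)

lemma op_state_sum:
  assumes "op_state \<phi>" "\<And>i. i \<in> I \<Longrightarrow> bounded_clinear (T i)"
  shows "\<phi> (\<lambda>x. \<Sum>i\<in>I. T i x) = (\<Sum>i\<in>I. \<phi> (T i))"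
proof -
  have "\<phi> (\<lambda>x. 0) = 0" using op_state_scaleC[OF assms(1) bounded_clinear_zero, of 0] by simp
  then show ?thesis using assms(2)
    by (induction I rule: infinite_finite_induct)
      (simp_all add: op_state_add[OF assms(1)] bounded_clinear_sum)
qed

lemma op_state_nonneg: "op_state \<phi> \<Longrightarrow> positive_op T \<Longrightarrow> \<phi> T \<in> \<real>\<^sub>\<ge>\<^sub>0"
  by (simp add: op_state_def)

lemma op_state_id: "op_state \<phi> \<Longrightarrow> \<phi> (\<lambda>x. x) = 1"
  by (simp add: op_state_def id_def)

text \<open>Makes \<open>\<phi> (rank_one v)\<close> a quadratic form in v. The parallelogram law is
  all that is used of this form besides scaling, so no operator has to represent it.\<close>

lemma rank_one_parallelogram: "rank_one (u + v) x + rank_one (u - v) x = 2 *\<^sub>C rank_one u x + 2 *\<^sub>C rank_one v x"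
proof -
  have two: "2 *\<^sub>C y = y + y" for y :: 'a
    using scaleC_add_left[of 1 1 y] by simp
  show ?thesis
    unfolding two rank_one_def cinner_add_right cinner_diff_right scaleC_add_left scaleC_add_right
      complex_vector.scale_left_diff_distrib complex_vector.scale_right_diff_distrib
    by simp
qed

lemma rank_one_scaleC: "rank_one (c *\<^sub>C v) x = complex_of_real ((cmod c)\<^sup>2) *\<^sub>C rank_one v x"
  unfolding rank_one_def complex_norm_square
  by (simp add: cinner_scaleC_right scaleC_scaleC mult_ac)

lemma cproj_convergent_subsequence:
  fixes E :: "'a::complex_inner set" and v :: "nat \<Rightarrow> 'a"
  assumes "finite E" "corthonormal E" "\<And>n. norm (v n) = 1"
  shows "\<exists>k l. strict_mono k \<and> (\<lambda>n. cproj E (v (k n))) \<longlonglongrightarrow> l"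
proof -
  define f where "f = (\<lambda>c :: 'a \<Rightarrow> complex. \<Sum>e\<in>E. c e *\<^sub>C e)"
  define K where "K = {c :: 'a \<Rightarrow> complex. \<forall>e. c e \<in> cball 0 1}"
  have cont: "continuous_on UNIV (\<lambda>c :: 'a \<Rightarrow> complex. c e *\<^sub>C e)" for e
  proof -
    have "continuous_on UNIV (\<lambda>c :: 'a \<Rightarrow> complex. Re (c e) *\<^sub>R e + Im (c e) *\<^sub>R (\<i> *\<^sub>C e))"
      by (intro continuous_intros)
    then show ?thesis by (rule subst[OF ext[OF scaleC_Re_Im[symmetric]], of "continuous_on UNIV"])
  qed
  have "continuous_on K f"
    unfolding f_def by (intro continuous_on_sum continuous_on_subset[OF cont subset_UNIV])
  moreover have "compact K" unfolding K_def by (rule compact_box) simp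
  \<comment> \<open>K lies in a product over all vectors, where compactness need not give convergent
    subsequences. Its image lies in a metric space, where it does.\<close>
  ultimately have "compact (f ` K)" by (rule compact_continuous_image)
  then have sc: "seq_compact (f ` K)" by (rule compact_imp_seq_compact)
  have mem: "cproj E (v n) \<in> f ` K" for n
  proof -
    define c where "c = (\<lambda>e. if e \<in> E then cinner (v n) e else 0)"
    have "cproj E (v n) = f c"
      unfolding cproj_def rank_one_def f_def by (intro sum.cong) (auto simp: c_def)
    moreover have "cmod (cinner (v n) e) \<le> 1" if "e \<in> E" for e
    proof -
      have "cmod (cinner (v n) e) \<le> norm (v n) * norm e" by (rule norm_cinner_le)
      also have "\<dots> = 1" by (simp add: assms(3) corthonormal_norm[OF assms(2) that])
      finally show ?thesis .
    qed
    then have "c \<in> K" unfolding K_def c_def by simp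
    ultimately show ?thesis by (rule image_eqI)
  qed
  from mem have "\<forall>n. cproj E (v n) \<in> f ` K" by (rule allI)
  with sc obtain l k where "strict_mono k" "((\<lambda>n. cproj E (v n)) \<circ> k) \<longlonglongrightarrow> l"
    by (rule seq_compactE)
  then show ?thesis unfolding o_def by (intro exI[of _ k] exI[of _ l] conjI)
qed

context unitary_representation begin

lemma invariant_state_rank_one:
  assumes \<phi>: "op_state \<phi>"
    and inv: "\<And>g T. g \<in> carrier G \<Longrightarrow> bounded_clinear T \<Longrightarrow> \<phi> (\<pi> g \<circ> T \<circ> inv_into UNIV (\<pi> g)) = \<phi> T"
    and no_sub: "\<not> (\<exists>V. subrep G \<pi> V \<and> V \<noteq> {0} \<and> cfinite_dim V)"
  shows "\<phi> (rank_one v) = 0"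
proof -
  define q where "q = (\<lambda>v. Re (\<phi> (rank_one v)))"
  have \<phi>q: "\<phi> (rank_one v) = complex_of_real (q v)" and q0: "q v \<ge> 0" for v
    using op_state_nonneg[OF \<phi> positive_op_rank_one[of v]]
    by (auto simp: q_def complex_nonneg_Reals_iff complex_eq_iff)
  have q_par: "q (u + v) + q (u - v) = 2 * q u + 2 * q v" for u v
  proof -
    note bc = bounded_clinear_rank_one
    have "\<phi> (rank_one (u + v)) + \<phi> (rank_one (u - v)) = \<phi> (\<lambda>x. rank_one (u + v) x + rank_one (u - v) x)"
      by (rule op_state_add[OF \<phi> bc bc, symmetric])
    also have "\<dots> = \<phi> (\<lambda>x. 2 *\<^sub>C rank_one u x + 2 *\<^sub>C rank_one v x)" by (simp only: rank_one_parallelogram)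
    also have "\<dots> = 2 * \<phi> (rank_one u) + 2 * \<phi> (rank_one v)"
      by (simp add: op_state_add[OF \<phi>] op_state_scaleC[OF \<phi>] bounded_clinear_scaleC bc)
    finally have "Re (\<phi> (rank_one (u + v)) + \<phi> (rank_one (u - v))) = Re (2 * \<phi> (rank_one u) + 2 * \<phi> (rank_one v))"
      by simp
    then show ?thesis by (simp add: q_def)
  qed
  have q_scale: "q (c *\<^sub>C v) = (cmod c)\<^sup>2 * q v" for c v
  proof -
    have "rank_one (c *\<^sub>C v) = (\<lambda>x. complex_of_real ((cmod c)\<^sup>2) *\<^sub>C rank_one v x)"
      by (rule ext) (rule rank_one_scaleC)
    then have "\<phi> (rank_one (c *\<^sub>C v)) = complex_of_real ((cmod c)\<^sup>2) * \<phi> (rank_one v)"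
      by (simp only: op_state_scaleC[OF \<phi> bounded_clinear_rank_one])
    then show ?thesis by (simp add: \<phi>q flip: of_real_mult of_real_power)
  qed
  have q_inv: "q (\<pi> g v) = q v" if "g \<in> carrier G" for g v
    by (simp add: q_def rank_one_conj[OF that] inv[OF that bounded_clinear_rank_one])
  \<comment> \<open>The identity minus an orthogonal projection is positive and has state value at
    least 0: this is the trace class bound on q.\<close>
  have q_sum: "(\<Sum>b\<in>B. q b) \<le> 1" if B: "finite B" "corthonormal B" for B
  proof -
    have bs: "bounded_clinear (\<lambda>x. \<Sum>b\<in>B. rank_one b x)"
      by (intro bounded_clinear_sum bounded_clinear_rank_one)
    have bi: "bounded_clinear (\<lambda>x :: 'a. x)" using bounded_clinear_id by (simp add: id_def)
    have "positive_op (\<lambda>x. x - (\<Sum>b\<in>B. rank_one b x))"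
      unfolding positive_op_def
    proof (intro conjI allI)
      show "bounded_clinear (\<lambda>x. x - (\<Sum>b\<in>B. rank_one b x))" by (rule bounded_clinear_diff[OF bi bs])
      fix x
      have "cinner (x - (\<Sum>b\<in>B. rank_one b x)) x = complex_of_real ((norm x)\<^sup>2 - (\<Sum>b\<in>B. (cmod (cinner x b))\<^sup>2))"
        by (simp add: cinner_diff_left cinner_sum_left cinner_rank_one cinner_self)
      then show "cinner (x - (\<Sum>b\<in>B. rank_one b x)) x \<in> \<real>\<^sub>\<ge>\<^sub>0"
        using cproj_pythagoras[OF B, of x] by (simp add: complex_nonneg_Reals_iff del: of_real_diff)
    qed
    from op_state_nonneg[OF \<phi> this] have "Re (1 - (\<Sum>b\<in>B. \<phi> (rank_one b))) \<ge> 0"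
      by (simp add: op_state_diff[OF \<phi> bi bs] op_state_id[OF \<phi>] op_state_sum[OF \<phi> bounded_clinear_rank_one]
          complex_nonneg_Reals_iff)
    then show ?thesis by (simp add: q_def)
  qed
  have corth1: "corthonormal {x}" if "norm x = 1" for x :: 'a
    using that by (simp add: corthonormal_def cinner_self)
  have q_le1: "q x \<le> 1" if "norm x = 1" for x
    using q_sum[OF _ corth1[OF that]] by simp
  have homog: "q x \<le> c * (norm x)\<^sup>2" if "x \<noteq> 0 \<Longrightarrow> q (complex_of_real (1 / norm x) *\<^sub>C x) \<le> c" for x c
  proof (cases "x = 0")
    case True
    then show ?thesis using q_scale[of 0 0] by simp
  next
    case False
    then show ?thesis using that unfolding q_scale by (simp add: norm_divide power_divide field_simps)
  qed
  have "q v = 0" for v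
  proof (rule ccontr)
    assume "q v \<noteq> 0"
    define \<mu> where "\<mu> = (SUP x\<in>sphere 0 1. q x)"
    have bdd: "bdd_above (q ` sphere 0 1)" using q_le1 by (auto intro!: bdd_aboveI2[of _ _ 1])
    have \<mu>_unit: "q x \<le> \<mu>" if "norm x = 1" for x
      unfolding \<mu>_def using bdd that by (intro cSUP_upper) auto
    have \<mu>_ge: "q x \<le> \<mu> * (norm x)\<^sup>2" for x
      by (intro homog \<mu>_unit) (simp add: norm_scaleC norm_divide)
    have v: "v \<noteq> 0" "q v > 0" using \<open>q v \<noteq> 0\<close> q0[of v] q_scale[of 0 0] by (auto simp: order_less_le)
    have \<mu>: "\<mu> > 0"
    proof -
      have "0 < \<mu> * (norm v)\<^sup>2" using v \<mu>_ge[of v] by linarith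
      then show ?thesis by (simp add: zero_less_mult_iff)
    qed
    define r where "r = (\<lambda>x. \<mu> * (norm x)\<^sup>2 - q x)"
    have r0: "r x \<ge> 0" for x using \<mu>_ge by (simp add: r_def)
    have r_le: "r x \<le> \<mu> * (norm x)\<^sup>2" for x using q0 by (simp add: r_def)
    have r_par: "r (x + y) + r (x - y) = 2 * r x + 2 * r y" for x y
    proof -
      have "(norm (x + y))\<^sup>2 + (norm (x - y))\<^sup>2 = 2 * (norm x)\<^sup>2 + 2 * (norm y)\<^sup>2"
        by (simp add: power2_norm_eq_inner inner_diff inner_add inner_commute)
      then have "\<mu> * ((norm (x + y))\<^sup>2 + (norm (x - y))\<^sup>2) = \<mu> * (2 * (norm x)\<^sup>2 + 2 * (norm y)\<^sup>2)" by simp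
      then show ?thesis using q_par[of x y] by (simp add: r_def distrib_left)
    qed
    have r_diff: "r (x - y) \<le> 2 * r x + 2 * r y" and r_add: "r (x + y) \<le> 2 * r x + 2 * r y" for x y
      using r_par[of x y] r0[of "x + y"] r0[of "x - y"] by linarith+
    have r_scale: "r (c *\<^sub>C x) = (cmod c)\<^sup>2 * r x" for c x
      by (simp add: r_def q_scale norm_scaleC power_mult_distrib algebra_simps)
    have r_lim: "r l = 0" if "x \<longlonglongrightarrow> l" "(\<lambda>n. r (x n)) \<longlonglongrightarrow> 0" for x l
    proof -
      have "r l \<le> 2 * r (x n) + 2 * (\<mu> * (norm (x n - l))\<^sup>2)" for n
        using r_diff[of "x n" "x n - l"] r_le[of "x n - l"] by simp
      moreover have "(\<lambda>n. 2 * r (x n) + 2 * (\<mu> * (norm (x n - l))\<^sup>2)) \<longlonglongrightarrow> 2 * 0 + 2 * (\<mu> * (norm (l - l))\<^sup>2)"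
        by (intro tendsto_intros that)
      ultimately have "r l \<le> 2 * 0 + 2 * (\<mu> * (norm (l - l))\<^sup>2)"
        by (intro LIMSEQ_le_const) auto
      then show ?thesis using r0[of l] by simp
    qed
    define V where "V = {x. r x = 0}"
    have sub: "csubspace V"
      unfolding complex_vector.subspace_def
    proof (intro conjI ballI allI)
      show "0 \<in> V" using r_scale[of 0 0] by (simp add: V_def)
      show "x + y \<in> V" if "x \<in> V" "y \<in> V" for x y
        using that r_add[of x y] r0[of "x + y"] by (simp add: V_def)
      show "c *\<^sub>C x \<in> V" if "x \<in> V" for c x using that by (simp add: V_def r_scale)
    qed
    have "closed V"
      unfolding closed_sequential_limits
    proof (intro allI impI)
      fix x l assume "(\<forall>n. x n \<in> V) \<and> x \<longlonglongrightarrow> l"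
      then show "l \<in> V" using r_lim[of x l] by (simp add: V_def)
    qed
    then have "subrep G \<pi> V"
      using sub by (auto simp: subrep_def V_def r_def q_inv norm)
    moreover have "cfinite_dim V"
    proof -
      \<comment> \<open>Unit vectors of V have q-value \<mu>, so the trace bound limits the size of
        orthonormal sets in V.\<close>
      have card_le: "card B \<le> nat \<lfloor>1 / \<mu>\<rfloor>" if B: "finite B" "corthonormal B" "B \<subseteq> V" for B
      proof -
        have "q b = \<mu>" if "b \<in> B" for b
          using that B corthonormal_norm[OF B(2) that] by (auto simp: V_def r_def)
        then have "card B * \<mu> \<le> 1" using q_sum[OF B(1,2)] by simp
        then have "real (card B) \<le> 1 / \<mu>" using \<mu> by (simp add: field_simps)
        then show ?thesis by (simp add: le_nat_floor)
      qed
      obtain B where "finite B" "corthonormal B" "B \<subseteq> V" "\<And>x. x \<in> V \<Longrightarrow> cproj B x = x"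
        by (rule csubspace_corthonormal_basis[OF sub card_le]) (assumption+, rule that)
      note B = this(1,3,4)
      have "cspan B = V"
      proof
        show "cspan B \<subseteq> V" using B(2) sub by (rule complex_vector.span_minimal)
        show "V \<subseteq> cspan B"
        proof
          fix x assume "x \<in> V"
          moreover have "cproj B x \<in> cspan B"
            by (rule cproj_in_csubspace[OF complex_vector.subspace_span complex_vector.span_superset])
          ultimately show "x \<in> cspan B" using B(3) by simp
        qed
      qed
      then show ?thesis using B(1) by (auto simp: cfinite_dim_def)
    qed
    moreover have "V \<noteq> {0}"
    proof -
      \<comment> \<open>The supremum must be shown to be attained. A finite set E exhausts the
        directions with q above \<mu> / 4, and on its orthogonal complement r is coercive. Along a
        maximising sequence the E-components converge by compactness and the rest is Cauchy by
        coercivity.\<close>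
      have card_le: "card B \<le> nat \<lfloor>4 / \<mu>\<rfloor>" if B: "finite B" "corthonormal B" "B \<subseteq> {x. q x > \<mu> / 4}" for B
      proof -
        have "card B * (\<mu> / 4) = (\<Sum>b\<in>B. \<mu> / 4)" by simp
        also have "\<dots> \<le> (\<Sum>b\<in>B. q b)" using B(3) by (intro sum_mono) auto
        also have "\<dots> \<le> 1" by (rule q_sum[OF B(1,2)])
        finally have "real (card B) \<le> 4 / \<mu>" using \<mu> by (simp add: field_simps)
        then show ?thesis by (simp add: le_nat_floor)
      qed
      obtain E where E: "finite E" "corthonormal E" "E \<subseteq> {x. q x > \<mu> / 4}"
        and max: "\<And>x. x \<in> {x. q x > \<mu> / 4} \<Longrightarrow> norm x = 1 \<Longrightarrow> \<exists>e\<in>E. cinner x e \<noteq> 0"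
        by (rule maximal_corthonormal[OF card_le]) (assumption+, rule that)
      note E = E(1,2)
      have maxE: "\<And>x. q x > \<mu> / 4 \<Longrightarrow> norm x = 1 \<Longrightarrow> \<exists>e\<in>E. cinner x e \<noteq> 0"
        using max by simp
      have perpE: "3 / 4 * \<mu> * (norm t)\<^sup>2 \<le> r t" if "\<And>e. e \<in> E \<Longrightarrow> cinner t e = 0" for t
      proof -
        have "q t \<le> \<mu> / 4 * (norm t)\<^sup>2"
        proof (rule homog)
          assume "t \<noteq> 0"
          define u where "u = complex_of_real (1 / norm t) *\<^sub>C t"
          have "norm u = 1" using \<open>t \<noteq> 0\<close> by (simp add: u_def norm_scaleC norm_divide)
          moreover have "cinner u e = 0" if "e \<in> E" for e
            using \<open>\<And>e. e \<in> E \<Longrightarrow> cinner t e = 0\<close>[OF that] by (simp add: u_def cinner_scaleC_left)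
          ultimately show "q u \<le> \<mu> / 4" using maxE[of u] by force
        qed
        then show ?thesis by (simp add: r_def)
      qed
      have ex: "\<forall>n. \<exists>x. norm x = 1 \<and> r x < 1 / Suc n"
      proof
        fix n
        have "complex_of_real (1 / norm v) *\<^sub>C v \<in> sphere 0 1" using v by (simp add: norm_scaleC norm_divide)
        then have "\<exists>x\<in>sphere 0 1. \<mu> - 1 / Suc n < q x"
          unfolding \<mu>_def using bdd by (subst less_cSUP_iff[symmetric]) auto
        then show "\<exists>x. norm x = 1 \<and> r x < 1 / Suc n" by (auto simp: r_def)
      qed
      from choice[OF ex] obtain x where "\<forall>n. norm (x n) = 1 \<and> r (x n) < 1 / Suc n" ..
      then have x: "norm (x n) = 1" "r (x n) < 1 / Suc n" for n by auto
      obtain k l where k: "strict_mono k" and lim: "(\<lambda>n. cproj E (x (k n))) \<longlonglongrightarrow> l"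
        using cproj_convergent_subsequence[of E x, OF E x(1)] by blast
      define s where "s = (\<lambda>n. cproj E (x (k n)))"
      define t where "t = (\<lambda>n. x (k n) - s n)"
      have rx: "(\<lambda>n. r (x (k n))) \<longlonglongrightarrow> 0"
      proof -
        have "(\<lambda>n. r (x n)) \<longlonglongrightarrow> 0"
        proof (rule tendsto_sandwich[OF _ _ tendsto_const LIMSEQ_inverse_real_of_nat])
          show "\<forall>\<^sub>F n in sequentially. r (x n) \<le> inverse (real (Suc n))"
            using x(2) by (intro always_eventually allI less_imp_le) (simp add: inverse_eq_divide)
        qed (use r0 in auto)
        from LIMSEQ_subseq_LIMSEQ[OF this k] show ?thesis by (simp add: o_def)
      qed
      have Cs: "Cauchy s" using lim unfolding s_def by (rule LIMSEQ_imp_Cauchy)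
      have "Cauchy t"
      proof (rule CauchyI)
        fix e :: real assume e: "e > 0"
        \<comment> \<open>The fractions 1/32 here and 1/3 below add up to
          \<open>17 / 36 * \<mu> * e\<^sup>2\<close>, which is below the coercivity bound with
          constant 3/4.\<close>
        have "\<forall>\<^sub>F n in sequentially. r (x (k n)) < \<mu> * e\<^sup>2 / 32"
          using rx \<mu> e by (intro order_tendstoD(2)[OF rx]) auto
        then obtain N1 where N1: "\<And>n. n \<ge> N1 \<Longrightarrow> r (x (k n)) < \<mu> * e\<^sup>2 / 32"
          by (auto simp: eventually_sequentially)
        obtain N2 where N2: "\<And>m n. m \<ge> N2 \<Longrightarrow> n \<ge> N2 \<Longrightarrow> norm (s m - s n) < e / 3"
          using CauchyD[OF Cs, of "e / 3"] e by auto
        have "norm (t m - t n) < e" if mn: "m \<ge> max N1 N2" "n \<ge> max N1 N2" for m n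
        proof -
          have "cinner (t m - t n) b = 0" if "b \<in> E" for b
            using cproj_perp[OF E that, of "x (k m)"] cproj_perp[OF E that, of "x (k n)"]
            by (simp add: t_def s_def cinner_diff_left)
          then have "3 / 4 * \<mu> * (norm (t m - t n))\<^sup>2 \<le> r (t m - t n)" by (rule perpE)
          also have teq: "t m - t n = (x (k m) - x (k n)) - (s m - s n)" by (simp add: t_def)
          also have "r \<dots> \<le> 2 * (2 * r (x (k m)) + 2 * r (x (k n))) + 2 * (\<mu> * (norm (s m - s n))\<^sup>2)"
            by (rule order.trans[OF r_diff]) (intro add_mono mult_left_mono r_diff r_le; simp)
          also have "\<dots> < 2 * (2 * (\<mu> * e\<^sup>2 / 32) + 2 * (\<mu> * e\<^sup>2 / 32)) + 2 * (\<mu> * (e / 3)\<^sup>2)"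
          proof -
            have 1: "r (x (k m)) < \<mu> * e\<^sup>2 / 32" "r (x (k n)) < \<mu> * e\<^sup>2 / 32" using N1 mn by auto
            have "norm (s m - s n) \<le> e / 3" using N2[of m n] mn by simp
            then have 2: "\<mu> * (norm (s m - s n))\<^sup>2 \<le> \<mu> * (e / 3)\<^sup>2"
              using \<mu> by (intro mult_left_mono power_mono) auto
            have "2 * (2 * a + 2 * b) + 2 * c < 2 * (2 * d + 2 * d) + 2 * w"
              if "a < d" "b < d" "c \<le> w" for a b c d w :: real
              using that by simp
            from this[OF 1 2] show ?thesis .
          qed
          also have "\<dots> \<le> 3 / 4 * \<mu> * e\<^sup>2" using \<mu> by (simp add: power_divide field_simps)
          finally have "(norm (t m - t n))\<^sup>2 < e\<^sup>2" using \<mu> by (simp add: teq)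
          then show ?thesis by (rule power2_less_imp_less) (use e in auto)
        qed
        then show "\<exists>M. \<forall>m\<ge>M. \<forall>n\<ge>M. norm (t m - t n) < e" by blast
      qed
      then obtain l' where "t \<longlonglongrightarrow> l'"
        using Cauchy_convergent unfolding convergent_def by blast
      then have "(\<lambda>n. s n + t n) \<longlonglongrightarrow> l + l'" using lim unfolding s_def by (intro tendsto_add)
      then have xl: "(\<lambda>n. x (k n)) \<longlonglongrightarrow> l + l'" by (simp add: t_def)
      have "l + l' \<in> V" using r_lim[OF xl rx] by (simp add: V_def)
      moreover have "(\<lambda>n. 1) \<longlonglongrightarrow> norm (l + l')" using tendsto_norm[OF xl] by (simp add: x(1))
      then have "norm (l + l') = 1" by (simp add: LIMSEQ_const_iff)
      ultimately show ?thesis by auto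
    qed
    ultimately show False using no_sub by blast
  qed
  then show ?thesis by (simp add: \<phi>q)
qed

end

section \<open>Almost invariant tuples\<close>

lemma max_zero_diff_square_le: "(max 0 (a - x))\<^sup>2 \<le> (max 0 a - x)\<^sup>2" for a x :: real
proof (cases "a \<le> 0")
  case True
  show ?thesis
  proof (cases "a - x \<le> 0")
    case False
    then have "(a - x)\<^sup>2 \<le> (- x)\<^sup>2" using True by (intro power_mono) auto
    then show ?thesis using True False by (simp add: max_def)
  qed simp
qed (simp add: max_def)

text \<open>
  The minimiser of the sum of the squared deficits satisfies all inequalities: otherwise its deficits,
  used as weights, contradict the domination hypothesis by the first order condition.
\<close>

lemma finite_minimax:
  fixes K :: "('i \<Rightarrow> real) set" and h :: "'b \<Rightarrow> ('i \<Rightarrow> real) \<Rightarrow> real"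
  assumes K: "compact K" "K \<noteq> {}"
    and conv: "\<And>t u s. t \<in> K \<Longrightarrow> u \<in> K \<Longrightarrow> 0 \<le> s \<Longrightarrow> s \<le> 1 \<Longrightarrow> (\<lambda>i. (1 - s) * t i + s * u i) \<in> K"
    and fin: "finite J"
    and cont: "\<And>b. b \<in> J \<Longrightarrow> continuous_on UNIV (h b)"
    and aff: "\<And>b t u s. b \<in> J \<Longrightarrow> h b (\<lambda>i. (1 - s) * t i + s * u i) = (1 - s) * h b t + s * h b u"
    and dom: "\<And>p. (\<And>b. b \<in> J \<Longrightarrow> 0 \<le> p b) \<Longrightarrow> (\<Sum>b\<in>J. p b) = 1 \<Longrightarrow> \<exists>t\<in>K. c \<le> (\<Sum>b\<in>J. p b * h b t)"
  shows "\<exists>t\<in>K. \<forall>b\<in>J. c \<le> h b t"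
proof -
  define D where "D = (\<lambda>t. \<Sum>b\<in>J. (max 0 (c - h b t))\<^sup>2)"
  have "continuous_on K D"
    unfolding D_def
    by (intro continuous_intros continuous_on_subset[OF cont subset_UNIV])
  then obtain t where t: "t \<in> K" "\<And>u. u \<in> K \<Longrightarrow> D t \<le> D u"
    using continuous_attains_inf[OF K, of D] by blast
  define p where "p = (\<lambda>b. max 0 (c - h b t))"
  have p0: "p b \<ge> 0" for b by (simp add: p_def)
  have Dt: "D t = (\<Sum>b\<in>J. (p b)\<^sup>2)" by (simp add: D_def p_def)
  show ?thesis
  proof (cases "(\<Sum>b\<in>J. p b) = 0")
    case True
    then have "\<forall>b\<in>J. p b = 0" using fin p0 by (simp add: sum_nonneg_eq_0_iff)
    then have "\<forall>b\<in>J. c \<le> h b t" by (auto simp: p_def max_def split: if_splits)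
    then show ?thesis using t(1) by blast
  next
    case False
    define S where "S = (\<Sum>b\<in>J. p b)"
    have S: "S > 0" using False p0 by (simp add: S_def order_less_le sum_nonneg)
    have "(\<Sum>b\<in>J. p b / S) = 1" using S by (simp add: S_def flip: sum_divide_distrib)
    then obtain u where u: "u \<in> K" "c \<le> (\<Sum>b\<in>J. p b / S * h b u)"
      using dom[of "\<lambda>b. p b / S"] p0 S by auto
    define y where "y = (\<lambda>b. h b u - h b t)"
    define P Y where "P = (\<Sum>b\<in>J. p b * y b)" and "Y = (\<Sum>b\<in>J. (y b)\<^sup>2)"
    have Y0: "Y \<ge> 0" by (simp add: Y_def sum_nonneg)
    have "P > 0"
    proof -
      have "c * S \<le> (\<Sum>b\<in>J. p b / S * h b u) * S" using u(2) S by (intro mult_right_mono) auto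
      also have "\<dots> = (\<Sum>b\<in>J. p b * h b u)" using S by (simp add: sum_distrib_right)
      finally have 1: "(\<Sum>b\<in>J. p b * c) \<le> (\<Sum>b\<in>J. p b * h b u)" by (simp add: S_def sum_distrib_left mult.commute)
      have "P = (\<Sum>b\<in>J. p b * h b u) - (\<Sum>b\<in>J. p b * h b t)"
        by (simp add: P_def y_def right_diff_distrib sum_subtractf)
      then have 2: "(\<Sum>b\<in>J. p b * c) - (\<Sum>b\<in>J. p b * h b t) \<le> P" using 1 by simp
      \<comment> \<open>The deficit p vanishes wherever \<open>c - h b t\<close> is negative, so p
        times \<open>c - h b t\<close> is the square of p.\<close>
      have 3: "(\<Sum>b\<in>J. p b * c) - (\<Sum>b\<in>J. p b * h b t) = (\<Sum>b\<in>J. (p b)\<^sup>2)"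
        unfolding sum_subtractf[symmetric]
        by (intro sum.cong refl) (auto simp: p_def max_def power2_eq_square algebra_simps)
      have "(\<Sum>b\<in>J. (p b)\<^sup>2) > 0"
      proof -
        have "(\<Sum>b\<in>J. (p b)\<^sup>2) \<noteq> 0"
        proof
          assume "(\<Sum>b\<in>J. (p b)\<^sup>2) = 0"
          then have "\<forall>b\<in>J. p b = 0" using fin by (simp add: sum_nonneg_eq_0_iff)
          then show False using False by simp
        qed
        then show ?thesis by (simp add: order_less_le sum_nonneg)
      qed
      then show ?thesis using 2 3 by linarith
    qed
    \<comment> \<open>Moving from t towards u bounds D by
      \<open>D t - 2 * s * P + s\<^sup>2 * Y\<close>. This step length keeps s Y at most P, so D
      would drop below its minimum; the added 1 covers Y = 0.\<close>
    define s where "s = min 1 (P / (Y + 1))"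
    have s: "0 < s" "s \<le> 1" using \<open>P > 0\<close> Y0 by (auto simp: s_def)
    have "D t \<le> D (\<lambda>i. (1 - s) * t i + s * u i)"
      using s by (intro t(2) conv t(1) u(1)) auto
    also have "\<dots> \<le> (\<Sum>b\<in>J. (p b - s * y b)\<^sup>2)"
      unfolding D_def
    proof (intro sum_mono)
      fix b assume b: "b \<in> J"
      have "c - h b (\<lambda>i. (1 - s) * t i + s * u i) = (c - h b t) - s * y b"
        unfolding aff[OF b] by (simp add: y_def algebra_simps)
      then show "(max 0 (c - h b (\<lambda>i. (1 - s) * t i + s * u i)))\<^sup>2 \<le> (p b - s * y b)\<^sup>2"
        unfolding p_def by (metis max_zero_diff_square_le)
    qed
    also have "\<dots> = D t - 2 * s * P + s\<^sup>2 * Y"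
      unfolding Dt P_def Y_def sum_distrib_left sum_subtractf[symmetric] sum.distrib[symmetric]
      by (intro sum.cong refl) (simp add: power2_eq_square algebra_simps)
    finally have "2 * s * P \<le> s\<^sup>2 * Y" by simp
    then have "s * (2 * P) \<le> s * (s * Y)" by (simp add: power2_eq_square mult_ac)
    then have "2 * P \<le> s * Y" using s by simp
    also have "s * Y \<le> P / (Y + 1) * (Y + 1)"
      using Y0 \<open>P > 0\<close> by (intro mult_mono) (auto simp: s_def)
    also have "\<dots> = P" using Y0 by simp
    finally show ?thesis using \<open>P > 0\<close> by simp
  qed
qed

text \<open>The superlevel sets are closed in K, so the finite case and the finite intersection
  property suffice. Infinitely many conditions are needed because they will be indexed by the unit
  sphere.\<close>

lemma compact_minimax:
  fixes K :: "('i \<Rightarrow> real) set" and h :: "'b \<Rightarrow> ('i \<Rightarrow> real) \<Rightarrow> real"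
  assumes K: "compact K" "K \<noteq> {}"
    and conv: "\<And>t u s. t \<in> K \<Longrightarrow> u \<in> K \<Longrightarrow> 0 \<le> s \<Longrightarrow> s \<le> 1 \<Longrightarrow> (\<lambda>i. (1 - s) * t i + s * u i) \<in> K"
    and cont: "\<And>b. b \<in> B \<Longrightarrow> continuous_on UNIV (h b)"
    and aff: "\<And>b t u s. b \<in> B \<Longrightarrow> h b (\<lambda>i. (1 - s) * t i + s * u i) = (1 - s) * h b t + s * h b u"
    and dom: "\<And>J p. finite J \<Longrightarrow> J \<subseteq> B \<Longrightarrow> (\<And>b. b \<in> J \<Longrightarrow> 0 \<le> p b) \<Longrightarrow> (\<Sum>b\<in>J. p b) = 1 \<Longrightarrow>
      \<exists>t\<in>K. c \<le> (\<Sum>b\<in>J. p b * h b t)"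
  shows "\<exists>t\<in>K. \<forall>b\<in>B. c \<le> h b t"
proof -
  have "K \<inter> \<Inter>((\<lambda>b. {t. c \<le> h b t}) ` B) \<noteq> {}"
  proof (rule compact_imp_fip_image[OF K(1)])
    show "closed {t. c \<le> h b t}" if "b \<in> B" for b
      using cont[OF that] by (intro closed_Collect_le continuous_intros)
    fix J assume J: "finite J" "J \<subseteq> B"
    have "\<exists>t\<in>K. \<forall>b\<in>J. c \<le> h b t"
      by (rule finite_minimax[OF K conv J(1)]) (use J cont aff dom[OF J] in auto)
    then show "K \<inter> \<Inter>((\<lambda>b. {t. c \<le> h b t}) ` J) \<noteq> {}" by auto
  qed
  then show ?thesis by auto
qed

section \<open>Self-adjoint contractions as a compact convex space of forms\<close>

lemma riesz_representation:
  fixes f :: "'a::{real_inner,banach} \<Rightarrow> real"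
  assumes "bounded_linear f"
  shows "\<exists>z. \<forall>x. f x = z \<bullet> x"
proof -
  interpret bounded_linear f by fact
  obtain K where K: "\<And>x. \<bar>f x\<bar> \<le> norm x * K" using bounded by auto
  \<comment> \<open>The minimiser of J represents f. Minimising sequences are Cauchy by the
    parallelogram law, and the first order condition at the limit is the claim.\<close>
  define J where "J = (\<lambda>x. (norm x)\<^sup>2 / 2 - f x)"
  have J_bdd: "- (K\<^sup>2) / 2 \<le> J x" for x
  proof -
    have "f x \<le> norm x * K" using K[of x] by simp
    also have "\<dots> \<le> ((norm x)\<^sup>2 + K\<^sup>2) / 2" using sum_squares_bound[of "norm x" K] by simp
    finally show ?thesis by (simp add: J_def field_simps)
  qed
  define m where "m = (INF x. J x)"
  have bdd: "bdd_below (range J)" by (intro bdd_belowI2[of _ "- (K\<^sup>2) / 2"] J_bdd)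
  have m_le: "m \<le> J x" for x unfolding m_def using bdd by (rule cINF_lower) simp
  have "\<forall>n. \<exists>x. J x < m + 1 / Suc n"
  proof
    fix n
    have "m < m + 1 / Suc n" by simp
    then show "\<exists>x. J x < m + 1 / Suc n"
      unfolding m_def using bdd by (subst (asm) cINF_less_iff) auto
  qed
  from choice[OF this] obtain x where x: "\<forall>n. J (x n) < m + 1 / Suc n" ..
  have par: "(norm (u - v))\<^sup>2 \<le> 4 * (J u - m) + 4 * (J v - m)" for u v
  proof -
    have "J ((1 / 2) *\<^sub>R (u + v)) = (J u + J v) / 2 - (norm (u - v))\<^sup>2 / 8"
      unfolding J_def power2_norm_eq_inner
      by (simp add: scale add inner_add inner_diff inner_commute field_simps)
    with m_le[of "(1 / 2) *\<^sub>R (u + v)"] have "m \<le> (J u + J v) / 2 - (norm (u - v))\<^sup>2 / 8" by simp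
    then show ?thesis by argo
  qed
  have "Cauchy x"
  proof (rule CauchyI)
    fix e :: real assume e: "e > 0"
    have "\<exists>N. inverse (real (Suc N)) < e\<^sup>2 / 8" using e by (intro reals_Archimedean) simp
    then obtain N where N: "inverse (real (Suc N)) < e\<^sup>2 / 8" ..
    have J_small: "J (x n) - m < e\<^sup>2 / 8" if "n \<ge> N" for n
    proof -
      have "J (x n) - m < 1 / real (Suc n)" using spec[OF x, of n] by (simp only: less_diff_eq diff_less_eq add.commute)
      also have "\<dots> \<le> 1 / real (Suc N)" using that by (simp add: field_simps)
      finally show ?thesis using N by (simp add: inverse_eq_divide)
    qed
    have "norm (x i - x j) < e" if "i \<ge> N" "j \<ge> N" for i j
    proof -
      have "(norm (x i - x j))\<^sup>2 < e\<^sup>2"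
        using par[of "x i" "x j"] J_small[OF that(1)] J_small[OF that(2)] by simp
      then show ?thesis by (rule power2_less_imp_less) (use e in auto)
    qed
    then show "\<exists>M. \<forall>i\<ge>M. \<forall>j\<ge>M. norm (x i - x j) < e" by blast
  qed
  then obtain z where z: "x \<longlonglongrightarrow> z"
    using Cauchy_convergent unfolding convergent_def by blast
  have "(\<lambda>n. J (x n)) \<longlonglongrightarrow> J z"
    unfolding J_def by (intro tendsto_intros tendsto z) simp
  moreover have "(\<lambda>n. m + 1 / real (Suc n)) \<longlonglongrightarrow> m + 0"
    using LIMSEQ_inverse_real_of_nat by (intro tendsto_add tendsto_const) (simp add: inverse_eq_divide)
  ultimately have Jz: "J z \<le> m"
    using x by (intro LIMSEQ_le[of "\<lambda>n. J (x n)" _ "\<lambda>n. m + 1 / real (Suc n)"]) (auto intro: less_imp_le)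
  have "f y = z \<bullet> y" for y
  proof -
    have "\<epsilon> * (f y - z \<bullet> y) \<le> \<epsilon>\<^sup>2 * ((norm y)\<^sup>2 / 2)" for \<epsilon>
    proof -
      have "J z \<le> J (z + \<epsilon> *\<^sub>R y)" using Jz m_le[of "z + \<epsilon> *\<^sub>R y"] by linarith
      then show ?thesis
        unfolding J_def power2_norm_eq_inner
        by (simp add: add scale inner_add inner_commute field_simps power2_eq_square)
    qed
    from homogeneous_le_square_imp_zero[OF this] show ?thesis by simp
  qed
  then show ?thesis by blast
qed

text \<open>Such a t is the real part of \<open>cinner (T x) y\<close> for a self-adjoint
  contraction T; invariance under multiplying both arguments by i encodes complex linearity of T.
  All conditions are pointwise and closed, so compactness in the weak operator topology becomes
  Tychonoff's theorem.\<close>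

definition hermitian_contraction_form :: "('a::complex_inner \<Rightarrow> 'a \<Rightarrow> real) \<Rightarrow> bool" where
  "hermitian_contraction_form t \<longleftrightarrow>
    (\<forall>x y z. t (x + y) z = t x z + t y z) \<and> (\<forall>r x z. t (r *\<^sub>R x) z = r * t x z) \<and>
    (\<forall>x y. t x y = t y x) \<and> (\<forall>x y. t (\<i> *\<^sub>C x) (\<i> *\<^sub>C y) = t x y) \<and>
    (\<forall>x y. \<bar>t x y\<bar> \<le> norm x * norm y)"

lemma i_scaleC_i: "\<i> *\<^sub>C \<i> *\<^sub>C x = - (x :: 'a::complex_inner)"
  by (simp add: scaleC_scaleC scaleC_minus1)

text \<open>Riesz representation in the second argument gives a real linear T. Invariance under i
  makes T complex linear, and symmetry then removes the imaginary part of the diagonal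
  values.\<close>

lemma hermitian_contraction_form_operator:
  fixes t :: "'a::complex_hilbert_space \<Rightarrow> 'a \<Rightarrow> real"
  assumes "hermitian_contraction_form t"
  shows "\<exists>T. bounded_clinear T \<and> (\<forall>x. cinner (T x) x = complex_of_real (t x x))"
proof -
  have add: "t (x + y) z = t x z + t y z" and scale: "t (r *\<^sub>R x) z = r * t x z"
    and sym: "t x y = t y x" and ii: "t (\<i> *\<^sub>C x) (\<i> *\<^sub>C y) = t x y"
    and bdd: "\<bar>t x y\<bar> \<le> norm x * norm y" for x y z r
    using assms by (auto simp: hermitian_contraction_form_def)
  have minus: "t (- x) y = - t x y" for x y using scale[of "-1" x y] by simp
  have minus2: "t x (- y) = - t x y" for x y using minus[of y x] by (simp add: sym[of x])
  have "bounded_linear (t x)" for x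
    by (rule bounded_linear_intro[of _ "norm x"])
      (use add scale bdd in \<open>auto simp: sym[of x] mult.commute\<close>)
  then have "\<forall>x. \<exists>z. \<forall>y. t x y = z \<bullet> y" using riesz_representation by blast
  from choice[OF this] obtain T where T: "\<forall>x y. t x y = T x \<bullet> y" ..
  then have T: "T x \<bullet> y = t x y" for x y by simp
  have i: "t (\<i> *\<^sub>C x) y = - t x (\<i> *\<^sub>C y)" for x y
    using ii[of x "\<i> *\<^sub>C y"] by (simp add: i_scaleC_i minus2)
  have Ti: "T (\<i> *\<^sub>C x) = \<i> *\<^sub>C T x" for x
  proof -
    have "T (\<i> *\<^sub>C x) \<bullet> y = (\<i> *\<^sub>C T x) \<bullet> y" for y
    proof -
      have "(\<i> *\<^sub>C T x) \<bullet> y = - (T x \<bullet> (\<i> *\<^sub>C y))"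
        by (simp add: inner_eq_Re_cinner cinner_scaleC_left cinner_scaleC_right)
      then show ?thesis by (simp add: T i)
    qed
    then show ?thesis by (metis vector_eq_rdot)
  qed
  have Tadd: "T (x + y) = T x + T y" for x y
  proof -
    have "T (x + y) \<bullet> z = (T x + T y) \<bullet> z" for z by (simp add: T add inner_add_left)
    then show ?thesis by (metis vector_eq_rdot)
  qed
  have Tscale: "T (r *\<^sub>R x) = r *\<^sub>R T x" for r x
  proof -
    have "T (r *\<^sub>R x) \<bullet> z = (r *\<^sub>R T x) \<bullet> z" for z by (simp add: T scale)
    then show ?thesis by (metis vector_eq_rdot)
  qed
  have "bounded_clinear T"
  proof (rule bounded_clinearI[OF Tadd])
    show "T (c *\<^sub>C x) = c *\<^sub>C T x" for c x
    proof -
      have "T (c *\<^sub>C x) = T (Re c *\<^sub>R x + Im c *\<^sub>R (\<i> *\<^sub>C x))" by (rule arg_cong[OF scaleC_Re_Im])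
      also have "\<dots> = Re c *\<^sub>R T x + Im c *\<^sub>R (\<i> *\<^sub>C T x)" by (simp only: Tadd Tscale Ti)
      also have "\<dots> = c *\<^sub>C T x" by (rule scaleC_Re_Im[symmetric])
      finally show ?thesis .
    qed
    show "norm (T x) \<le> norm x * 1" for x
    proof -
      have "norm (T x) * norm (T x) = t x (T x)" by (simp add: T[symmetric] dot_square_norm power2_eq_square)
      also have "\<dots> \<le> norm x * norm (T x)" using bdd[of x "T x"] by simp
      finally show ?thesis by (cases "norm (T x) = 0") (auto simp: mult_le_cancel_right)
    qed
  qed
  moreover have "cinner (T x) x = complex_of_real (t x x)" for x
  proof (rule complex_eqI)
    show "Re (cinner (T x) x) = Re (complex_of_real (t x x))" by (simp add: T flip: inner_eq_Re_cinner)
    have "t x (\<i> *\<^sub>C x) = 0" using i[of x x] sym[of "\<i> *\<^sub>C x" x] by simp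
    then show "Im (cinner (T x) x) = Im (complex_of_real (t x x))" by (simp add: Im_cinner T)
  qed
  ultimately show ?thesis by blast
qed

text \<open>One form for each group element, since each element needs its own contraction in the
  minimax argument. The arguments are uncurried so that the families lie in a single product of real
  lines.\<close>

definition form_space :: "('g \<times> 'a::complex_inner \<times> 'a \<Rightarrow> real) set" where
  "form_space = {t. \<forall>g. hermitian_contraction_form (\<lambda>x y. t (g, x, y))}"

lemma form_spaceD:
  assumes "t \<in> form_space"
  shows "t (g, x + y, z) = t (g, x, z) + t (g, y, z)" "t (g, r *\<^sub>R x, z) = r * t (g, x, z)"
    "t (g, \<i> *\<^sub>C x, \<i> *\<^sub>C y) = t (g, x, y)" "\<bar>t (g, x, y)\<bar> \<le> norm x * norm y"
    "t (g, x, y) = t (g, y, x)"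
proof -
  from assms have "hermitian_contraction_form (\<lambda>x y. t (g, x, y))"
    unfolding form_space_def by simp
  note h = this[unfolded hermitian_contraction_form_def]
  show "t (g, x + y, z) = t (g, x, z) + t (g, y, z)" "t (g, r *\<^sub>R x, z) = r * t (g, x, z)"
    "t (g, \<i> *\<^sub>C x, \<i> *\<^sub>C y) = t (g, x, y)" "\<bar>t (g, x, y)\<bar> \<le> norm x * norm y"
    "t (g, x, y) = t (g, y, x)"
    using h by (elim conjE; iprover)+
qed

lemma compact_form_space: "compact (form_space :: ('g \<times> 'a::complex_inner \<times> 'a \<Rightarrow> real) set)"
proof -
  define S where "S = (\<lambda>(g :: 'g, x :: 'a, y :: 'a). {- (norm x * norm y)..norm x * norm y})"
  have cl: "closed (form_space :: ('g \<times> 'a \<times> 'a \<Rightarrow> real) set)"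
    unfolding form_space_def hermitian_contraction_form_def
    by (intro closed_Collect_all closed_Collect_conj closed_Collect_eq closed_Collect_le continuous_intros)
  have co: "compact {t. \<forall>p. t p \<in> S p}"
    by (rule compact_box) (auto simp: S_def split: prod.split)
  have "form_space \<subseteq> {t. \<forall>p. t p \<in> S p}"
  proof
    fix t :: "'g \<times> 'a \<times> 'a \<Rightarrow> real" assume "t \<in> form_space"
    from form_spaceD(4)[OF this] show "t \<in> {t. \<forall>p. t p \<in> S p}"
      by (auto simp: S_def abs_le_iff minus_le_iff)
  qed
  then have "{t. \<forall>p. t p \<in> S p} \<inter> form_space = form_space" by (rule inf.absorb2)
  with compact_Int_closed[OF co cl] show ?thesis by simp
qed

lemma form_space_zero: "(\<lambda>_. 0) \<in> form_space"
  by (simp add: form_space_def hermitian_contraction_form_def)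

lemma form_space_convex:
  assumes t: "t \<in> form_space" and u: "u \<in> form_space" and s: "0 \<le> s" "s \<le> 1"
  shows "(\<lambda>i. (1 - s) * t i + s * u i) \<in> form_space"
  unfolding form_space_def hermitian_contraction_form_def
proof (intro CollectI allI conjI)
  fix g x y z and r :: real
  show "(1 - s) * t (g, x + y, z) + s * u (g, x + y, z) =
      (1 - s) * t (g, x, z) + s * u (g, x, z) + ((1 - s) * t (g, y, z) + s * u (g, y, z))"
    by (simp add: form_spaceD(1)[OF t] form_spaceD(1)[OF u] algebra_simps)
  show "(1 - s) * t (g, r *\<^sub>R x, z) + s * u (g, r *\<^sub>R x, z) = r * ((1 - s) * t (g, x, z) + s * u (g, x, z))"
    by (simp add: form_spaceD(2)[OF t] form_spaceD(2)[OF u] algebra_simps)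
  show "(1 - s) * t (g, x, y) + s * u (g, x, y) = (1 - s) * t (g, y, x) + s * u (g, y, x)"
    by (simp only: form_spaceD(5)[OF t, of g x y] form_spaceD(5)[OF u, of g x y])
  show "(1 - s) * t (g, \<i> *\<^sub>C x, \<i> *\<^sub>C y) + s * u (g, \<i> *\<^sub>C x, \<i> *\<^sub>C y) = (1 - s) * t (g, x, y) + s * u (g, x, y)"
    by (simp add: form_spaceD(3)[OF t] form_spaceD(3)[OF u])
  have "\<bar>(1 - s) * t (g, x, y) + s * u (g, x, y)\<bar> \<le> (1 - s) * (norm x * norm y) + s * (norm x * norm y)"
    using s form_spaceD(4)[OF t, of g x y] form_spaceD(4)[OF u, of g x y]
    by (intro order.trans[OF abs_triangle_ineq] add_mono) (auto simp: abs_mult intro!: mult_left_mono)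
  then show "\<bar>(1 - s) * t (g, x, y) + s * u (g, x, y)\<bar> \<le> norm x * norm y" by (simp add: left_diff_distrib)
qed

text \<open>Bridges the real contractions of the Procrustes step and the complex linear operators on
  which a state acts. Symmetrising does not affect diagonal values, and averaging over conjugation
  by i does not affect sums over tuples that contain x and i x with equal weight.\<close>

lemma contraction_form:
  fixes Z :: "'a::complex_inner \<Rightarrow> 'a"
  assumes Z: "linear Z" "\<And>x. norm (Z x) \<le> norm x"
  shows "hermitian_contraction_form
    (\<lambda>x y. (Z x \<bullet> y + Z y \<bullet> x + Z (\<i> *\<^sub>C x) \<bullet> (\<i> *\<^sub>C y) + Z (\<i> *\<^sub>C y) \<bullet> (\<i> *\<^sub>C x)) / 4)"
proof -
  interpret linear Z by fact
  have b: "\<bar>Z x \<bullet> y\<bar> \<le> norm x * norm y" for x y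
    by (rule order.trans[OF Cauchy_Schwarz_ineq2]) (intro mult_right_mono Z(2); simp)
  have "\<bar>(Z x \<bullet> y + Z y \<bullet> x + Z (\<i> *\<^sub>C x) \<bullet> (\<i> *\<^sub>C y) + Z (\<i> *\<^sub>C y) \<bullet> (\<i> *\<^sub>C x)) / 4\<bar> \<le> norm x * norm y" for x y
    using b[of x y] b[of y x] b[of "\<i> *\<^sub>C x" "\<i> *\<^sub>C y"] b[of "\<i> *\<^sub>C y" "\<i> *\<^sub>C x"]
    by (simp add: norm_scaleC abs_le_iff mult.commute)
  then show ?thesis
    unfolding hermitian_contraction_form_def
    by (auto simp: add scale neg scaleC_add_right scaleC_scaleR_commute inner_add_left inner_add_right
        i_scaleC_i field_simps)
qed

section \<open>Amenability implies concentration\<close>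

lemma sum_list_map_nth: "(\<Sum>x\<leftarrow>xs. f x) = (\<Sum>i<length xs. f (xs ! i))"
  by (simp add: sum_list_sum_nth atLeast0LessThan)

context unitary_representation begin

text \<open>Otherwise homogeneity would make a positive operator out of the differences of operators
  and their conjugates, plus rank one operators, minus \<eta> times the identity. An invariant state
  killing rank one operators takes the value -\<eta> on it.\<close>

lemma invariant_state_no_strict_form:
  assumes \<phi>: "op_state \<phi>"
    and inv: "\<And>g T. g \<in> carrier G \<Longrightarrow> bounded_clinear T \<Longrightarrow> \<phi> (\<pi> g \<circ> T \<circ> inv_into UNIV (\<pi> g)) = \<phi> T"
    and rank: "\<And>v. \<phi> (rank_one v) = 0"
    and F: "finite F" "F \<subseteq> carrier G" and t: "t \<in> form_space" and \<eta>: "\<eta> > 0"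
  shows "\<exists>x. norm x = 1 \<and>
    (\<Sum>g\<in>F. t (g, x, x) - t (g, \<pi> g x, \<pi> g x)) + (\<Sum>j<l. (cmod (cinner x (e j)))\<^sup>2) < \<eta>"
proof (rule ccontr)
  define h where "h = (\<lambda>x. (\<Sum>g\<in>F. t (g, x, x) - t (g, \<pi> g x, \<pi> g x)) + (\<Sum>j<l. (cmod (cinner x (e j)))\<^sup>2))"
  assume "\<not> ?thesis"
  then have h1: "\<eta> \<le> h x" if "norm x = 1" for x using that by (auto simp: h_def not_less)
  have tr: "t (g, r *\<^sub>R x, r *\<^sub>R x) = r\<^sup>2 * t (g, x, x)" for g r x
    using form_spaceD(2)[OF t, of g r x "r *\<^sub>R x"] form_spaceD(2)[OF t, of g r x x]
      form_spaceD(5)[OF t, of g x "r *\<^sub>R x"]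
    by (simp add: power2_eq_square)
  have h_ge: "\<eta> * (norm x)\<^sup>2 \<le> h x" for x
  proof (cases "x = 0")
    case True
    have "t (g, 0, 0) = 0" for g using tr[of g 0 0] by simp
    moreover have "\<pi> g 0 = 0" if "g \<in> F" for g using linear_0[OF linear] that F(2) by blast
    ultimately show ?thesis using True by (simp add: h_def sum_nonneg)
  next
    case False
    define r where "r = 1 / norm x"
    have "h (r *\<^sub>R x) = r\<^sup>2 * h x"
    proof -
      have "\<pi> g (r *\<^sub>R x) = r *\<^sub>R \<pi> g x" if "g \<in> F" for g
        using linear_scale[OF linear] that F(2) by blast
      moreover have "(cmod (cinner (r *\<^sub>R x) y))\<^sup>2 = r\<^sup>2 * (cmod (cinner x y))\<^sup>2" for y
        by (simp add: scaleR_scaleC cinner_scaleC_left norm_mult power_mult_distrib)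
      ultimately show ?thesis
        unfolding h_def distrib_left sum_distrib_left
        by (intro arg_cong2[of _ _ _ _ "(+)"] sum.cong refl) (simp_all add: tr right_diff_distrib)
    qed
    moreover have "norm (r *\<^sub>R x) = 1" using False by (simp add: r_def)
    ultimately have "\<eta> \<le> r\<^sup>2 * h x" using h1[of "r *\<^sub>R x"] by simp
    then show ?thesis using False by (simp add: r_def power_divide field_simps)
  qed
  have "\<forall>g. \<exists>T. bounded_clinear T \<and> (\<forall>x. cinner (T x) x = complex_of_real (t (g, x, x)))"
    using t hermitian_contraction_form_operator by (auto simp: form_space_def)
  from choice[OF this] obtain T where "\<forall>g. bounded_clinear (T g) \<and> (\<forall>x. cinner (T g x) x = complex_of_real (t (g, x, x)))" ..
  then have T: "bounded_clinear (T g)" "cinner (T g x) x = complex_of_real (t (g, x, x))" for g x by auto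
  define T' where "T' = (\<lambda>g. \<pi> (inv\<^bsub>G\<^esub> g) \<circ> T g \<circ> \<pi> g)"
  have T': "bounded_clinear (T' g)" "\<phi> (T' g) = \<phi> (T g)"
    "\<And>x. cinner (T' g x) x = complex_of_real (t (g, \<pi> g x, \<pi> g x))" if g: "g \<in> F" for g
  proof -
    have gG: "g \<in> carrier G" using g F(2) by blast
    show bc: "bounded_clinear (T' g)"
      unfolding T'_def by (intro bounded_clinear_compose bounded_clinear T gG inv_closed)
    have "\<pi> g \<circ> T' g \<circ> inv_into UNIV (\<pi> g) = T g"
      by (simp add: fun_eq_iff T'_def inv_into_eq[OF gG] inv_cancel[OF gG])
    then show "\<phi> (T' g) = \<phi> (T g)" using inv[OF gG bc] by simp
    show "cinner (T' g x) x = complex_of_real (t (g, \<pi> g x, \<pi> g x))" for x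
      by (simp add: T'_def cinner_inv[OF gG] T)
  qed
  define S1 S2 S3 where "S1 = (\<lambda>x. \<Sum>g\<in>F. T g x - T' g x)" and "S2 = (\<lambda>x. \<Sum>j<l. rank_one (e j) x)"
    and "S3 = (\<lambda>x :: 'a. complex_of_real \<eta> *\<^sub>C id x)"
  have bc12: "bounded_clinear (\<lambda>x. T g x - T' g x)" if "g \<in> F" for g
    by (rule bounded_clinear_diff[OF T(1) T'(1)[OF that]])
  have bc: "bounded_clinear S1" "bounded_clinear S2" "bounded_clinear S3"
  proof -
    show "bounded_clinear S1" unfolding S1_def by (rule bounded_clinear_sum[OF bc12])
    show "bounded_clinear S2" unfolding S2_def by (rule bounded_clinear_sum[OF bounded_clinear_rank_one])
    show "bounded_clinear S3" unfolding S3_def by (rule bounded_clinear_scaleC[OF bounded_clinear_id])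
  qed
  have bc123: "bounded_clinear (\<lambda>x. S1 x + S2 x)" by (rule bounded_clinear_add[OF bc(1,2)])
  define S where "S = (\<lambda>x. (S1 x + S2 x) - S3 x)"
  have "positive_op S"
    unfolding positive_op_def
  proof (intro conjI allI)
    show "bounded_clinear S" unfolding S_def by (rule bounded_clinear_diff[OF bc123 bc(3)])
    fix x
    have "cinner (S1 x) x = complex_of_real (\<Sum>g\<in>F. t (g, x, x) - t (g, \<pi> g x, \<pi> g x))"
      unfolding S1_def cinner_sum_left cinner_diff_left of_real_sum of_real_diff
      by (intro sum.cong refl) (simp add: T T')
    moreover have "cinner (S2 x) x = complex_of_real (\<Sum>j<l. (cmod (cinner x (e j)))\<^sup>2)"
      unfolding S2_def cinner_sum_left of_real_sum cinner_rank_one ..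
    moreover have "cinner (S3 x) x = complex_of_real (\<eta> * (norm x)\<^sup>2)"
      by (simp add: S3_def cinner_scaleC_left cinner_self)
    ultimately have "cinner (S x) x = complex_of_real (h x - \<eta> * (norm x)\<^sup>2)"
      unfolding S_def h_def cinner_diff_left cinner_add_left of_real_diff of_real_add by simp
    then show "cinner (S x) x \<in> \<real>\<^sub>\<ge>\<^sub>0" using h_ge[of x] by (simp add: complex_nonneg_Reals_iff del: of_real_diff)
  qed
  then have "\<phi> S \<in> \<real>\<^sub>\<ge>\<^sub>0" by (rule op_state_nonneg[OF \<phi>])
  moreover have "\<phi> S = - complex_of_real \<eta>"
  proof -
    have "\<phi> S = \<phi> S1 + \<phi> S2 - \<phi> S3"
      unfolding S_def op_state_diff[OF \<phi> bc123 bc(3)] op_state_add[OF \<phi> bc(1,2)] ..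
    moreover have "\<phi> S1 = (\<Sum>g\<in>F. \<phi> (\<lambda>x. T g x - T' g x))"
      unfolding S1_def by (rule op_state_sum[OF \<phi> bc12])
    moreover have "\<phi> (\<lambda>x. T g x - T' g x) = 0" if "g \<in> F" for g
      unfolding op_state_diff[OF \<phi> T(1) T'(1)[OF that]] using T'(2)[OF that] by simp
    moreover have "\<phi> S2 = (\<Sum>j<l. \<phi> (rank_one (e j)))"
      unfolding S2_def by (rule op_state_sum[OF \<phi> bounded_clinear_rank_one])
    moreover have "\<phi> S3 = complex_of_real \<eta>"
      unfolding S3_def op_state_scaleC[OF \<phi> bounded_clinear_id] using \<phi> by (simp add: op_state_def)
    ultimately show ?thesis by (simp add: rank)
  qed
  ultimately show False using \<eta> by (simp add: complex_nonneg_Reals_iff)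
qed

text \<open>A finitely supported probability p on the sphere gives a list of weighted vectors. If
  every list violates some condition, each p is answered by a family of forms with mean value at
  least \<eta>, and minimax yields one family that works for all unit vectors at once, contradicting
  \<open>invariant_state_no_strict_form\<close>.\<close>

lemma almost_invariant_list:
  assumes \<phi>: "op_state \<phi>"
    and inv: "\<And>g T. g \<in> carrier G \<Longrightarrow> bounded_clinear T \<Longrightarrow> \<phi> (\<pi> g \<circ> T \<circ> inv_into UNIV (\<pi> g)) = \<phi> T"
    and rank: "\<And>v. \<phi> (rank_one v) = 0"
    and F: "finite F" "F \<subseteq> carrier G" and \<eta>: "\<eta> > 0"
  shows "\<exists>ws. (\<Sum>w\<leftarrow>ws. (norm w)\<^sup>2) = 1 \<and> (\<Sum>w\<leftarrow>ws. \<Sum>e\<leftarrow>es. (w \<bullet> e)\<^sup>2) \<le> \<eta> \<and>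
    (\<forall>g\<in>F. \<forall>Z. linear Z \<longrightarrow> (\<forall>x. norm (Z x) \<le> norm x) \<longrightarrow>
      (\<Sum>w\<leftarrow>ws. Z w \<bullet> w - Z (\<pi> g w) \<bullet> \<pi> g w) \<le> \<eta>)"
proof (rule ccontr)
  assume contra: "\<not> ?thesis"
  define l where "l = length es"
  define h where "h = (\<lambda>x (t :: 'g \<times> 'a \<times> 'a \<Rightarrow> real).
    (\<Sum>g\<in>F. t (g, x, x) - t (g, \<pi> g x, \<pi> g x)) + (\<Sum>j<l. (cmod (cinner x (es ! j)))\<^sup>2))"
  have "\<exists>t\<in>form_space. \<forall>x\<in>sphere 0 1. \<eta> \<le> h x t"
  proof (rule compact_minimax[OF compact_form_space _ form_space_convex])
    show "form_space \<noteq> ({} :: ('g \<times> 'a \<times> 'a \<Rightarrow> real) set)" using form_space_zero by blast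
    show "continuous_on UNIV (h x)" for x
      unfolding h_def by (intro continuous_intros)
    show "h x (\<lambda>i. (1 - s) * t i + s * u i) = (1 - s) * h x t + s * h x u" for x t u s
    proof -
      have "(\<Sum>g\<in>F. ((1 - s) * t (g, x, x) + s * u (g, x, x)) - ((1 - s) * t (g, \<pi> g x, \<pi> g x) + s * u (g, \<pi> g x, \<pi> g x)))
        = (1 - s) * (\<Sum>g\<in>F. t (g, x, x) - t (g, \<pi> g x, \<pi> g x)) + s * (\<Sum>g\<in>F. u (g, x, x) - u (g, \<pi> g x, \<pi> g x))"
        unfolding sum_distrib_left sum.distrib[symmetric]
        by (intro sum.cong refl) (simp add: algebra_simps)
      then show ?thesis by (simp add: h_def algebra_simps)
    qed
    fix J :: "'a set" and p :: "'a \<Rightarrow> real"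
    assume J: "finite J" "J \<subseteq> sphere 0 1" and p0: "\<And>b. b \<in> J \<Longrightarrow> 0 \<le> p b" and p1: "(\<Sum>b\<in>J. p b) = 1"
    obtain xs where xs: "set xs = J" "distinct xs" using finite_distinct_list[OF J(1)] by blast
    \<comment> \<open>The weight p x is halved because both x and i x enter the list. Squared real
      products with x and i x add up to the squared modulus of the complex product, which accounts
      for the 1/2 in \<open>penalty\<close>.\<close>
    define c where "c = (\<lambda>x. sqrt (p x / 2))"
    have c2: "(c x)\<^sup>2 = p x / 2" if "x \<in> J" for x using p0[OF that] by (simp add: c_def)
    define ws where "ws = map (\<lambda>x. c x *\<^sub>R x) xs @ map (\<lambda>x. c x *\<^sub>R (\<i> *\<^sub>C x)) xs"
    have ws_sum: "(\<Sum>w\<leftarrow>ws. f w) = (\<Sum>x\<in>J. p x / 2 * (f x + f (\<i> *\<^sub>C x)))"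
      if "\<And>r x. f (r *\<^sub>R x) = r\<^sup>2 * f x" for f :: "'a \<Rightarrow> real"
    proof -
      have "(\<Sum>w\<leftarrow>ws. f w) = (\<Sum>x\<leftarrow>xs. f (c x *\<^sub>R x)) + (\<Sum>x\<leftarrow>xs. f (c x *\<^sub>R (\<i> *\<^sub>C x)))"
        by (simp add: ws_def o_def)
      also have "\<dots> = (\<Sum>x\<in>J. f (c x *\<^sub>R x)) + (\<Sum>x\<in>J. f (c x *\<^sub>R (\<i> *\<^sub>C x)))"
        using xs by (simp add: sum_list_distinct_conv_sum_set)
      also have "\<dots> = (\<Sum>x\<in>J. p x / 2 * (f x + f (\<i> *\<^sub>C x)))"
        unfolding sum.distrib[symmetric] by (intro sum.cong refl) (simp add: that c2 distrib_left)
      finally show ?thesis .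
    qed
    have one: "(\<Sum>w\<leftarrow>ws. (norm w)\<^sup>2) = 1"
    proof -
      have "(\<Sum>w\<leftarrow>ws. (norm w)\<^sup>2) = (\<Sum>x\<in>J. p x / 2 * ((norm x)\<^sup>2 + (norm (\<i> *\<^sub>C x))\<^sup>2))"
        by (rule ws_sum) (simp add: power_mult_distrib)
      also have "\<dots> = (\<Sum>x\<in>J. p x)" using J(2) by (intro sum.cong) (auto simp: norm_scaleC)
      finally show ?thesis using p1 by simp
    qed
    have penalty: "(\<Sum>w\<leftarrow>ws. \<Sum>e\<leftarrow>es. (w \<bullet> e)\<^sup>2) = (\<Sum>x\<in>J. p x * (\<Sum>j<l. (cmod (cinner x (es ! j)))\<^sup>2)) / 2"
    proof -
      have "(\<Sum>w\<leftarrow>ws. \<Sum>e\<leftarrow>es. (w \<bullet> e)\<^sup>2) = (\<Sum>w\<leftarrow>ws. \<Sum>j<l. (w \<bullet> (es ! j))\<^sup>2)"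
        by (simp add: sum_list_map_nth[of _ es] l_def)
      also have "\<dots> = (\<Sum>x\<in>J. p x / 2 * ((\<Sum>j<l. (x \<bullet> (es ! j))\<^sup>2) + (\<Sum>j<l. ((\<i> *\<^sub>C x) \<bullet> (es ! j))\<^sup>2)))"
        by (rule ws_sum) (simp add: power_mult_distrib sum_distrib_left)
      also have "\<dots> = (\<Sum>x\<in>J. p x * (\<Sum>j<l. (cmod (cinner x (es ! j)))\<^sup>2) / 2)"
        by (intro sum.cong refl)
          (simp add: cmod_power2 inner_eq_Re_cinner cinner_scaleC_left sum.distrib)
      finally show ?thesis by (simp add: sum_divide_distrib)
    qed
    have pen0: "0 \<le> (\<Sum>x\<in>J. p x * (\<Sum>j<l. (cmod (cinner x (es ! j)))\<^sup>2))"
      using p0 by (intro sum_nonneg mult_nonneg_nonneg) auto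
    have "\<not> ((\<Sum>w\<leftarrow>ws. (norm w)\<^sup>2) = 1 \<and> (\<Sum>w\<leftarrow>ws. \<Sum>e\<leftarrow>es. (w \<bullet> e)\<^sup>2) \<le> \<eta> \<and>
      (\<forall>g\<in>F. \<forall>Z. linear Z \<longrightarrow> (\<forall>x. norm (Z x) \<le> norm x) \<longrightarrow>
        (\<Sum>w\<leftarrow>ws. Z w \<bullet> w - Z (\<pi> g w) \<bullet> \<pi> g w) \<le> \<eta>))"
      using contra by (rule contrapos_nn) (rule exI)
    then have "\<eta> < (\<Sum>w\<leftarrow>ws. \<Sum>e\<leftarrow>es. (w \<bullet> e)\<^sup>2) \<or> (\<exists>g\<in>F. \<exists>Z. linear Z \<and> (\<forall>x. norm (Z x) \<le> norm x) \<and>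
        \<eta> < (\<Sum>w\<leftarrow>ws. Z w \<bullet> w - Z (\<pi> g w) \<bullet> \<pi> g w))"
      using one by (simp add: not_le)
    then consider "\<eta> < (\<Sum>w\<leftarrow>ws. \<Sum>e\<leftarrow>es. (w \<bullet> e)\<^sup>2)"
      | g Z where "g \<in> F" "linear Z" "\<And>x. norm (Z x) \<le> norm x" "\<eta> < (\<Sum>w\<leftarrow>ws. Z w \<bullet> w - Z (\<pi> g w) \<bullet> \<pi> g w)"
      by blast
    then show "\<exists>t\<in>form_space. \<eta> \<le> (\<Sum>b\<in>J. p b * h b t)"
    proof cases
      case 1
      \<comment> \<open>The zero family removes the invariance terms, so the violated orthogonality
        condition alone answers p.\<close>
      have "\<eta> \<le> (\<Sum>b\<in>J. p b * h b (\<lambda>_. 0))"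
        using 1 pen0 \<eta> unfolding penalty by (simp add: h_def)
      then show ?thesis using form_space_zero by blast
    next
      case (2 g Z)
      define q where "q = (\<lambda>x y. (Z x \<bullet> y + Z y \<bullet> x + Z (\<i> *\<^sub>C x) \<bullet> (\<i> *\<^sub>C y) + Z (\<i> *\<^sub>C y) \<bullet> (\<i> *\<^sub>C x)) / 4)"
      \<comment> \<open>The family is concentrated at the group element whose invariance condition
        fails, with the hermitian form of the offending contraction.\<close>
      define t where "t = (\<lambda>(g', x, y). if g' = g then q x y else 0)"
      have gG: "g \<in> carrier G" using 2(1) F(2) by blast
      have "hermitian_contraction_form q" unfolding q_def by (rule contraction_form[OF 2(2,3)])
      then have "hermitian_contraction_form (\<lambda>x y. t (g', x, y))" for g'
        by (cases "g' = g") (simp_all add: t_def hermitian_contraction_form_def[of "\<lambda>_ _. 0"])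
      then have t: "t \<in> form_space" by (simp add: form_space_def)
      have q: "q x x = (Z x \<bullet> x + Z (\<i> *\<^sub>C x) \<bullet> (\<i> *\<^sub>C x)) / 2" for x by (simp add: q_def)
      have ht: "h x t = q x x - q (\<pi> g x) (\<pi> g x) + (\<Sum>j<l. (cmod (cinner x (es ! j)))\<^sup>2)" for x
      proof -
        have "(\<Sum>g'\<in>F. t (g', x, x) - t (g', \<pi> g' x, \<pi> g' x)) = (\<Sum>g'\<in>F. if g' = g then q x x - q (\<pi> g x) (\<pi> g x) else 0)"
          by (intro sum.cong refl) (simp add: t_def)
        then show ?thesis using 2(1) F(1) by (simp add: h_def)
      qed
      have "(\<Sum>w\<leftarrow>ws. Z w \<bullet> w - Z (\<pi> g w) \<bullet> \<pi> g w) = (\<Sum>x\<in>J. p x / 2 * ((Z x \<bullet> x - Z (\<pi> g x) \<bullet> \<pi> g x)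
          + (Z (\<i> *\<^sub>C x) \<bullet> (\<i> *\<^sub>C x) - Z (\<pi> g (\<i> *\<^sub>C x)) \<bullet> \<pi> g (\<i> *\<^sub>C x))))"
        by (rule ws_sum)
          (simp add: linear_scale[OF 2(2)] linear_scale[OF linear[OF gG]] power2_eq_square right_diff_distrib)
      also have "\<dots> = (\<Sum>x\<in>J. p x * (q x x - q (\<pi> g x) (\<pi> g x)))"
        by (intro sum.cong refl) (simp add: q scaleC[OF gG] field_simps)
      also have "\<dots> \<le> (\<Sum>x\<in>J. p x * (q x x - q (\<pi> g x) (\<pi> g x))) + (\<Sum>x\<in>J. p x * (\<Sum>j<l. (cmod (cinner x (es ! j)))\<^sup>2))"
        using pen0 by simp
      also have "\<dots> = (\<Sum>x\<in>J. p x * h x t)"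
        unfolding ht sum.distrib[symmetric] by (simp add: distrib_left)
      finally have "\<eta> \<le> (\<Sum>x\<in>J. p x * h x t)" using 2(4) by linarith
      then show ?thesis using t by blast
    qed
  qed
  then obtain t where t: "t \<in> form_space" "\<And>x. norm x = 1 \<Longrightarrow> \<eta> \<le> h x t" by auto
  obtain x where "norm x = 1" "h x t < \<eta>"
    using invariant_state_no_strict_form[where l = l and e = "\<lambda>j. es ! j", OF \<phi> inv rank F t(1) \<eta>]
    unfolding h_def by blast
  then show False using t(2)[of x] by simp
qed

text \<open>Each new list is nearly orthogonal to all earlier ones, so the squared Hilbert-Schmidt
  norm of the Gram matrix grows linearly in n. After normalising to total squared norm 1 it decays
  like 1 / n.\<close>

lemma almost_invariant_spread_list:
  assumes \<phi>: "op_state \<phi>"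
    and inv: "\<And>g T. g \<in> carrier G \<Longrightarrow> bounded_clinear T \<Longrightarrow> \<phi> (\<pi> g \<circ> T \<circ> inv_into UNIV (\<pi> g)) = \<phi> T"
    and rank: "\<And>v. \<phi> (rank_one v) = 0"
    and F: "finite F" "F \<subseteq> carrier G" and \<eta>: "\<eta> > 0"
  shows "\<exists>ws. (\<Sum>w\<leftarrow>ws. (norm w)\<^sup>2) = real n \<and> (\<Sum>w\<leftarrow>ws. \<Sum>e\<leftarrow>ws. (w \<bullet> e)\<^sup>2) \<le> 2 * real n \<and>
    (\<forall>g\<in>F. \<forall>Z. linear Z \<longrightarrow> (\<forall>x. norm (Z x) \<le> norm x) \<longrightarrow>
      (\<Sum>w\<leftarrow>ws. Z w \<bullet> w - Z (\<pi> g w) \<bullet> \<pi> g w) \<le> real n * \<eta>)"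
proof (induction n)
  case 0
  show ?case by (rule exI[of _ "[]"]) simp
next
  case (Suc n)
  then obtain es where es: "(\<Sum>w\<leftarrow>es. (norm w)\<^sup>2) = real n" "(\<Sum>w\<leftarrow>es. \<Sum>e\<leftarrow>es. (w \<bullet> e)\<^sup>2) \<le> 2 * real n"
    "\<And>g Z. g \<in> F \<Longrightarrow> linear Z \<Longrightarrow> (\<And>x. norm (Z x) \<le> norm x) \<Longrightarrow>
      (\<Sum>w\<leftarrow>es. Z w \<bullet> w - Z (\<pi> g w) \<bullet> \<pi> g w) \<le> real n * \<eta>"
    by auto
  \<comment> \<open>The two cross blocks contribute at most 2 \<delta>, hence at most 1, and the new
    diagonal block at most 1: an increase of at most 2 per step.\<close>
  define \<delta> where "\<delta> = min \<eta> (1 / 2)"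
  have \<delta>: "\<delta> > 0" "\<delta> \<le> \<eta>" "\<delta> \<le> 1 / 2" using \<eta> by (auto simp: \<delta>_def)
  obtain ws where ws: "(\<Sum>w\<leftarrow>ws. (norm w)\<^sup>2) = 1" "(\<Sum>w\<leftarrow>ws. \<Sum>e\<leftarrow>es. (w \<bullet> e)\<^sup>2) \<le> \<delta>"
    "\<And>g Z. g \<in> F \<Longrightarrow> linear Z \<Longrightarrow> (\<And>x. norm (Z x) \<le> norm x) \<Longrightarrow>
      (\<Sum>w\<leftarrow>ws. Z w \<bullet> w - Z (\<pi> g w) \<bullet> \<pi> g w) \<le> \<delta>"
    using almost_invariant_list[OF \<phi> inv rank F \<delta>(1), of es] by auto
  have gram_ws: "(\<Sum>w\<leftarrow>ws. \<Sum>e\<leftarrow>ws. (w \<bullet> e)\<^sup>2) \<le> 1"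
  proof -
    have "(\<Sum>w\<leftarrow>ws. \<Sum>e\<leftarrow>ws. (w \<bullet> e)\<^sup>2) \<le> (\<Sum>w\<leftarrow>ws. \<Sum>e\<leftarrow>ws. (norm w)\<^sup>2 * (norm e)\<^sup>2)"
    proof (intro sum_list_mono)
      fix w e :: 'a
      have "\<bar>w \<bullet> e\<bar>\<^sup>2 \<le> (norm w * norm e)\<^sup>2" by (intro power_mono Cauchy_Schwarz_ineq2) simp
      then show "(w \<bullet> e)\<^sup>2 \<le> (norm w)\<^sup>2 * (norm e)\<^sup>2" by (simp add: power_mult_distrib)
    qed
    then show ?thesis using ws(1) by (simp add: sum_list_const_mult)
  qed
  have swap: "(\<Sum>w\<leftarrow>es. \<Sum>e\<leftarrow>ws. (w \<bullet> e)\<^sup>2) = (\<Sum>w\<leftarrow>ws. \<Sum>e\<leftarrow>es. (w \<bullet> e)\<^sup>2)"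
    by (simp only: sum_list_map_nth inner_commute sum.swap[of _ "{..<length es}"])
  have "(\<Sum>w\<leftarrow>ws @ es. \<Sum>e\<leftarrow>ws @ es. (w \<bullet> e)\<^sup>2)
    = (\<Sum>w\<leftarrow>ws. \<Sum>e\<leftarrow>ws. (w \<bullet> e)\<^sup>2) + (\<Sum>w\<leftarrow>ws. \<Sum>e\<leftarrow>es. (w \<bullet> e)\<^sup>2)
      + ((\<Sum>w\<leftarrow>es. \<Sum>e\<leftarrow>ws. (w \<bullet> e)\<^sup>2) + (\<Sum>w\<leftarrow>es. \<Sum>e\<leftarrow>es. (w \<bullet> e)\<^sup>2))"
    by (simp add: sum_list_addf)
  then have "(\<Sum>w\<leftarrow>ws @ es. \<Sum>e\<leftarrow>ws @ es. (w \<bullet> e)\<^sup>2) \<le> 2 * real (Suc n)"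
    using gram_ws ws(2) es(2) \<delta>(3) swap by simp
  moreover have "(\<Sum>w\<leftarrow>ws @ es. Z w \<bullet> w - Z (\<pi> g w) \<bullet> \<pi> g w) \<le> real (Suc n) * \<eta>"
    if "g \<in> F" "linear Z" "\<And>x. norm (Z x) \<le> norm x" for g Z
    using ws(3)[OF that] es(3)[OF that] \<delta>(2) by (simp add: algebra_simps)
  moreover have "(\<Sum>w\<leftarrow>ws @ es. (norm w)\<^sup>2) = real (Suc n)" using ws(1) es(1) by simp
  ultimately show ?case by (intro exI[of _ "ws @ es"]) auto
qed

lemma almost_invariant_tuple:
  assumes \<phi>: "op_state \<phi>"
    and inv: "\<And>g T. g \<in> carrier G \<Longrightarrow> bounded_clinear T \<Longrightarrow> \<phi> (\<pi> g \<circ> T \<circ> inv_into UNIV (\<pi> g)) = \<phi> T"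
    and rank: "\<And>v. \<phi> (rank_one v) = 0"
    and F: "finite F" "F \<subseteq> carrier G" and \<eta>: "\<eta> > 0"
  shows "\<exists>(k :: nat) w. (\<Sum>i<k. (norm (w i))\<^sup>2) = 1 \<and> (\<Sum>i<k. \<Sum>j<k. (w i \<bullet> w j)\<^sup>2) \<le> \<eta>\<^sup>2 \<and>
    (\<forall>g\<in>F. \<forall>Z. linear Z \<longrightarrow> (\<forall>x. norm (Z x) \<le> norm x) \<longrightarrow>
      (\<Sum>i<k. Z (w i) \<bullet> w i - Z (\<pi> g (w i)) \<bullet> \<pi> g (w i)) \<le> \<eta>)"
proof -
  \<comment> \<open>Scaling squared norms by 1 / n multiplies the Gram sum by
    \<open>1 / n\<^sup>2\<close>, so \<open>2 * real n\<close> becomes 2 / n, which this choice of n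
    makes smaller than \<open>\<eta>\<^sup>2\<close>.\<close>
  obtain n :: nat where n: "2 / \<eta>\<^sup>2 < real n" using reals_Archimedean2 by blast
  have "2 / \<eta>\<^sup>2 > 0" using \<eta> by simp
  then have n0: "real n > 0" using n by linarith
  obtain ws where ws: "(\<Sum>w\<leftarrow>ws. (norm w)\<^sup>2) = real n" "(\<Sum>w\<leftarrow>ws. \<Sum>e\<leftarrow>ws. (w \<bullet> e)\<^sup>2) \<le> 2 * real n"
    "\<And>g Z. g \<in> F \<Longrightarrow> linear Z \<Longrightarrow> (\<And>x. norm (Z x) \<le> norm x) \<Longrightarrow>
      (\<Sum>w\<leftarrow>ws. Z w \<bullet> w - Z (\<pi> g w) \<bullet> \<pi> g w) \<le> real n * \<eta>"
    using almost_invariant_spread_list[OF \<phi> inv rank F \<eta>, of n] by auto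
  define k where "k = length ws"
  define c where "c = 1 / sqrt (real n)"
  have c2: "c * c = 1 / real n" and c_abs: "\<bar>c\<bar> = c" using n0 by (simp_all add: c_def)
  define w where "w = (\<lambda>i. c *\<^sub>R (ws ! i))"
  have "(\<Sum>i<k. (norm (w i))\<^sup>2) = 1"
  proof -
    have "(\<Sum>i<k. (norm (w i))\<^sup>2) = (c * c) * (\<Sum>w\<leftarrow>ws. (norm w)\<^sup>2)"
      by (simp add: sum_list_map_nth k_def w_def sum_distrib_left power2_eq_square c_abs mult_ac)
    then show ?thesis using ws(1) c2 n0 by simp
  qed
  moreover have "(\<Sum>i<k. \<Sum>j<k. (w i \<bullet> w j)\<^sup>2) \<le> \<eta>\<^sup>2"
  proof -
    have "(\<Sum>i<k. \<Sum>j<k. (w i \<bullet> w j)\<^sup>2) = (c * c)\<^sup>2 * (\<Sum>w\<leftarrow>ws. \<Sum>e\<leftarrow>ws. (w \<bullet> e)\<^sup>2)"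
      by (simp add: sum_list_map_nth k_def w_def power_mult_distrib sum_distrib_left power2_eq_square mult_ac)
    also have "\<dots> \<le> (c * c)\<^sup>2 * (2 * real n)" using ws(2) by (intro mult_left_mono) auto
    also have "\<dots> = 2 / real n" unfolding c2 using n0 by (simp add: power2_eq_square)
    also have "\<dots> \<le> \<eta>\<^sup>2" using n n0 \<eta> by (simp add: field_simps)
    finally show ?thesis .
  qed
  moreover have "(\<Sum>i<k. Z (w i) \<bullet> w i - Z (\<pi> g (w i)) \<bullet> \<pi> g (w i)) \<le> \<eta>"
    if g: "g \<in> F" and Z: "linear Z" "\<And>x. norm (Z x) \<le> norm x" for g Z
  proof -
    have gG: "g \<in> carrier G" using g F(2) by blast
    have "(\<Sum>i<k. Z (w i) \<bullet> w i - Z (\<pi> g (w i)) \<bullet> \<pi> g (w i))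
      = (c * c) * (\<Sum>w\<leftarrow>ws. Z w \<bullet> w - Z (\<pi> g w) \<bullet> \<pi> g w)"
      unfolding sum_list_map_nth k_def w_def sum_distrib_left
      by (intro sum.cong refl)
        (simp add: linear_scale[OF Z(1)] linear_scale[OF linear[OF gG]] algebra_simps)
    also have "\<dots> \<le> (c * c) * (real n * \<eta>)" using ws(3)[OF g Z] by (intro mult_left_mono) auto
    also have "\<dots> = \<eta>" unfolding c2 using n0 by simp
    finally show ?thesis .
  qed
  ultimately show ?thesis by (intro exI[of _ k] exI[of _ w]) auto
qed

lemma amenable_imp_concentration:
  assumes am: "amenable_rep G \<pi>"
    and no_sub: "\<not> (\<exists>V. subrep G \<pi> V \<and> V \<noteq> {0} \<and> cfinite_dim V)"
  shows "concentration_property (sphere 0 1) G \<pi>"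
  unfolding concentration_property_def
proof (intro allI impI, rule ccontr)
  fix \<C> :: "'a set set"
  assume fin: "finite \<C>" and sub: "\<forall>A\<in>\<C>. A \<subseteq> sphere 0 1" and cov: "\<Union>\<C> = sphere 0 1"
    and non: "\<not> (\<exists>A\<in>\<C>. essential (sphere 0 1) G \<pi> A)"
  have "\<forall>A\<in>\<C>. \<exists>p. fst p > (0::real) \<and> finite (snd p) \<and> snd p \<subseteq> carrier G \<and>
      (\<Inter>g\<in>snd p. \<pi> g ` nbhd_in (sphere 0 1) (fst p) A) = {}"
  proof
    fix A assume "A \<in> \<C>"
    then have "\<not> essential (sphere 0 1) G \<pi> A" using non by blast
    then obtain \<epsilon> F where "\<epsilon> > 0" "finite F" "F \<subseteq> carrier G"
      "(\<Inter>g\<in>F. \<pi> g ` nbhd_in (sphere 0 1) \<epsilon> A) = {}"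
      unfolding essential_def by blast
    then show "\<exists>p. fst p > (0::real) \<and> finite (snd p) \<and> snd p \<subseteq> carrier G \<and>
        (\<Inter>g\<in>snd p. \<pi> g ` nbhd_in (sphere 0 1) (fst p) A) = {}"
      by (intro exI[of _ "(\<epsilon>, F)"]) simp
  qed
  from bchoice[OF this] obtain p where
    p: "\<forall>A\<in>\<C>. fst (p A) > (0::real) \<and> finite (snd (p A)) \<and> snd (p A) \<subseteq> carrier G \<and>
      (\<Inter>g\<in>snd (p A). \<pi> g ` nbhd_in (sphere 0 1) (fst (p A)) A) = {}" ..
  define \<epsilon> F where "\<epsilon> = (\<lambda>A. fst (p A))" and "F = (\<lambda>A. snd (p A))"
  have \<epsilon>: "\<epsilon> A > 0" and F: "finite (F A)" "F A \<subseteq> carrier G"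
    and empty: "(\<Inter>g\<in>F A. \<pi> g ` nbhd_in (sphere 0 1) (\<epsilon> A) A) = {}" if "A \<in> \<C>" for A
    using bspec[OF p that] by (simp_all add: \<epsilon>_def F_def)
  \<comment> \<open>Inverses, because z lies in the translate by g of a neighbourhood when the
    inverse of g moves z into that neighbourhood.\<close>
  define F0 where "F0 = (\<lambda>g. inv\<^bsub>G\<^esub> g) ` (\<Union>A\<in>\<C>. F A)"
  have F0: "finite F0" "F0 \<subseteq> carrier G" using fin F inv_closed by (auto simp: F0_def)
  \<comment> \<open>The concentration lemma gives distances below 4 \<tau>, which must not exceed
    any of the radii refuting essentiality; 1/2 is its own restriction on \<tau>.\<close>
  define \<tau> where "\<tau> = Min (insert (1 / 2) ((\<lambda>A. \<epsilon> A / 4) ` \<C>))"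
  have "\<tau> \<le> 1 / 2" unfolding \<tau>_def using fin by (intro Min_le) auto
  moreover have "0 < \<tau>" using fin \<epsilon> by (auto simp: \<tau>_def)
  ultimately have \<tau>: "0 < \<tau>" "\<tau> \<le> 1 / 2" by auto
  have \<tau>_le: "4 * \<tau> \<le> \<epsilon> A" if "A \<in> \<C>" for A
  proof -
    have "\<tau> \<le> \<epsilon> A / 4" unfolding \<tau>_def using fin that by (intro Min_le) auto
    then show ?thesis by simp
  qed
  define d where "d = 200 * (real (card \<C>) + 1) * (real (card F0) + 1)"
  have d: "d > 0" unfolding d_def by (intro mult_pos_pos add_nonneg_pos) auto
  \<comment> \<open>Divided by 6 because the permuted tuple loses that factor:
    \<open>6 * \<eta>\<close> is what the concentration lemma receives as its \<eta>.\<close>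
  define \<eta> where "\<eta> = \<tau>^4 / d / 6"
  have \<eta>: "\<eta> > 0" using \<tau> d by (simp add: \<eta>_def)
  obtain \<phi> where \<phi>: "op_state \<phi>"
    and inv: "\<And>g T. g \<in> carrier G \<Longrightarrow> bounded_clinear T \<Longrightarrow> \<phi> (\<pi> g \<circ> T \<circ> inv_into UNIV (\<pi> g)) = \<phi> T"
    using am unfolding amenable_rep_def by blast
  have rank: "\<phi> (rank_one v) = 0" for v
    by (rule invariant_state_rank_one[OF \<phi> inv no_sub])
  obtain k and w :: "nat \<Rightarrow> 'a" where w: "(\<Sum>i<k. (norm (w i))\<^sup>2) = 1" "(\<Sum>i<k. \<Sum>j<k. (w i \<bullet> w j)\<^sup>2) \<le> \<eta>\<^sup>2"
    "\<And>g Z. g \<in> F0 \<Longrightarrow> linear Z \<Longrightarrow> (\<And>x. norm (Z x) \<le> norm x) \<Longrightarrow>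
      (\<Sum>i<k. Z (w i) \<bullet> w i - Z (\<pi> g (w i)) \<bullet> \<pi> g (w i)) \<le> \<eta>"
    using almost_invariant_tuple[OF \<phi> inv rank F0 \<eta>] by auto
  have lin: "linear (\<pi> g)" and iso: "norm (\<pi> g x) = norm x" if "g \<in> F0" for g x
    using that F0(2) linear norm by auto
  have "\<exists>(X :: ((nat \<times> nat \<Rightarrow> real) \<times> nat) set) v \<sigma>. finite X \<and> (\<Sum>x\<in>X. (norm (v x))\<^sup>2) = 1 \<and>
      (\<forall>u. (\<Sum>x\<in>X. (u \<bullet> v x)\<^sup>2) \<le> \<eta> * (norm u)\<^sup>2) \<and>
      (\<forall>g\<in>F0. bij_betw (\<sigma> g) X X \<and> (\<Sum>x\<in>X. (norm (\<pi> g (v x) - v (\<sigma> g x)))\<^sup>2) \<le> 6 * \<eta>)"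
    by (rule almost_permuted_tuple[OF w(1,2) \<eta>]) (rule lin w(3); assumption)+
  then obtain X :: "((nat \<times> nat \<Rightarrow> real) \<times> nat) set" and v \<sigma> where
    *: "finite X \<and> (\<Sum>x\<in>X. (norm (v x))\<^sup>2) = 1 \<and> (\<forall>u. (\<Sum>x\<in>X. (u \<bullet> v x)\<^sup>2) \<le> \<eta> * (norm u)\<^sup>2) \<and>
      (\<forall>g\<in>F0. bij_betw (\<sigma> g) X X \<and> (\<Sum>x\<in>X. (norm (\<pi> g (v x) - v (\<sigma> g x)))\<^sup>2) \<le> 6 * \<eta>)"
    by (elim exE) (rule that)
  then have X: "finite X" "(\<Sum>x\<in>X. (norm (v x))\<^sup>2) = 1" by simp_all
  have perm: "bij_betw (\<sigma> g) X X" "(\<Sum>x\<in>X. (norm (\<pi> g (v x) - v (\<sigma> g x)))\<^sup>2) \<le> 6 * \<eta>" if "g \<in> F0" for g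
    using * that by simp_all
  have small: "(\<Sum>x\<in>X. (u \<bullet> v x)\<^sup>2) \<le> 6 * \<eta> * (norm u)\<^sup>2" for u
  proof -
    have "(\<Sum>x\<in>X. (u \<bullet> v x)\<^sup>2) \<le> \<eta> * (norm u)\<^sup>2" using * by simp
    also have "\<dots> \<le> 6 * \<eta> * (norm u)\<^sup>2" using \<eta> by (intro mult_right_mono) auto
    finally show ?thesis .
  qed
  have \<eta>_eq: "6 * \<eta> * (200 * (real (card \<C>) + 1) * (real (card F0) + 1)) = \<tau>^4"
  proof -
    have "6 * \<eta> * d = \<tau>^4" using d by (simp add: \<eta>_def)
    then show ?thesis by (simp only: d_def)
  qed
  have "\<exists>C\<in>\<C>. \<exists>z. norm z = 1 \<and> (\<forall>g\<in>F0. \<exists>a\<in>C. dist (\<pi> g z) a < 4 * \<tau>)"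
  proof (rule almost_permuted_concentration[OF X small F0(1) fin])
    show "sphere 0 1 \<subseteq> \<Union>\<C>" by (simp add: cov)
  qed (fact \<tau> \<eta>_eq | rule lin iso perm; assumption)+
  then obtain C z where C: "C \<in> \<C>" "norm z = 1" "\<And>g. g \<in> F0 \<Longrightarrow> \<exists>a\<in>C. dist (\<pi> g z) a < 4 * \<tau>"
    by blast
  have "z \<in> \<pi> g ` nbhd_in (sphere 0 1) (\<epsilon> C) C" if g: "g \<in> F C" for g
  proof -
    have gG: "g \<in> carrier G" using g F(2)[OF C(1)] by blast
    have "inv\<^bsub>G\<^esub> g \<in> F0" using g C(1) by (auto simp: F0_def)
    then obtain a where "a \<in> C" "dist (\<pi> (inv\<^bsub>G\<^esub> g) z) a < 4 * \<tau>" using C(3) by blast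
    moreover from this have "dist (\<pi> (inv\<^bsub>G\<^esub> g) z) a < \<epsilon> C" using \<tau>_le[OF C(1)] by linarith
    ultimately have "\<pi> (inv\<^bsub>G\<^esub> g) z \<in> nbhd_in (sphere 0 1) (\<epsilon> C) C"
      using norm[OF inv_closed[OF gG], of z] C(2) unfolding nbhd_in_def by auto
    then show ?thesis using inv_cancel(2)[OF gG] by (metis image_eqI)
  qed
  then show False using empty[OF C(1)] by blast
qed

end

theorem theorem7p5:
  fixes G :: "('g, 'm) monoid_scheme"
    and \<pi> :: "'g \<Rightarrow> 'a::complex_hilbert_space \<Rightarrow> 'a"
  assumes "group G"
    and "unitary_rep G \<pi>"
  shows "amenable_rep G \<pi> \<longleftrightarrow>
    (\<exists>V. subrep G \<pi> V \<and> V \<noteq> {0} \<and> cfinite_dim V) \<or>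
    concentration_property (sphere 0 1) G \<pi>"
proof -
  interpret unitary_representation G \<pi> by (rule unitary_representation.intro[OF assms])
  show ?thesis
    using amenable_imp_concentration finite_dim_subrep_imp_amenable concentration_imp_amenable by blast
qed

end
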